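(* Let $K$ and $H$ be Hopf algebras with bijective antipodes over a field $k$. Suppose that $T$ and $R$ are bialgebras in the categories ${}_K^K\mathcal{YD}$ and ${}_H^H\mathcal{YD}$ respectively and that $\tau : K\otimes H\longrightarrow k$ and $\beta : T\otimes R\longrightarrow k$ are linear forms, where $\tau$ satisfies (A.1)–(A.4), $\beta$ satisfies (B.1)–(B.4), and $\tau$ and $\beta$ satisfy (C.1)–(C.2) (all conditions listed in the context). Let $\beta\#\tau : (T\# K)\otimes(R\# H)\longrightarrow k$ be the linear form determined by $$(\beta\#\tau)(t\# k, r\# h) = \beta(t, S^{-1}(h_{(1)})\cdot r)\,\tau(k, h_{(2)})$$ for all $t\in T$, $k\in K$, $r\in R$ and $h\in H$, where $S$ is the antipode of $H$. Let $\varphi : R^{\underline{op}}\# H^{op}\to (R\# H)^{op}$ be the bialgebra isomorphism $\varphi(r\# h) = (1\# h)(r\# 1)$ (product in $R\# H$), and let $\vartheta : R^{\underline{op}\,\underline{o}}\# H^{op\,o}\to (R^{\underline{op}}\# H^{op})^o$ be the bialgebra isomorphism $\vartheta(p\# q) = p\otimes q$. Then: (a) $(\beta\#\tau)_\ell$ is the composite $$T\# K \xrightarrow{\ \beta_\ell\#\tau_\ell\ } R^{\underline{op}\,\underline{o}}\# H^{op\,o}\xrightarrow{\ \vartheta\ }(R^{\underline{op}}\# H^{op})^o\xrightarrow{\ (\varphi^{-1})^o\ }(R\# H)^{op\,o}.$$ Thus $\beta\#\tau$ satisfies (A.1)–(A.4) (with $U = T\# K$, $A = R\# H$). (b) $(\beta\#\tau)_\ell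 = (\varphi^{-1})^*\circ(\beta_\ell\otimes\tau_\ell)$ and $(\beta\#\tau)_r = (\beta_r\otimes\tau_r)\circ\varphi^{-1}$. (c) $\beta\#\tau$ is left (respectively right) non-singular if and only if $\beta$ and $\tau$ are left (respectively right) non-singular.
   Context: Everything is over a field $k$. For an ordinary coalgebra write $\Delta(c) = c_{(1)}\otimes c_{(2)}$; for a left comodule write $\delta(m) = m_{(-1)}\otimes m_{(0)}$. $A^{op}$ is $A$ with opposite multiplication; $A^o$ is the finite (Sweedler) dual bialgebra and $f^o$ is the restriction of the transpose $f^*$ to finite duals; $A^{op\,o} = (A^{op})^o$. Tensor products of dual spaces are regarded as subspaces of duals of tensor products in the usual way. Forms. For a linear form $\beta : U\otimes V\to k$ write $\beta(u,v) = \beta(u\otimes v)$; $\beta_\ell : U\to V^*$ and $\beta_r : V\to U^*$ are given by $\beta_\ell(u)(v) = \beta(u,v) = \beta_r(v)(u)$. $\beta$ is left (right) non-singular if $\beta_\ell$ ($\beta_r$) is one-one. Yetter–Drinfel'd modules. For a Hopf algebra $H$, ${}_H^H\mathcal{YD}$ is the category whose objects are left $H$-modules and left $H$-comodules $M$ with $h_{(1)}m_{(-1)}\otimes h_{(2)}\cdot m_{(0)} = (h_{(1)}\cdot m)_{(-1)}h_{(2)}\otimes (h_{(1)}\cdot m)_{(0)}$, and whose morphisms are module and comodule maps. It is monoidal with diagonal action and codiagonal coaction, with braiding $m\otimes n \mapsto m_{(-1)}\cdot n\otimes m_{(0)}$. The coproduct of a coalgebra in the category is written $\Delta(c) = c^{(1)}\otimes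 c^{(2)}$. A bialgebra in the category is an algebra and coalgebra $R$ in the category such that $\epsilon$ and $\Delta: R\to R\otimes R$ are algebra maps, where $(a\otimes b)(a'\otimes b') = a(b_{(-1)}\cdot a')\otimes b_{(0)}b'$. Bi-product. For a bialgebra $R$ in ${}_H^H\mathcal{YD}$, $R\# H$ is the $k$-bialgebra $R\otimes H$ (with $r\# h = r\otimes h$) with product $(r\# h)(r'\# h') = r(h_{(1)}\cdot r')\# h_{(2)}h'$, coproduct $\Delta(r\# h) = (r^{(1)}\# r^{(2)}_{\ (-1)}h_{(1)})\otimes(r^{(2)}_{\ (0)}\# h_{(2)})$, unit $1\#1$, counit $\epsilon\otimes\epsilon$. For linear maps, $(\psi\#\varphi)(r\# h) = \psi(r)\#\varphi(h)$. $R^{\underline{op}}$: for a bialgebra $R$ in ${}_H^H\mathcal{YD}$ ($S$ bijective), the bialgebra in ${}_{H^{op}}^{H^{op}}\mathcal{YD}$ with underlying vector space $R$, action $h\cdot_{op}r = S^{-1}(h)\cdot r$, same coaction, product $a\otimes b\mapsto ba$, same unit and counit, coproduct $r\mapsto r^{(2)}_{\ (-1)}\cdot_{op}r^{(1)}\otimes r^{(2)}_{\ (0)}$. $R^{\underline{o}}$: for a bialgebra $R$ in ${}_H^H\mathcal{YD}$, the set of functionals in $R^*$ vanishing on some cofinite subspace of $R$ that is both an ideal and a left $H$-submodule; it is a bialgebra in ${}_{H^o}^{H^o}\mathcal{YD}$ with coaction determined by $p_{(-1)}(h)p_{(0)}(r) = p(h\cdot r)$, action $(h^o\cdot p)(r)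 = h^o(r_{(-1)})p(r_{(0)})$, product $(pq)(r) = p(r^{(1)})q(r^{(2)})$, unit $\epsilon$, coproduct $p^{(1)}(r)p^{(2)}(r') = p(rr')$, counit $p\mapsto p(1)$. $R^{\underline{op}\,\underline{o}} = (R^{\underline{op}})^{\underline{o}}$ (formed with $H^{op}$ in place of $H$). Conditions. For bialgebras $U,A$ over $k$ and a form $\tau : U\otimes A\to k$: (A.1) $\tau(u,aa') = \tau(u_{(2)},a)\tau(u_{(1)},a')$; (A.2) $\tau(1,a) = \epsilon(a)$; (A.3) $\tau(uu',a) = \tau(u,a_{(1)})\tau(u',a_{(2)})$; (A.4) $\tau(u,1) = \epsilon(u)$. These are applied to $\tau : K\otimes H\to k$ with $U=K$, $A=H$. For $\beta : T\otimes R\to k$: (B.1) $\beta(tt',r) = \beta(t, S^{-1}(r^{(2)}_{\ (-1)})\cdot r^{(1)})\,\beta(t', r^{(2)}_{\ (0)})$; (B.2) $\beta(1,r) = \epsilon(r)$; (B.3) $\beta(t,rr') = \beta(t^{(2)},r)\beta(t^{(1)},r')$; (B.4) $\beta(t,1) = \epsilon(t)$. For $\tau : K\otimes H\to k$ and $\beta : T\otimes R\to k$: (C.1) $\beta(k\cdot t, r) = \beta(t, r\leftharpoonup\tau_\ell(k))$, where $r\leftharpoonup p = p(r_{(-1)})r_{(0)}$ for $p\in H^*$; (C.2) $\beta(t\leftharpoonup\tau_r(h), r) = \beta(t, S^{-1}(h)\cdot r)$, where $t\leftharpoonup p = p(t_{(-1)})t_{(0)}$ for $p\in K^*$. All identities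 are required for all elements of the relevant spaces; $S$ is the antipode of $H$. Under the hypotheses one has $\tau_\ell(K)\subseteq H^{op\,o}$ and $\beta_\ell(T)\subseteq R^{\underline{op}\,\underline{o}}$. *)

theory Defs
  imports Complex_Main "HOL-Library.Function_Algebras" "HOL-Library.FuncSet"
begin

section \<open>Vector spaces, linear maps and tensor products\<close>

text \<open>
  A vector space over the field \<open>'k\<close> is a linear subspace (the carrier) of an ambient
  vector space in the sense of \<^locale>\<open>vector_space\<close>.  Carriers are needed because finite duals
  and tensor products are subspaces of function spaces.
\<close>

record ('k, 'a) vspace =
  carrier :: "'a set"
  scal :: "'k \<Rightarrow> 'a \<Rightarrow> 'a"

definition is_vspace :: "('k::field, 'a::ab_group_add, 'm) vspace_scheme \<Rightarrow> bool" where
  "is_vspace V \<longleftrightarrow> vector_space (scal V) \<and> module.subspace (scal V) (carrier V)"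

definition field_space :: "('k::field, 'k) vspace" where
  "field_space = \<lparr>carrier = UNIV, scal = (*)\<rparr>"

definition linear_map ::
  "('k::field, 'a::ab_group_add, 'm) vspace_scheme \<Rightarrow> ('k, 'b::ab_group_add, 'n) vspace_scheme
    \<Rightarrow> ('a \<Rightarrow> 'b) \<Rightarrow> bool" where
  "linear_map V W f \<longleftrightarrow>
     f \<in> carrier V \<rightarrow> carrier W \<and>
     (\<forall>x\<in>carrier V. \<forall>y\<in>carrier V. f (x + y) = f x + f y) \<and>
     (\<forall>c. \<forall>x\<in>carrier V. f (scal V c x) = scal W c (f x))"

definition linear_form :: "('k::field, 'a::ab_group_add, 'm) vspace_scheme \<Rightarrow> ('a \<Rightarrow> 'k) \<Rightarrow> bool" where
  "linear_form V f \<longleftrightarrow> linear_map V field_space f"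

definition bilinear_map ::
  "('k::field, 'a::ab_group_add, 'm) vspace_scheme \<Rightarrow> ('k, 'b::ab_group_add, 'n) vspace_scheme
    \<Rightarrow> ('k, 'c::ab_group_add, 'l) vspace_scheme \<Rightarrow> ('a \<Rightarrow> 'b \<Rightarrow> 'c) \<Rightarrow> bool" where
  "bilinear_map U V W f \<longleftrightarrow>
     (\<forall>u\<in>carrier U. linear_map V W (f u)) \<and> (\<forall>v\<in>carrier V. linear_map U W (\<lambda>u. f u v))"

abbreviation fun_scal :: "'k::field \<Rightarrow> ('x \<Rightarrow> 'k) \<Rightarrow> 'x \<Rightarrow> 'k" where
  "fun_scal \<equiv> (\<lambda>c f x. c * f x)"

text \<open>
  The tensor product \<open>U \<otimes> V\<close> is realised inside the dual of the space of bilinear forms on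
  \<open>U \<times> V\<close>: \<open>u \<otimes> v\<close> is evaluation at \<open>(u, v)\<close>, and \<open>U \<otimes> V\<close> is the span of these evaluations.
  Over a field this is the usual tensor product; the universal property is proved below
  (\<open>sweedler_tens\<close>, \<open>linear_map_sweedler\<close>).
\<close>

type_synonym ('a, 'b, 'k) tensor = "('a \<Rightarrow> 'b \<Rightarrow> 'k) \<Rightarrow> 'k"

definition tens ::
  "('k::field, 'a::ab_group_add, 'm) vspace_scheme \<Rightarrow> ('k, 'b::ab_group_add, 'n) vspace_scheme
    \<Rightarrow> 'a \<Rightarrow> 'b \<Rightarrow> ('a, 'b, 'k) tensor" where
  "tens U V u v = (\<lambda>b. if bilinear_map U V field_space b then b u v else 0)"

definition tensor ::
  "('k::field, 'a::ab_group_add, 'm) vspace_scheme \<Rightarrow> ('k, 'b::ab_group_add, 'n) vspace_scheme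
    \<Rightarrow> ('k, ('a, 'b, 'k) tensor) vspace" where
  "tensor U V =
     \<lparr>carrier = module.span fun_scal {tens U V u v | u v. u \<in> carrier U \<and> v \<in> carrier V},
      scal = fun_scal\<rparr>"

text \<open>
  \<open>sweedler U V x f\<close> is the sum of all \<open>f u v\<close> where \<open>x\<close> is written as a finite sum of tensors
  \<open>u \<otimes> v\<close>, i.e. the linear map on \<open>U \<otimes> V\<close> induced by \<open>f\<close>, evaluated at \<open>x\<close>.  For bilinear
  \<open>f\<close> it does not depend on the representation of \<open>x\<close>.
  Thus \<open>sweedler C C (\<Delta> c) f\<close> is \<open>f(c\<^sub>(\<^sub>1\<^sub>), c\<^sub>(\<^sub>2\<^sub>))\<close> in Sweedler's notation.
\<close>

definition sweedler ::
  "('k::field, 'a::ab_group_add, 'm) vspace_scheme \<Rightarrow> ('k, 'b::ab_group_add, 'n) vspace_scheme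
    \<Rightarrow> ('a, 'b, 'k) tensor \<Rightarrow> ('a \<Rightarrow> 'b \<Rightarrow> 'c::ab_group_add) \<Rightarrow> 'c" where
  "sweedler U V x f =
     (let ps = (SOME ps. set ps \<subseteq> carrier U \<times> carrier V \<and> x = (\<Sum>(u, v)\<leftarrow>ps. tens U V u v))
      in \<Sum>(u, v)\<leftarrow>ps. f u v)"

definition tensor_map ::
  "('k::field, 'a::ab_group_add, 'm) vspace_scheme \<Rightarrow> ('k, 'b::ab_group_add, 'n) vspace_scheme
    \<Rightarrow> ('k, 'c::ab_group_add, 'p) vspace_scheme \<Rightarrow> ('k, 'd::ab_group_add, 'q) vspace_scheme
    \<Rightarrow> ('a \<Rightarrow> 'c) \<Rightarrow> ('b \<Rightarrow> 'd) \<Rightarrow> ('a, 'b, 'k) tensor \<Rightarrow> ('c, 'd, 'k) tensor" where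
  "tensor_map U V U' V' f g x = sweedler U V x (\<lambda>u v. tens U' V' (f u) (g v))"


subsection \<open>The universal property\<close>

lemma linear_map_scaleD: "linear_map V W f \<Longrightarrow> x \<in> carrier V \<Longrightarrow> f (scal V c x) = scal W c (f x)"
  by (simp add: linear_map_def)

lemma vector_space_fun: "vector_space (fun_scal :: 'k::field \<Rightarrow> ('x \<Rightarrow> 'k) \<Rightarrow> _)"
  by unfold_locales (auto simp: fun_eq_iff algebra_simps)

lemma module_fun: "module (fun_scal :: 'k::field \<Rightarrow> ('x \<Rightarrow> 'k) \<Rightarrow> _)"
  by unfold_locales (auto simp: fun_eq_iff algebra_simps)

lemma is_vspace_tensor: "is_vspace (tensor U V)"
  by (simp add: is_vspace_def tensor_def vector_space_fun module.subspace_span[OF module_fun])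

lemma module_of_vspace: "is_vspace V \<Longrightarrow> module (scal V)"
  by (simp add: is_vspace_def module_iff_vector_space)

lemma separating_form:
  assumes "vector_space (s :: 'k::field \<Rightarrow> 'w::ab_group_add \<Rightarrow> 'w)" "w \<noteq> 0"
  shows "\<exists>g. (\<forall>x y. g (x + y) = g x + g y) \<and> (\<forall>c x. g (s c x) = c * g x) \<and> g w \<noteq> (0::'k)"
proof -
  interpret vector_space s by fact
  have ind: "independent {w}" using assms(2) by (simp add: dependent_single)
  define B where "B = extend_basis {w}"
  have B: "independent B" "span B = UNIV" "w \<in> B"
    using independent_extend_basis[OF ind] span_extend_basis[OF ind] extend_basis_superset[OF ind]
    by (auto simp: B_def)
  have "representation B w w = 1" using representation_basis[OF B(1,3)] by simp
  moreover have "representation B (x + y) w = representation B x w + representation B y w" for x y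
    using representation_add[OF B(1)] B(2) by simp
  moreover have "representation B (s c x) w = c * representation B x w" for c x
    using representation_scale[OF B(1)] B(2) by simp
  ultimately show ?thesis by (intro exI[of _ "\<lambda>v. representation B v w"]) simp
qed

lemma sum_list_fun_apply: "(\<Sum>x\<leftarrow>xs. f x) b = (\<Sum>x\<leftarrow>xs. f x b)"
  for f :: "'a \<Rightarrow> 'b \<Rightarrow> 'c::ab_group_add"
  by (induction xs) auto

lemma sum_list_tens_apply:
  assumes "bilinear_map U V field_space b"
  shows "(\<Sum>(u, v)\<leftarrow>ps. tens U V u v) b = (\<Sum>(u, v)\<leftarrow>ps. b u v)"
  using assms by (induction ps) (auto simp: tens_def)

lemma sweedler_unique:
  assumes "is_vspace W" and f: "bilinear_map U V W f"
    and ps: "set ps \<subseteq> carrier U \<times> carrier V" and qs: "set qs \<subseteq> carrier U \<times> carrier V"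
    and eq: "(\<Sum>(u, v)\<leftarrow>ps. tens U V u v) = (\<Sum>(u, v)\<leftarrow>qs. tens U V u v)"
  shows "(\<Sum>(u, v)\<leftarrow>ps. f u v) = (\<Sum>(u, v)\<leftarrow>qs. f u v)"
proof (rule ccontr)
  let ?w = "(\<Sum>(u, v)\<leftarrow>ps. f u v) - (\<Sum>(u, v)\<leftarrow>qs. f u v)"
  assume "\<not> ?thesis"
  hence "?w \<noteq> 0" by simp
  moreover have "vector_space (scal W)" using assms(1) by (simp add: is_vspace_def)
  ultimately obtain g where g: "\<And>x y. g (x + y) = g x + g y" "\<And>c x. g (scal W c x) = c * g x" "g ?w \<noteq> 0"
    using separating_form by blast
  have g0: "g 0 = 0" using g(1)[of 0 0] by (metis add_0 add_right_cancel)
  have gd: "g (x - y) = g x - g y" for x y using g(1)[of "x - y" y] by simp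
  have gs: "g (\<Sum>(u, v)\<leftarrow>rs. f u v) = (\<Sum>(u, v)\<leftarrow>rs. g (f u v))" for rs
    by (induction rs) (auto simp: g g0)
  have "bilinear_map U V field_space (\<lambda>u v. g (f u v))"
    using f by (auto simp: bilinear_map_def linear_map_def field_space_def g)
  from sum_list_tens_apply[OF this] eq have "g ?w = 0"
    by (metis gd gs cancel_comm_monoid_add_class.diff_cancel)
  with g(3) show False ..
qed

lemma bilinear_tens: 
  assumes "u \<in> carrier U" "v \<in> carrier V" "is_vspace U" "is_vspace V"
  shows "tens U V (scal U c u) v = (\<lambda>b. c * tens U V u v b)"
  using assms by (auto simp: tens_def fun_eq_iff bilinear_map_def linear_map_def field_space_def)

lemma tensor_rep:
  assumes "is_vspace U" "is_vspace V" "x \<in> carrier (tensor U V)"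
  shows "\<exists>ps. set ps \<subseteq> carrier U \<times> carrier V \<and> x = (\<Sum>(u, v)\<leftarrow>ps. tens U V u v)"
proof -
  let ?S = "{tens U V u v | u v. u \<in> carrier U \<and> v \<in> carrier V}"
  have "x \<in> module.span fun_scal ?S" using assms(3) by (simp add: tensor_def)
  thus ?thesis
  proof (induction rule: module.span_induct_alt[OF module_fun, consumes 1])
    case 1
    show ?case by (intro exI[of _ "[]"]) simp
  next
    case (2 c a y)
    then obtain ps where ps: "set ps \<subseteq> carrier U \<times> carrier V" "y = (\<Sum>(u, v)\<leftarrow>ps. tens U V u v)" by blast
    from 2 obtain u v where uv: "u \<in> carrier U" "v \<in> carrier V" "a = tens U V u v" by blast
    have cu: "scal U c u \<in> carrier U" using assms(1) uv module_of_vspace[OF assms(1)]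
      by (auto simp: is_vspace_def module.subspace_def)
    show ?case using ps uv cu bilinear_tens[OF uv(1,2) assms(1,2)]
      by (intro exI[of _ "(scal U c u, v) # ps"]) auto
  qed
qed

lemma sweedler_eq:
  assumes "is_vspace W" "bilinear_map U V W f"
    and "set ps \<subseteq> carrier U \<times> carrier V" "x = (\<Sum>(u, v)\<leftarrow>ps. tens U V u v)"
  shows "sweedler U V x f = (\<Sum>(u, v)\<leftarrow>ps. f u v)"
proof -
  define qs where
    "qs = (SOME ps. set ps \<subseteq> carrier U \<times> carrier V \<and> x = (\<Sum>(u, v)\<leftarrow>ps. tens U V u v))"
  have "set qs \<subseteq> carrier U \<times> carrier V \<and> x = (\<Sum>(u, v)\<leftarrow>qs. tens U V u v)"
    unfolding qs_def by (rule someI[of _ ps]) (use assms in blast)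
  hence "(\<Sum>(u, v)\<leftarrow>qs. f u v) = (\<Sum>(u, v)\<leftarrow>ps. f u v)"
    by (intro sweedler_unique[OF assms(1,2)]) (use assms(3,4) in auto)
  thus ?thesis unfolding sweedler_def Let_def qs_def .
qed

lemma sweedler_tens:
  assumes "is_vspace W" "bilinear_map U V W f" "u \<in> carrier U" "v \<in> carrier V"
  shows "sweedler U V (tens U V u v) f = f u v"
  using sweedler_eq[OF assms(1,2), of "[(u, v)]"] assms(3,4) by simp

lemma linear_map_sweedler:
  assumes U: "is_vspace U" and V: "is_vspace V" and W: "is_vspace W" and f: "bilinear_map U V W f"
  shows "linear_map (tensor U V) W (\<lambda>x. sweedler U V x f)"
proof -
  interpret W: module "scal W" by (rule module_of_vspace[OF W])
  have sub: "W.subspace (carrier W)" using W by (simp add: is_vspace_def)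
  have mem: "(\<Sum>(u, v)\<leftarrow>ps. f u v) \<in> carrier W" if "set ps \<subseteq> carrier U \<times> carrier V" for ps
    using that f by (induction ps)
      (auto simp: W.subspace_0[OF sub] W.subspace_add[OF sub] bilinear_map_def linear_map_def Pi_iff)
  have 1: "sweedler U V x f \<in> carrier W" if "x \<in> carrier (tensor U V)" for x
    using tensor_rep[OF U V that] sweedler_eq[OF W f] mem by metis
  have 2: "sweedler U V (x + y) f = sweedler U V x f + sweedler U V y f"
    if "x \<in> carrier (tensor U V)" "y \<in> carrier (tensor U V)" for x y
  proof -
    obtain ps qs where
      "set ps \<subseteq> carrier U \<times> carrier V" "x = (\<Sum>(u, v)\<leftarrow>ps. tens U V u v)"
      "set qs \<subseteq> carrier U \<times> carrier V" "y = (\<Sum>(u, v)\<leftarrow>qs. tens U V u v)"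
      using tensor_rep[OF U V] \<open>x \<in> _\<close> \<open>y \<in> _\<close> by metis
    thus ?thesis
      using sweedler_eq[OF W f, of ps x] sweedler_eq[OF W f, of qs y]
        sweedler_eq[OF W f, of "ps @ qs" "x + y"] by simp
  qed
  have 3: "sweedler U V (scal (tensor U V) c x) f = scal W c (sweedler U V x f)"
    if "x \<in> carrier (tensor U V)" for c x
  proof -
    obtain ps where ps: "set ps \<subseteq> carrier U \<times> carrier V" "x = (\<Sum>(u, v)\<leftarrow>ps. tens U V u v)"
      using tensor_rep[OF U V \<open>x \<in> _\<close>] by metis
    let ?qs = "map (\<lambda>(u, v). (scal U c u, v)) ps"
    have qs: "set ?qs \<subseteq> carrier U \<times> carrier V"
      using ps(1) U module_of_vspace[OF U] by (auto simp: is_vspace_def module.subspace_def)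
    have *: "fun_scal c (\<Sum>(u, v)\<leftarrow>ps. tens U V u v) = (\<Sum>(u, v)\<leftarrow>?qs. tens U V u v)"
      using ps(1)
    proof (induction ps)
      case (Cons p ps)
      obtain u v where p: "p = (u, v)" by (cases p)
      have "tens U V (scal U c u) v = (\<lambda>b. c * tens U V u v b)"
        using Cons.prems p by (intro bilinear_tens U V) auto
      moreover have "(\<lambda>b. c * (\<Sum>(u, v)\<leftarrow>ps. tens U V u v) b)
          = (\<Sum>(u, v)\<leftarrow>map (\<lambda>(u, v). (scal U c u, v)) ps. tens U V u v)"
        using Cons by auto
      ultimately show ?case by (simp add: p fun_eq_iff distrib_left)
    qed (simp add: fun_eq_iff)
    have **: "scal W c (\<Sum>(u, v)\<leftarrow>ps. f u v) = (\<Sum>(u, v)\<leftarrow>?qs. f u v)"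
      using ps(1) f
      by (induction ps) (auto simp: W.scale_right_distrib bilinear_map_def linear_map_def)
    have "scal (tensor U V) c x = (\<Sum>(u, v)\<leftarrow>?qs. tens U V u v)"
      using * ps(2) by (simp add: tensor_def)
    from sweedler_eq[OF W f qs this] sweedler_eq[OF W f ps] ** show ?thesis by simp
  qed
  from 1 2 3 show ?thesis by (auto simp: linear_map_def)
qed


section \<open>Bialgebras and Hopf algebras\<close>

record ('k, 'a) bialg = "('k, 'a) vspace" +
  mult :: "'a \<Rightarrow> 'a \<Rightarrow> 'a"
  unit :: 'a
  comult :: "'a \<Rightarrow> ('a, 'a, 'k) tensor"
  counit :: "'a \<Rightarrow> 'k"

record ('k, 'a) hopf = "('k, 'a) bialg" +
  antipode :: "'a \<Rightarrow> 'a"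

definition algebra :: "('k::field, 'a::ab_group_add, 'm) bialg_scheme \<Rightarrow> bool" where
  "algebra A \<longleftrightarrow> is_vspace A \<and> bilinear_map A A A (mult A) \<and> unit A \<in> carrier A \<and>
     (\<forall>a\<in>carrier A. \<forall>b\<in>carrier A. \<forall>c\<in>carrier A. mult A (mult A a b) c = mult A a (mult A b c)) \<and>
     (\<forall>a\<in>carrier A. mult A (unit A) a = a \<and> mult A a (unit A) = a)"

definition coalgebra :: "('k::field, 'a::ab_group_add, 'm) bialg_scheme \<Rightarrow> bool" where
  "coalgebra C \<longleftrightarrow> is_vspace C \<and> linear_map C (tensor C C) (comult C) \<and> linear_form C (counit C) \<and>
     (\<forall>c\<in>carrier C.
        sweedler C C (comult C c)
          (\<lambda>a b. sweedler C C (comult C a) (\<lambda>a\<^sub>1 a\<^sub>2. tens C (tensor C C) a\<^sub>1 (tens C C a\<^sub>2 b)))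
        = sweedler C C (comult C c) (\<lambda>a b. tens C (tensor C C) a (comult C b))) \<and>
     (\<forall>c\<in>carrier C. sweedler C C (comult C c) (\<lambda>a b. scal C (counit C a) b) = c \<and>
        sweedler C C (comult C c) (\<lambda>a b. scal C (counit C b) a) = c)"

definition bialgebra :: "('k::field, 'a::ab_group_add, 'm) bialg_scheme \<Rightarrow> bool" where
  "bialgebra A \<longleftrightarrow> algebra A \<and> coalgebra A \<and>
     (\<forall>a\<in>carrier A. \<forall>b\<in>carrier A. comult A (mult A a b) =
        sweedler A A (comult A a) (\<lambda>a\<^sub>1 a\<^sub>2. sweedler A A (comult A b) (\<lambda>b\<^sub>1 b\<^sub>2.
          tens A A (mult A a\<^sub>1 b\<^sub>1) (mult A a\<^sub>2 b\<^sub>2)))) \<and>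
     comult A (unit A) = tens A A (unit A) (unit A) \<and>
     (\<forall>a\<in>carrier A. \<forall>b\<in>carrier A. counit A (mult A a b) = counit A a * counit A b) \<and>
     counit A (unit A) = 1"

definition hopf_algebra :: "('k::field, 'a::ab_group_add, 'm) hopf_scheme \<Rightarrow> bool" where
  "hopf_algebra H \<longleftrightarrow> bialgebra H \<and> linear_map H H (antipode H) \<and>
     (\<forall>h\<in>carrier H.
        sweedler H H (comult H h) (\<lambda>h\<^sub>1 h\<^sub>2. mult H (antipode H h\<^sub>1) h\<^sub>2) = scal H (counit H h) (unit H) \<and>
        sweedler H H (comult H h) (\<lambda>h\<^sub>1 h\<^sub>2. mult H h\<^sub>1 (antipode H h\<^sub>2)) = scal H (counit H h) (unit H))"

definition bijective_antipode :: "('k::field, 'a::ab_group_add, 'm) hopf_scheme \<Rightarrow> bool" where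
  "bijective_antipode H \<longleftrightarrow> bij_betw (antipode H) (carrier H) (carrier H)"

definition antipode_inv :: "('k::field, 'a::ab_group_add, 'm) hopf_scheme \<Rightarrow> 'a \<Rightarrow> 'a" where
  "antipode_inv H = inv_into (carrier H) (antipode H)"

definition op_bialg :: "('k::field, 'a::ab_group_add, 'm) bialg_scheme \<Rightarrow> ('k, 'a) bialg" where
  "op_bialg A = \<lparr>carrier = carrier A, scal = scal A, mult = (\<lambda>a b. mult A b a), unit = unit A,
     comult = comult A, counit = counit A\<rparr>"


section \<open>Duals and finite duals\<close>

text \<open>Functionals on a carrier are normalised to vanish outside of it, so that equality of
  functionals on the carrier is equality of functions.\<close>

definition zero_outside :: "('k::field, 'a, 'm) vspace_scheme \<Rightarrow> ('a \<Rightarrow> 'k) \<Rightarrow> 'a \<Rightarrow> 'k" where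
  "zero_outside V f = (\<lambda>x. if x \<in> carrier V then f x else 0)"

definition dual_space ::
  "('k::field, 'a::ab_group_add, 'm) vspace_scheme \<Rightarrow> ('k, 'a \<Rightarrow> 'k) vspace" where
  "dual_space V = \<lparr>carrier = {f. linear_form V f \<and> (\<forall>x. x \<notin> carrier V \<longrightarrow> f x = 0)}, scal = fun_scal\<rparr>"

text \<open>The transpose of \<open>f : V \<rightarrow> W\<close>, as a map from the dual of \<open>W\<close> to the dual of \<open>V\<close>.\<close>

definition transpose ::
  "('k::field, 'a::ab_group_add, 'm) vspace_scheme \<Rightarrow> ('a \<Rightarrow> 'b) \<Rightarrow> ('b \<Rightarrow> 'k) \<Rightarrow> 'a \<Rightarrow> 'k" where
  "transpose V f p = zero_outside V (\<lambda>x. p (f x))"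

text \<open>The identification of tensors of functionals on \<open>U\<close> and \<open>V\<close> with functionals on \<open>U \<otimes> V\<close>;
  \<open>P\<close> and \<open>Q\<close> are subspaces of the duals of \<open>U\<close> and \<open>V\<close>.\<close>

definition tensor_functional ::
  "('k::field, 'a \<Rightarrow> 'k, 'm) vspace_scheme \<Rightarrow> ('k, 'b \<Rightarrow> 'k, 'n) vspace_scheme
    \<Rightarrow> ('k, 'a::ab_group_add, 'p) vspace_scheme \<Rightarrow> ('k, 'b::ab_group_add, 'q) vspace_scheme
    \<Rightarrow> ('a \<Rightarrow> 'k, 'b \<Rightarrow> 'k, 'k) tensor \<Rightarrow> ('a, 'b, 'k) tensor \<Rightarrow> 'k" where
  "tensor_functional P Q U V x =
     zero_outside (tensor U V) (\<lambda>y. sweedler P Q x (\<lambda>p q. sweedler U V y (\<lambda>u v. p u * q v)))"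

definition ideal :: "('k::field, 'a::ab_group_add, 'm) bialg_scheme \<Rightarrow> 'a set \<Rightarrow> bool" where
  "ideal A I \<longleftrightarrow> module.subspace (scal A) I \<and> I \<subseteq> carrier A \<and>
     (\<forall>a\<in>carrier A. \<forall>x\<in>I. mult A a x \<in> I \<and> mult A x a \<in> I)"

text \<open>Finite codimension: finitely many vectors together with \<open>I\<close> span the space.\<close>

definition cofinite :: "('k::field, 'a::ab_group_add, 'm) vspace_scheme \<Rightarrow> 'a set \<Rightarrow> bool" where
  "cofinite V I \<longleftrightarrow> module.subspace (scal V) I \<and> I \<subseteq> carrier V \<and>
     (\<exists>F. finite F \<and> F \<subseteq> carrier V \<and> module.span (scal V) (F \<union> I) = carrier V)"

definition finite_dual_space ::
  "('k::field, 'a::ab_group_add, 'm) bialg_scheme \<Rightarrow> ('k, 'a \<Rightarrow> 'k) vspace" where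
  "finite_dual_space A = \<lparr>carrier = {f \<in> carrier (dual_space A).
     \<exists>I. ideal A I \<and> cofinite A I \<and> (\<forall>x\<in>I. f x = 0)}, scal = fun_scal\<rparr>"

definition finite_dual ::
  "('k::field, 'a::ab_group_add, 'm) bialg_scheme \<Rightarrow> ('k, 'a \<Rightarrow> 'k) bialg" where
  "finite_dual A = (let D = finite_dual_space A in
     \<lparr>carrier = carrier D, scal = fun_scal,
      mult = (\<lambda>p q. zero_outside A (\<lambda>a. sweedler A A (comult A a) (\<lambda>a\<^sub>1 a\<^sub>2. p a\<^sub>1 * q a\<^sub>2))),
      unit = zero_outside A (counit A),
      comult = (\<lambda>p. THE x. x \<in> carrier (tensor D D) \<and>
        (\<forall>a\<in>carrier A. \<forall>b\<in>carrier A. sweedler D D x (\<lambda>p\<^sub>1 p\<^sub>2. p\<^sub>1 a * p\<^sub>2 b) = p (mult A a b))),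
      counit = (\<lambda>p. p (unit A))\<rparr>)"

definition finite_dual_map ::
  "('k::field, 'a::ab_group_add, 'm) bialg_scheme \<Rightarrow> ('k, 'b::ab_group_add, 'n) bialg_scheme
    \<Rightarrow> ('a \<Rightarrow> 'b) \<Rightarrow> ('b \<Rightarrow> 'k) \<Rightarrow> 'a \<Rightarrow> 'k" where
  "finite_dual_map A B f = restrict (transpose A f) (carrier (finite_dual B))"


section \<open>Bialgebras in Yetter-Drinfel'd categories\<close>

record ('k, 'm, 'h) ydmod = "('k, 'm) vspace" +
  act :: "'h \<Rightarrow> 'm \<Rightarrow> 'm"
  coact :: "'m \<Rightarrow> ('h, 'm, 'k) tensor"

definition yd_module ::
  "('k::field, 'h::ab_group_add, 'n) bialg_scheme \<Rightarrow> ('k, 'm::ab_group_add, 'h) ydmod \<Rightarrow> bool" where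
  "yd_module H M \<longleftrightarrow> is_vspace M \<and>
     bilinear_map H M M (act M) \<and>
     (\<forall>m\<in>carrier M. act M (unit H) m = m) \<and>
     (\<forall>g\<in>carrier H. \<forall>h\<in>carrier H. \<forall>m\<in>carrier M. act M (mult H g h) m = act M g (act M h m)) \<and>
     linear_map M (tensor H M) (coact M) \<and>
     (\<forall>m\<in>carrier M.
        sweedler H M (coact M m)
          (\<lambda>g n. sweedler H H (comult H g) (\<lambda>g\<^sub>1 g\<^sub>2. tens H (tensor H M) g\<^sub>1 (tens H M g\<^sub>2 n)))
        = sweedler H M (coact M m) (\<lambda>g n. tens H (tensor H M) g (coact M n))) \<and>
     (\<forall>m\<in>carrier M. sweedler H M (coact M m) (\<lambda>g n. scal M (counit H g) n) = m) \<and>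
     (\<forall>h\<in>carrier H. \<forall>m\<in>carrier M.
        sweedler H H (comult H h) (\<lambda>h\<^sub>1 h\<^sub>2. sweedler H M (coact M m) (\<lambda>g n.
          tens H M (mult H h\<^sub>1 g) (act M h\<^sub>2 n)))
        = sweedler H H (comult H h) (\<lambda>h\<^sub>1 h\<^sub>2. sweedler H M (coact M (act M h\<^sub>1 m)) (\<lambda>g n.
          tens H M (mult H g h\<^sub>2) n)))"

definition yd_hom ::
  "('k::field, 'h::ab_group_add, 'n) bialg_scheme \<Rightarrow> ('k, 'a::ab_group_add, 'h) ydmod
    \<Rightarrow> ('k, 'b::ab_group_add, 'h) ydmod \<Rightarrow> ('a \<Rightarrow> 'b) \<Rightarrow> bool" where
  "yd_hom H M N f \<longleftrightarrow> linear_map M N f \<and>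
     (\<forall>h\<in>carrier H. \<forall>m\<in>carrier M. f (act M h m) = act N h (f m)) \<and>
     (\<forall>m\<in>carrier M. coact N (f m) = sweedler H M (coact M m) (\<lambda>g n. tens H N g (f n)))"

definition yd_tensor ::
  "('k::field, 'h::ab_group_add, 'n) bialg_scheme \<Rightarrow> ('k, 'a::ab_group_add, 'h) ydmod
    \<Rightarrow> ('k, 'b::ab_group_add, 'h) ydmod \<Rightarrow> ('k, ('a, 'b, 'k) tensor, 'h) ydmod" where
  "yd_tensor H M N =
     \<lparr>carrier = carrier (tensor M N), scal = fun_scal,
      act = (\<lambda>h x. sweedler M N x (\<lambda>m n. sweedler H H (comult H h) (\<lambda>h\<^sub>1 h\<^sub>2.
        tens M N (act M h\<^sub>1 m) (act N h\<^sub>2 n)))),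
      coact = (\<lambda>x. sweedler M N x (\<lambda>m n. sweedler H M (coact M m) (\<lambda>g m'.
        sweedler H N (coact N n) (\<lambda>g' n'. tens H (tensor M N) (mult H g g') (tens M N m' n')))))\<rparr>"

definition yd_unit :: "('k::field, 'h::ab_group_add, 'n) bialg_scheme \<Rightarrow> ('k, 'k, 'h) ydmod" where
  "yd_unit H = \<lparr>carrier = UNIV, scal = (*), act = (\<lambda>h c. counit H h * c),
     coact = (\<lambda>c. tens H field_space (unit H) c)\<rparr>"

record ('k, 'r, 'h) ydbialg = "('k, 'r) bialg" +
  yact :: "'h \<Rightarrow> 'r \<Rightarrow> 'r"
  ycoact :: "'r \<Rightarrow> ('h, 'r, 'k) tensor"

definition yd_of :: "('k, 'r, 'h) ydbialg \<Rightarrow> ('k, 'r, 'h) ydmod" where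
  "yd_of R = \<lparr>carrier = carrier R, scal = scal R, act = yact R, coact = ycoact R\<rparr>"

definition braided_mult ::
  "('k::field, 'h::ab_group_add, 'n) bialg_scheme \<Rightarrow> ('k, 'r::ab_group_add, 'h) ydbialg
    \<Rightarrow> ('r, 'r, 'k) tensor \<Rightarrow> ('r, 'r, 'k) tensor \<Rightarrow> ('r, 'r, 'k) tensor" where
  "braided_mult H R x y =
     sweedler R R x (\<lambda>a b. sweedler R R y (\<lambda>a' b'. sweedler H R (ycoact R b) (\<lambda>g b\<^sub>0.
       tens R R (mult R a (yact R g a')) (mult R b\<^sub>0 b'))))"

definition yd_bialgebra ::
  "('k::field, 'h::ab_group_add, 'n) bialg_scheme \<Rightarrow> ('k, 'r::ab_group_add, 'h) ydbialg \<Rightarrow> bool" where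
  "yd_bialgebra H R \<longleftrightarrow> yd_module H (yd_of R) \<and>
     algebra R \<and>
     yd_hom H (yd_tensor H (yd_of R) (yd_of R)) (yd_of R) (\<lambda>x. sweedler R R x (mult R)) \<and>
     yd_hom H (yd_unit H) (yd_of R) (\<lambda>c. scal R c (unit R)) \<and>
     coalgebra R \<and>
     yd_hom H (yd_of R) (yd_tensor H (yd_of R) (yd_of R)) (comult R) \<and>
     yd_hom H (yd_of R) (yd_unit H) (counit R) \<and>
     (\<forall>a\<in>carrier R. \<forall>b\<in>carrier R.
        comult R (mult R a b) = braided_mult H R (comult R a) (comult R b)) \<and>
     comult R (unit R) = tens R R (unit R) (unit R) \<and>
     (\<forall>a\<in>carrier R. \<forall>b\<in>carrier R. counit R (mult R a b) = counit R a * counit R b) \<and>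
     counit R (unit R) = 1"

text \<open>The bi-product \<open>R # H\<close>; \<open>r # h\<close> is \<open>tens R H r h\<close>, and \<open>\<psi> # \<phi>\<close> is \<^const>\<open>tensor_map\<close>.\<close>

definition biproduct ::
  "('k, 'r, 'h) ydbialg \<Rightarrow> ('k::field, 'h::ab_group_add, 'n) bialg_scheme
    \<Rightarrow> ('k, ('r::ab_group_add, 'h, 'k) tensor) bialg" where
  "biproduct R H =
     \<lparr>carrier = carrier (tensor R H), scal = fun_scal,
      mult = (\<lambda>x y. sweedler R H x (\<lambda>r h. sweedler R H y (\<lambda>r' h'.
        sweedler H H (comult H h) (\<lambda>h\<^sub>1 h\<^sub>2. tens R H (mult R r (yact R h\<^sub>1 r')) (mult H h\<^sub>2 h'))))),
      unit = tens R H (unit R) (unit H),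
      comult = (\<lambda>x. sweedler R H x (\<lambda>r h. sweedler R R (comult R r) (\<lambda>r\<^sub>1 r\<^sub>2.
        sweedler H R (ycoact R r\<^sub>2) (\<lambda>g r\<^sub>2'. sweedler H H (comult H h) (\<lambda>h\<^sub>1 h\<^sub>2.
          tens (tensor R H) (tensor R H) (tens R H r\<^sub>1 (mult H g h\<^sub>1)) (tens R H r\<^sub>2' h\<^sub>2)))))),
      counit = (\<lambda>x. sweedler R H x (\<lambda>r h. counit R r * counit H h))\<rparr>"

definition yd_op ::
  "('k::field, 'h::ab_group_add, 'n) hopf_scheme \<Rightarrow> ('k, 'r::ab_group_add, 'h) ydbialg
    \<Rightarrow> ('k, 'r, 'h) ydbialg" where
  "yd_op H R =
     \<lparr>carrier = carrier R, scal = scal R, mult = (\<lambda>a b. mult R b a), unit = unit R,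
      comult = (\<lambda>r. sweedler R R (comult R r) (\<lambda>r\<^sub>1 r\<^sub>2. sweedler H R (ycoact R r\<^sub>2) (\<lambda>g r\<^sub>2'.
        tens R R (yact R (antipode_inv H g) r\<^sub>1) r\<^sub>2'))),
      counit = counit R,
      yact = (\<lambda>h r. yact R (antipode_inv H h) r),
      ycoact = ycoact R\<rparr>"

text \<open>A bialgebra over \<open>H\<^sup>o\<close>.  The coproduct and coaction are the unique tensors of functionals
  representing \<open>p(r r')\<close> and \<open>p(h \<cdot> r)\<close>, respectively.\<close>

definition yd_dual_space ::
  "('k::field, 'h::ab_group_add, 'n) bialg_scheme \<Rightarrow> ('k, 'r::ab_group_add, 'h) ydbialg
    \<Rightarrow> ('k, 'r \<Rightarrow> 'k) vspace" where
  "yd_dual_space H R = \<lparr>carrier = {p \<in> carrier (dual_space R).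
     \<exists>I. ideal R I \<and> (\<forall>h\<in>carrier H. \<forall>x\<in>I. yact R h x \<in> I) \<and> cofinite R I \<and> (\<forall>x\<in>I. p x = 0)},
     scal = fun_scal\<rparr>"

definition yd_dual ::
  "('k::field, 'h::ab_group_add, 'n) bialg_scheme \<Rightarrow> ('k, 'r::ab_group_add, 'h) ydbialg
    \<Rightarrow> ('k, 'r \<Rightarrow> 'k, 'h \<Rightarrow> 'k) ydbialg" where
  "yd_dual H R = (let D = yd_dual_space H R; E = finite_dual H in
     \<lparr>carrier = carrier D, scal = fun_scal,
      mult = (\<lambda>p q. zero_outside R (\<lambda>r. sweedler R R (comult R r) (\<lambda>r\<^sub>1 r\<^sub>2. p r\<^sub>1 * q r\<^sub>2))),
      unit = zero_outside R (counit R),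
      comult = (\<lambda>p. THE x. x \<in> carrier (tensor D D) \<and>
        (\<forall>a\<in>carrier R. \<forall>b\<in>carrier R. sweedler D D x (\<lambda>p\<^sub>1 p\<^sub>2. p\<^sub>1 a * p\<^sub>2 b) = p (mult R a b))),
      counit = (\<lambda>p. p (unit R)),
      yact = (\<lambda>q p. zero_outside R (\<lambda>r. sweedler H R (ycoact R r) (\<lambda>g r\<^sub>0. q g * p r\<^sub>0))),
      ycoact = (\<lambda>p. THE x. x \<in> carrier (tensor E D) \<and>
        (\<forall>h\<in>carrier H. \<forall>r\<in>carrier R. sweedler E D x (\<lambda>q p\<^sub>0. q h * p\<^sub>0 r) = p (yact R h r)))\<rparr>)"


section \<open>Forms\<close>

definition form_left ::
  "('k::field, 'a::ab_group_add, 'm) vspace_scheme \<Rightarrow> ('k, 'b::ab_group_add, 'n) vspace_scheme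
    \<Rightarrow> (('a, 'b, 'k) tensor \<Rightarrow> 'k) \<Rightarrow> 'a \<Rightarrow> 'b \<Rightarrow> 'k" where
  "form_left U V b u = zero_outside V (\<lambda>v. b (tens U V u v))"

definition form_right ::
  "('k::field, 'a::ab_group_add, 'm) vspace_scheme \<Rightarrow> ('k, 'b::ab_group_add, 'n) vspace_scheme
    \<Rightarrow> (('a, 'b, 'k) tensor \<Rightarrow> 'k) \<Rightarrow> 'b \<Rightarrow> 'a \<Rightarrow> 'k" where
  "form_right U V b v = zero_outside U (\<lambda>u. b (tens U V u v))"

definition left_nonsingular ::
  "('k::field, 'a::ab_group_add, 'm) vspace_scheme \<Rightarrow> ('k, 'b::ab_group_add, 'n) vspace_scheme
    \<Rightarrow> (('a, 'b, 'k) tensor \<Rightarrow> 'k) \<Rightarrow> bool" where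
  "left_nonsingular U V b \<longleftrightarrow> inj_on (form_left U V b) (carrier U)"

definition right_nonsingular ::
  "('k::field, 'a::ab_group_add, 'm) vspace_scheme \<Rightarrow> ('k, 'b::ab_group_add, 'n) vspace_scheme
    \<Rightarrow> (('a, 'b, 'k) tensor \<Rightarrow> 'k) \<Rightarrow> bool" where
  "right_nonsingular U V b \<longleftrightarrow> inj_on (form_right U V b) (carrier V)"

definition conditions_A ::
  "('k::field, 'u::ab_group_add, 'm) bialg_scheme \<Rightarrow> ('k, 'a::ab_group_add, 'n) bialg_scheme
    \<Rightarrow> (('u, 'a, 'k) tensor \<Rightarrow> 'k) \<Rightarrow> bool" where
  "conditions_A U A \<tau> \<longleftrightarrow>
     (\<forall>u\<in>carrier U. \<forall>a\<in>carrier A. \<forall>a'\<in>carrier A.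
        \<tau> (tens U A u (mult A a a')) =
        sweedler U U (comult U u) (\<lambda>u\<^sub>1 u\<^sub>2. \<tau> (tens U A u\<^sub>2 a) * \<tau> (tens U A u\<^sub>1 a'))) \<and>
     (\<forall>a\<in>carrier A. \<tau> (tens U A (unit U) a) = counit A a) \<and>
     (\<forall>u\<in>carrier U. \<forall>u'\<in>carrier U. \<forall>a\<in>carrier A.
        \<tau> (tens U A (mult U u u') a) =
        sweedler A A (comult A a) (\<lambda>a\<^sub>1 a\<^sub>2. \<tau> (tens U A u a\<^sub>1) * \<tau> (tens U A u' a\<^sub>2))) \<and>
     (\<forall>u\<in>carrier U. \<tau> (tens U A u (unit A)) = counit U u)"

definition conditions_B ::
  "('k::field, 'h::ab_group_add, 'n) hopf_scheme \<Rightarrow> ('k, 't::ab_group_add, 'g) ydbialg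
    \<Rightarrow> ('k, 'r::ab_group_add, 'h) ydbialg \<Rightarrow> (('t, 'r, 'k) tensor \<Rightarrow> 'k) \<Rightarrow> bool" where
  "conditions_B H T R \<beta> \<longleftrightarrow>
     (\<forall>t\<in>carrier T. \<forall>t'\<in>carrier T. \<forall>r\<in>carrier R.
        \<beta> (tens T R (mult T t t') r) =
        sweedler R R (comult R r) (\<lambda>r\<^sub>1 r\<^sub>2. sweedler H R (ycoact R r\<^sub>2) (\<lambda>g r\<^sub>2'.
          \<beta> (tens T R t (yact R (antipode_inv H g) r\<^sub>1)) * \<beta> (tens T R t' r\<^sub>2')))) \<and>
     (\<forall>r\<in>carrier R. \<beta> (tens T R (unit T) r) = counit R r) \<and>
     (\<forall>t\<in>carrier T. \<forall>r\<in>carrier R. \<forall>r'\<in>carrier R.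
        \<beta> (tens T R t (mult R r r')) =
        sweedler T T (comult T t) (\<lambda>t\<^sub>1 t\<^sub>2. \<beta> (tens T R t\<^sub>2 r) * \<beta> (tens T R t\<^sub>1 r'))) \<and>
     (\<forall>t\<in>carrier T. \<beta> (tens T R t (unit R)) = counit T t)"

definition harpoon ::
  "('k::field, 'h::ab_group_add, 'n) bialg_scheme \<Rightarrow> ('k, 'r::ab_group_add, 'h) ydbialg
    \<Rightarrow> 'r \<Rightarrow> ('h \<Rightarrow> 'k) \<Rightarrow> 'r" where
  "harpoon H R r p = sweedler H R (ycoact R r) (\<lambda>g r\<^sub>0. scal R (p g) r\<^sub>0)"

definition conditions_C ::
  "('k::field, 'g::ab_group_add, 'm) bialg_scheme \<Rightarrow> ('k, 'h::ab_group_add, 'n) hopf_scheme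
    \<Rightarrow> ('k, 't::ab_group_add, 'g) ydbialg \<Rightarrow> ('k, 'r::ab_group_add, 'h) ydbialg
    \<Rightarrow> (('g, 'h, 'k) tensor \<Rightarrow> 'k) \<Rightarrow> (('t, 'r, 'k) tensor \<Rightarrow> 'k) \<Rightarrow> bool" where
  "conditions_C K H T R \<tau> \<beta> \<longleftrightarrow>
     (\<forall>k\<in>carrier K. \<forall>t\<in>carrier T. \<forall>r\<in>carrier R.
        \<beta> (tens T R (yact T k t) r) = \<beta> (tens T R t (harpoon H R r (form_left K H \<tau> k)))) \<and>
     (\<forall>h\<in>carrier H. \<forall>t\<in>carrier T. \<forall>r\<in>carrier R.
        \<beta> (tens T R (harpoon K T t (form_right K H \<tau> h)) r) =
        \<beta> (tens T R t (yact R (antipode_inv H h) r)))"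

definition hash_form ::
  "('k::field, 'g::ab_group_add, 'm) bialg_scheme \<Rightarrow> ('k, 'h::ab_group_add, 'n) hopf_scheme
    \<Rightarrow> ('k, 't::ab_group_add, 'g) ydbialg \<Rightarrow> ('k, 'r::ab_group_add, 'h) ydbialg
    \<Rightarrow> (('t, 'r, 'k) tensor \<Rightarrow> 'k) \<Rightarrow> (('g, 'h, 'k) tensor \<Rightarrow> 'k)
    \<Rightarrow> (('t, 'g, 'k) tensor, ('r, 'h, 'k) tensor, 'k) tensor \<Rightarrow> 'k" where
  "hash_form K H T R \<beta> \<tau> z =
     sweedler (biproduct T K) (biproduct R H) z (\<lambda>x y.
       sweedler T K x (\<lambda>t k. sweedler R H y (\<lambda>r h. sweedler H H (comult H h) (\<lambda>h\<^sub>1 h\<^sub>2.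
         \<beta> (tens T R t (yact R (antipode_inv H h\<^sub>1) r)) * \<tau> (tens K H k h\<^sub>2)))))"

text \<open>A map from \<open>R\<^sup>o\<^sup>p # H\<^sup>o\<^sup>p\<close> to \<open>(R # H)\<^sup>o\<^sup>p\<close>, but with \<open>mult\<close> the product of \<open>R # H\<close>.\<close>

definition phi ::
  "('k::field, 'h::ab_group_add, 'n) hopf_scheme \<Rightarrow> ('k, 'r::ab_group_add, 'h) ydbialg
    \<Rightarrow> ('r, 'h, 'k) tensor \<Rightarrow> ('r, 'h, 'k) tensor" where
  "phi H R x = sweedler (yd_op H R) (op_bialg H) x (\<lambda>r h.
     mult (biproduct R H) (tens R H (unit R) h) (tens R H r (unit H)))"

definition phi_inv ::
  "('k::field, 'h::ab_group_add, 'n) hopf_scheme \<Rightarrow> ('k, 'r::ab_group_add, 'h) ydbialg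
    \<Rightarrow> ('r, 'h, 'k) tensor \<Rightarrow> ('r, 'h, 'k) tensor" where
  "phi_inv H R = inv_into (carrier (biproduct (yd_op H R) (op_bialg H))) (phi H R)"

definition theta ::
  "('k::field, 'h::ab_group_add, 'n) hopf_scheme \<Rightarrow> ('k, 'r::ab_group_add, 'h) ydbialg
    \<Rightarrow> ('r \<Rightarrow> 'k, 'h \<Rightarrow> 'k, 'k) tensor \<Rightarrow> ('r, 'h, 'k) tensor \<Rightarrow> 'k" where
  "theta H R = tensor_functional
     (yd_dual (op_bialg H) (yd_op H R)) (finite_dual (op_bialg H)) (yd_op H R) (op_bialg H)"

end

theory Submission
  imports Defs
begin

text \<open>
  Everything is transported along \<open>\<phi>(r # h) = h\<^sub>(\<^sub>1\<^sub>) \<cdot> r # h\<^sub>(\<^sub>2\<^sub>)\<close>, whose inverse \<open>\<psi>\<close> sends \<open>r # h\<close> to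
  \<open>S\<^sup>-\<^sup>1(h\<^sub>(\<^sub>1\<^sub>)) \<cdot> r # h\<^sub>(\<^sub>2\<^sub>)\<close>. Since \<open>(\<beta> # \<tau>)(u, \<phi>(x))\<close> is the plain product form \<open>B(u, x)\<close> of \<open>\<beta>\<close> and \<open>\<tau>\<close>,
  the factorisations of \<open>(\<beta> # \<tau>)\<^sub>l\<close> and \<open>(\<beta> # \<tau>)\<^sub>r\<close> are immediate, and (A.1)--(A.4) become identities for
  \<open>B\<close> once \<open>\<phi>\<close> is known to reverse products and to send \<open>r # h\<close> to an element with coproduct
  \<open>\<phi>(S\<^sup>-\<^sup>1(g\<^sub>(\<^sub>1\<^sub>)) \<cdot> r\<^sup>(\<^sup>1\<^sup>) # h\<^sub>(\<^sub>1\<^sub>) g\<^sub>(\<^sub>2\<^sub>)) \<otimes> \<phi>(n # h\<^sub>(\<^sub>2\<^sub>))\<close>, where \<open>g \<otimes> n\<close> is the coaction of \<open>r\<^sup>(\<^sup>2\<^sup>)\<close>.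
  A functional \<open>f\<close> on an algebra lies in the finite dual as soon as the forms \<open>x \<mapsto> f(a x b)\<close> are spanned by
  finitely many forms; for \<open>\<beta>\<^sub>l(t)\<close> and \<open>\<tau>\<^sub>l(k)\<close> these forms come from an iterated coproduct of \<open>t\<close> or \<open>k\<close>.
  Non-singularity follows because a tensor product of injective maps is injective.
\<close>

section \<open>Sweedler sums\<close>

text \<open>(C.1) and (C.2) are what makes the identities for \<open>B\<close> close up. Expanding
  \<open>B\<close> on a product of R^op # H^op by (B.3) and (A.1) leaves S^{-1}(h_(1)) acting inside
  \<open>\<beta>\<close>; (C.2) trades this action for the coaction of T, the one occurring in the
  coproduct of T # K. Expanding \<open>B\<close> on a product of T # K leaves K acting on T, and
  (C.1) trades this for a second coaction of R. The inverse antipode enters \<open>\<psi>\<close>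
  because undoing the action of h_(1) on the left requires h_(2) S^{-1}(h_(1)) = \<epsilon>(h) 1.
  Two obstacles shape the development. \<open>sweedler\<close> evaluates a sum on an arbitrarily
  chosen list of terms, so each use of an axiom inside a sum carries a proof that the summand is
  multilinear. And the finite dual of R^op # H^op presupposes an algebra: its associativity and unit
  laws are pulled back from R # H along \<open>\<phi>\<close>. For \<open>\<beta>\<close> the
  annihilated ideal must also be stable under H; there (C.2) again separates h from the vector it
  acts on.\<close>

lemma vspace_0 [simp]: "is_vspace V \<Longrightarrow> 0 \<in> carrier V"
  and vspace_add: "is_vspace V \<Longrightarrow> x \<in> carrier V \<Longrightarrow> y \<in> carrier V \<Longrightarrow> x + y \<in> carrier V"
  and vspace_scal: "is_vspace V \<Longrightarrow> x \<in> carrier V \<Longrightarrow> scal V c x \<in> carrier V"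
  using module_of_vspace[of V] by (auto simp: is_vspace_def module.subspace_def)

lemma vspace_diff: "is_vspace V \<Longrightarrow> x \<in> carrier V \<Longrightarrow> y \<in> carrier V \<Longrightarrow> x - y \<in> carrier V"
  using module_of_vspace[of V] by (auto simp: is_vspace_def module.subspace_diff)

lemma vspace_sum_list: "is_vspace V \<Longrightarrow> (\<And>x. x \<in> set xs \<Longrightarrow> f x \<in> carrier V) \<Longrightarrow> sum_list (map f xs) \<in> carrier V"
  by (induction xs) (auto simp: vspace_add)

lemma is_vspace_field_space [simp]: "is_vspace (field_space :: ('k::field, 'k) vspace)"
proof -
  interpret vector_space "(*) :: 'k \<Rightarrow> 'k \<Rightarrow> 'k"
    by unfold_locales (auto simp: algebra_simps)
  show ?thesis
    unfolding is_vspace_def field_space_def using vector_space_axioms subspace_UNIV by simp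
qed

lemma field_space_simps [simp]: "carrier field_space = UNIV" "scal field_space = (*)"
  by (auto simp: field_space_def)

declare is_vspace_tensor [simp]

lemma linear_map_mem: "linear_map V W f \<Longrightarrow> x \<in> carrier V \<Longrightarrow> f x \<in> carrier W"
  and linear_map_add: "linear_map V W f \<Longrightarrow> x \<in> carrier V \<Longrightarrow> y \<in> carrier V \<Longrightarrow> f (x + y) = f x + f y"
  by (auto simp: linear_map_def)

lemma linear_map_0:
  assumes "linear_map V W f" "is_vspace V"
  shows "f 0 = 0"
  using linear_map_add[OF assms(1), of 0 0] assms(2) by simp

lemma linear_map_diff:
  assumes "linear_map V W f" "is_vspace V" "x \<in> carrier V" "y \<in> carrier V"
  shows "f (x - y) = f x - f y"
  using linear_map_add[OF assms(1), of "x - y" y] assms by (simp add: vspace_diff)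

lemma linear_map_sum_list:
  assumes "linear_map V W f" "is_vspace V" "\<And>x. x \<in> set xs \<Longrightarrow> g x \<in> carrier V"
  shows "f (\<Sum>x\<leftarrow>xs. g x) = (\<Sum>x\<leftarrow>xs. f (g x))"
  using assms(3)
  by (induction xs) (auto simp: linear_map_0[OF assms(1,2)] linear_map_add[OF assms(1)]
      vspace_sum_list[OF assms(2)])

lemma bilinear_mapI:
  "(\<And>u. u \<in> carrier U \<Longrightarrow> linear_map V W (\<lambda>v. f u v)) \<Longrightarrow>
    (\<And>v. v \<in> carrier V \<Longrightarrow> linear_map U W (\<lambda>u. f u v)) \<Longrightarrow> bilinear_map U V W f"
  by (auto simp: bilinear_map_def)

lemma linear_map_compose:
  "linear_map V W g \<Longrightarrow> linear_map U V f \<Longrightarrow> linear_map U W (\<lambda>x. g (f x))"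
  by (auto simp: linear_map_def Pi_iff)

lemma bilinear_map_left:
  "bilinear_map U V W f \<Longrightarrow> linear_map X U g \<Longrightarrow> v \<in> carrier V \<Longrightarrow> linear_map X W (\<lambda>x. f (g x) v)"
  by (auto simp: bilinear_map_def intro: linear_map_compose)

lemma bilinear_map_right:
  "bilinear_map U V W f \<Longrightarrow> u \<in> carrier U \<Longrightarrow> linear_map X V g \<Longrightarrow> linear_map X W (\<lambda>x. f u (g x))"
  by (auto simp: bilinear_map_def intro: linear_map_compose)

lemma bilinear_map_mem:
  "bilinear_map U V W f \<Longrightarrow> u \<in> carrier U \<Longrightarrow> v \<in> carrier V \<Longrightarrow> f u v \<in> carrier W"
  by (auto simp: bilinear_map_def linear_map_def)

text \<open>Names the list that \<open>sweedler\<close> chooses: manipulations of Sweedler sums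
  become manipulations of \<open>sum_list\<close>, and the entries later serve as an explicit finite
  family of vectors from which forms are built.\<close>

definition tensor_terms ::
  "('k::field, 'a::ab_group_add, 'm) vspace_scheme \<Rightarrow> ('k, 'b::ab_group_add, 'n) vspace_scheme
    \<Rightarrow> ('a, 'b, 'k) tensor \<Rightarrow> ('a \<times> 'b) list" where
  "tensor_terms U V x =
     (SOME ps. set ps \<subseteq> carrier U \<times> carrier V \<and> x = (\<Sum>(u, v)\<leftarrow>ps. tens U V u v))"

lemma sweedler_terms: "sweedler U V x f = (\<Sum>(u, v)\<leftarrow>tensor_terms U V x. f u v)"
  by (simp add: sweedler_def tensor_terms_def)

lemma
  assumes "is_vspace U" "is_vspace V" "x \<in> carrier (tensor U V)"
  shows tensor_terms_mem: "set (tensor_terms U V x) \<subseteq> carrier U \<times> carrier V"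
    and tensor_terms_eq: "x = (\<Sum>(u, v)\<leftarrow>tensor_terms U V x. tens U V u v)"
  using someI_ex[OF tensor_rep[OF assms]] unfolding tensor_terms_def by auto

lemma sweedler_cong:
  assumes "is_vspace U" "is_vspace V" "x \<in> carrier (tensor U V)"
    and "\<And>u v. u \<in> carrier U \<Longrightarrow> v \<in> carrier V \<Longrightarrow> f u v = g u v"
  shows "sweedler U V x f = sweedler U V x g"
  unfolding sweedler_terms using tensor_terms_mem[OF assms(1-3)] assms(4)
  by (intro arg_cong[where f=sum_list] map_cong) auto

lemma sweedler_cong':
  assumes "x = y" "is_vspace U" "is_vspace V" "y \<in> carrier (tensor U V)"
    and "\<And>u v. u \<in> carrier U \<Longrightarrow> v \<in> carrier V \<Longrightarrow> f u v = g u v"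
  shows "sweedler U V x f = sweedler U V y g"
  using assms sweedler_cong by blast

text \<open>Each side is the same finite double sum over two fixed lists of terms, which is why the
  rule can be used as an unconditional rewrite when neither tensor depends on the variables of the
  other sum.\<close>

lemma sweedler_swap:
  "sweedler U V x (\<lambda>u v. sweedler X Y y (\<lambda>a b. f u v a b))
    = sweedler X Y y (\<lambda>a b. sweedler U V x (\<lambda>u v. f u v a b))"
proof -
  have "(\<Sum>p\<leftarrow>ps. \<Sum>q\<leftarrow>qs. g p q) = (\<Sum>q\<leftarrow>qs. \<Sum>p\<leftarrow>ps. g p q)"
    for ps :: "'x list" and qs :: "'y list" and g :: "_ \<Rightarrow> _ \<Rightarrow> 'z::ab_group_add"
    by (induction ps) (auto simp: sum_list_addf)
  thus ?thesis by (simp add: sweedler_terms case_prod_unfold)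
qed

lemma sweedler_add:
  "sweedler U V x (\<lambda>u v. f u v + g u v) = sweedler U V x f + sweedler U V x g"
  by (simp add: sweedler_terms case_prod_unfold sum_list_addf)

lemma sweedler_eq_0:
  "(\<And>u v. (u, v) \<in> set (tensor_terms U V x) \<Longrightarrow> f u v = 0) \<Longrightarrow> sweedler U V x f = 0"
proof -
  assume "\<And>u v. (u, v) \<in> set (tensor_terms U V x) \<Longrightarrow> f u v = 0"
  hence "sweedler U V x f = (\<Sum>p\<leftarrow>tensor_terms U V x. 0)"
    unfolding sweedler_terms by (intro arg_cong[of _ _ sum_list] map_cong) auto
  thus ?thesis by simp
qed

lemma sweedler_sum_list:
  "sweedler U V x (\<lambda>u v. \<Sum>i\<leftarrow>xs. f i u v) = (\<Sum>i\<leftarrow>xs. sweedler U V x (f i))"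
  by (induction xs) (auto simp: sweedler_add sweedler_eq_0)

lemma sweedler_mem:
  assumes "is_vspace U" "is_vspace V" "is_vspace W" "x \<in> carrier (tensor U V)"
    and "\<And>u v. u \<in> carrier U \<Longrightarrow> v \<in> carrier V \<Longrightarrow> f u v \<in> carrier W"
  shows "sweedler U V x f \<in> carrier W"
  unfolding sweedler_terms using tensor_terms_mem[OF assms(1,2,4)] assms(3,5)
  by (intro vspace_sum_list) auto

lemma linear_map_of_sweedler:
  assumes "linear_map W Z L" "is_vspace U" "is_vspace V" "is_vspace W" "x \<in> carrier (tensor U V)"
    and "\<And>u v. u \<in> carrier U \<Longrightarrow> v \<in> carrier V \<Longrightarrow> f u v \<in> carrier W"
  shows "L (sweedler U V x f) = sweedler U V x (\<lambda>u v. L (f u v))"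
  unfolding sweedler_terms using tensor_terms_mem[OF assms(2,3,5)] assms(1,4,6)
  by (subst linear_map_sum_list[of W Z]) (auto simp: case_prod_unfold)

lemma sweedler_mult_right:
  "sweedler U V x (\<lambda>u v. f u v * c) = sweedler U V x f * (c :: 'k :: field)"
  by (simp add: sweedler_terms case_prod_unfold sum_list_mult_const)

lemma sweedler_mult_left:
  "sweedler U V x (\<lambda>u v. c * f u v) = (c :: 'k :: field) * sweedler U V x f"
  by (simp add: sweedler_terms case_prod_unfold sum_list_const_mult)

lemma sweedler_scal:
  assumes "module s"
  shows "sweedler U V x (\<lambda>u v. s c (f u v)) = s c (sweedler U V x f)"
proof -
  have "(\<Sum>p\<leftarrow>ps. s c (g p)) = s c (\<Sum>p\<leftarrow>ps. g p)" for ps :: "'x list" and g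
    by (induction ps) (auto simp: module.scale_right_distrib[OF assms] module.scale_zero_right[OF assms])
  thus ?thesis by (simp add: sweedler_terms case_prod_unfold)
qed

lemma sweedler_sweedler:
  assumes "is_vspace U" "is_vspace V" "is_vspace W" "is_vspace X" "is_vspace Y"
    and "bilinear_map U V W f" "z \<in> carrier (tensor X Y)"
    and "\<And>a b. a \<in> carrier X \<Longrightarrow> b \<in> carrier Y \<Longrightarrow> g a b \<in> carrier (tensor U V)"
  shows "sweedler U V (sweedler X Y z g) f = sweedler X Y z (\<lambda>a b. sweedler U V (g a b) f)"
  using assms by (intro linear_map_of_sweedler[OF linear_map_sweedler]) auto

lemma tens_mem: "u \<in> carrier U \<Longrightarrow> v \<in> carrier V \<Longrightarrow> tens U V u v \<in> carrier (tensor U V)"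
  unfolding tensor_def by (auto intro!: module.span_base[OF module_fun])

lemma scal_tensor [simp]: "scal (tensor U V) = fun_scal"
  by (simp add: tensor_def)

lemma bilinear_map_tens: "bilinear_map U V (tensor U V) (tens U V)"
  by (auto simp: bilinear_map_def linear_map_def tens_mem)
    (auto simp: tens_def fun_eq_iff bilinear_map_def linear_map_def)

lemma tensor_eq_sweedler:
  assumes "is_vspace U" "is_vspace V" "x \<in> carrier (tensor U V)"
  shows "sweedler U V x (tens U V) = x"
  using tensor_terms_eq[OF assms] by (simp add: sweedler_terms)

text \<open>The form in which pure tensors generate the tensor product; this and its two- and
  three-variable versions reduce every identity on bi-products to elements r # h.\<close>

lemma linear_map_tensor_eqI:
  assumes "is_vspace U" "is_vspace V" "linear_map (tensor U V) W f" "linear_map (tensor U V) W g"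
    and "\<And>u v. u \<in> carrier U \<Longrightarrow> v \<in> carrier V \<Longrightarrow> f (tens U V u v) = g (tens U V u v)"
    and x: "x \<in> carrier (tensor U V)"
  shows "f x = g x"
proof -
  have "L x = sweedler U V x (\<lambda>u v. L (tens U V u v))" if "linear_map (tensor U V) W L" for L
    using linear_map_of_sweedler[OF that, of U V x "tens U V"] assms(1,2) x
    by (simp add: tens_mem tensor_eq_sweedler)
  from this[OF assms(3)] this[OF assms(4)] show ?thesis
    using assms by (auto intro: sweedler_cong)
qed

lemma bilinear_tensor_eqI:
  assumes "is_vspace U" "is_vspace V" "is_vspace X" "is_vspace Y"
    and f: "bilinear_map (tensor U V) (tensor X Y) W f" and g: "bilinear_map (tensor U V) (tensor X Y) W g"
    and eq: "\<And>u v a b. u \<in> carrier U \<Longrightarrow> v \<in> carrier V \<Longrightarrow> a \<in> carrier X \<Longrightarrow> b \<in> carrier Y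
      \<Longrightarrow> f (tens U V u v) (tens X Y a b) = g (tens U V u v) (tens X Y a b)"
    and x: "x \<in> carrier (tensor U V)" and y: "y \<in> carrier (tensor X Y)"
  shows "f x y = g x y"
proof (rule linear_map_tensor_eqI[of U V W "\<lambda>x. f x y" "\<lambda>x. g x y"])
  fix u v assume uv: "u \<in> carrier U" "v \<in> carrier V"
  show "f (tens U V u v) y = g (tens U V u v) y"
    by (rule linear_map_tensor_eqI[of X Y W "f (tens U V u v)" "g (tens U V u v)"])
      (use assms uv in \<open>auto simp: bilinear_map_def tens_mem\<close>)
qed (use assms in \<open>auto simp: bilinear_map_def\<close>)

lemma tensor_apply:
  assumes "is_vspace U" "is_vspace V" "x \<in> carrier (tensor U V)" "bilinear_map U V field_space b"
  shows "x b = sweedler U V x b"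
  using tensor_terms_eq[OF assms(1-3)] sum_list_tens_apply[OF assms(4)]
  by (metis sweedler_terms)

text \<open>\<open>tens\<close> takes the default value 0 off the bilinear forms, and sums inherit
  this. Together with \<open>tensor_apply\<close> it determines a tensor as a function, so a tensor
  can be shown to vanish by testing bilinear forms only.\<close>

lemma tensor_apply_not_bilinear:
  assumes "is_vspace U" "is_vspace V" "x \<in> carrier (tensor U V)" "\<not> bilinear_map U V field_space b"
  shows "x b = 0"
proof -
  have "x b = (\<Sum>(u, v)\<leftarrow>tensor_terms U V x. tens U V u v) b"
    by (rule arg_cong[OF tensor_terms_eq[OF assms(1-3)], of "\<lambda>x. x b"])
  also have "\<dots> = 0" using assms(4) by (simp add: sum_list_fun_apply tens_def case_prod_unfold)
  finally show ?thesis .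
qed

subsection \<open>Closure rules for linear maps\<close>

text \<open>Almost all side conditions of Sweedler calculations say that a nested expression is
  linear in one variable or lies in a carrier. The two collections follow the syntax of the
  expression, so that \<open>auto intro!: linear closed\<close> settles them.\<close>

named_theorems linear
named_theorems closed

lemma linear_map_id [linear]: "linear_map V V (\<lambda>x. x)"
  by (auto simp: linear_map_def)

lemma linear_map_zero [linear]: "is_vspace W \<Longrightarrow> linear_map V W (\<lambda>x. 0)"
  using module.scale_zero_right[OF module_of_vspace] by (auto simp: linear_map_def)

lemma linear_map_sweedler_const [linear]:
  assumes "is_vspace W" "is_vspace X" "is_vspace Y" "z \<in> carrier (tensor X Y)"
    and lin: "\<And>a b. a \<in> carrier X \<Longrightarrow> b \<in> carrier Y \<Longrightarrow> linear_map V W (\<lambda>x. f x a b)"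
  shows "linear_map V W (\<lambda>x. sweedler X Y z (\<lambda>a b. f x a b))"
proof -
  show ?thesis unfolding linear_map_def
  proof (intro conjI ballI allI Pi_I)
    show "sweedler X Y z (\<lambda>a b. f x a b) \<in> carrier W" if "x \<in> carrier V" for x
      using assms that by (intro sweedler_mem) (auto intro: linear_map_mem[OF lin])
    show "sweedler X Y z (\<lambda>a b. f (x + y) a b) = sweedler X Y z (\<lambda>a b. f x a b) + sweedler X Y z (\<lambda>a b. f y a b)"
      if "x \<in> carrier V" "y \<in> carrier V" for x y
      by (subst sweedler_add[symmetric], intro sweedler_cong)
        (use assms that in \<open>auto simp: linear_map_add[OF lin]\<close>)
    show "sweedler X Y z (\<lambda>a b. f (scal V c x) a b) = scal W c (sweedler X Y z (\<lambda>a b. f x a b))"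
      if "x \<in> carrier V" for c x
      by (subst sweedler_scal[OF module_of_vspace[OF assms(1)], symmetric], intro sweedler_cong)
        (use assms that in \<open>auto simp: linear_map_scaleD[OF lin]\<close>)
  qed
qed

lemma linear_map_sweedler_arg [linear]:
  "is_vspace U \<Longrightarrow> is_vspace V \<Longrightarrow> is_vspace W \<Longrightarrow> linear_map X (tensor U V) g \<Longrightarrow> bilinear_map U V W f
    \<Longrightarrow> linear_map X W (\<lambda>x. sweedler U V (g x) f)"
  by (rule linear_map_compose[OF linear_map_sweedler])

lemmas linear_map_tens [linear] =
  bilinear_map_left[OF bilinear_map_tens] bilinear_map_right[OF bilinear_map_tens]

lemma linear_map_mult_const [linear]:
  "linear_map V field_space f \<Longrightarrow> linear_map V field_space (\<lambda>x. f x * c)"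
  "linear_map V field_space f \<Longrightarrow> linear_map V field_space (\<lambda>x. c * f x)"
  by (auto simp: linear_map_def algebra_simps)

lemma linear_map_scal_left [linear]:
  assumes "is_vspace W" "linear_map V field_space f" "w \<in> carrier W"
  shows "linear_map V W (\<lambda>x. scal W (f x) w)"
proof -
  interpret module "scal W" by (rule module_of_vspace[OF assms(1)])
  show ?thesis using assms
    by (auto simp: linear_map_def vspace_scal scale_left_distrib)
qed

lemma linear_map_scal_right [linear]:
  assumes "is_vspace W" "linear_map V W f"
  shows "linear_map V W (\<lambda>x. scal W c (f x))"
proof -
  interpret module "scal W" by (rule module_of_vspace[OF assms(1)])
  show ?thesis using assms
    by (auto simp: linear_map_def vspace_scal scale_right_distrib Pi_iff) (simp add: mult.commute)
qed

declare bilinear_mapI [linear]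
declare tens_mem [closed] sweedler_mem [closed] vspace_scal [closed]

text \<open>The shape of summand to which coassociativity applies: three legs, each entering
  linearly.\<close>

definition trilinear_map where
  "trilinear_map U V X W f \<longleftrightarrow>
     (\<forall>u\<in>carrier U. bilinear_map V X W (f u)) \<and>
     (\<forall>v\<in>carrier V. \<forall>x\<in>carrier X. linear_map U W (\<lambda>u. f u v x))"

lemma trilinear_mapI [linear]:
  assumes "\<And>u v. u \<in> carrier U \<Longrightarrow> v \<in> carrier V \<Longrightarrow> linear_map X W (\<lambda>x. f u v x)"
    and "\<And>u x. u \<in> carrier U \<Longrightarrow> x \<in> carrier X \<Longrightarrow> linear_map V W (\<lambda>v. f u v x)"
    and "\<And>v x. v \<in> carrier V \<Longrightarrow> x \<in> carrier X \<Longrightarrow> linear_map U W (\<lambda>u. f u v x)"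
  shows "trilinear_map U V X W f"
  using assms by (auto simp: trilinear_map_def intro!: bilinear_mapI)

lemma trilinear_map_1:
  "trilinear_map U V X W f \<Longrightarrow> linear_map Z U g \<Longrightarrow> v \<in> carrier V \<Longrightarrow> x \<in> carrier X
    \<Longrightarrow> linear_map Z W (\<lambda>z. f (g z) v x)"
  and trilinear_map_2: "trilinear_map U V X W f \<Longrightarrow> linear_map Z V h \<Longrightarrow> u \<in> carrier U \<Longrightarrow> x \<in> carrier X
    \<Longrightarrow> linear_map Z W (\<lambda>z. f u (h z) x)"
  and trilinear_map_3: "trilinear_map U V X W f \<Longrightarrow> linear_map Z X i \<Longrightarrow> u \<in> carrier U \<Longrightarrow> v \<in> carrier V
    \<Longrightarrow> linear_map Z W (\<lambda>z. f u v (i z))"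
  by (auto simp: trilinear_map_def bilinear_map_def linear_map_def Pi_iff)

lemma trilinear_map_mem:
  "trilinear_map U V X W f \<Longrightarrow> u \<in> carrier U \<Longrightarrow> v \<in> carrier V \<Longrightarrow> x \<in> carrier X \<Longrightarrow> f u v x \<in> carrier W"
  by (auto simp: trilinear_map_def bilinear_map_def linear_map_def Pi_iff)

lemmas trilinear_rules = trilinear_map_1 trilinear_map_2 trilinear_map_3 trilinear_map_mem
lemmas bilinear_rules = bilinear_map_left bilinear_map_right bilinear_map_mem

lemma trilinear_tensor_eqI:
  assumes "is_vspace U" "is_vspace V" "is_vspace X" "is_vspace Y" "is_vspace P" "is_vspace Q"
    and f: "trilinear_map (tensor U V) (tensor X Y) (tensor P Q) W f"
    and g: "trilinear_map (tensor U V) (tensor X Y) (tensor P Q) W g"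
    and eq: "\<And>u v a b p q. u \<in> carrier U \<Longrightarrow> v \<in> carrier V \<Longrightarrow> a \<in> carrier X \<Longrightarrow> b \<in> carrier Y
      \<Longrightarrow> p \<in> carrier P \<Longrightarrow> q \<in> carrier Q
      \<Longrightarrow> f (tens U V u v) (tens X Y a b) (tens P Q p q) = g (tens U V u v) (tens X Y a b) (tens P Q p q)"
    and "x \<in> carrier (tensor U V)" "y \<in> carrier (tensor X Y)" "z \<in> carrier (tensor P Q)"
  shows "f x y z = g x y z"
proof (rule linear_map_tensor_eqI[of U V W "\<lambda>x. f x y z" "\<lambda>x. g x y z"])
  fix u v assume uv: "u \<in> carrier U" "v \<in> carrier V"
  show "f (tens U V u v) y z = g (tens U V u v) y z"
    by (rule bilinear_tensor_eqI[of X Y P Q W "f (tens U V u v)" "g (tens U V u v)"])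
      (use assms uv in \<open>auto simp: trilinear_map_def tens_mem\<close>)
qed (use assms in \<open>auto simp: trilinear_map_def\<close>)

text \<open>Opposites, bi-products and duals are records that share carrier and scalars with a
  simpler space but differ in type or in further fields. Since \<open>tens\<close> tests bilinearity
  relative to its two spaces, equality of the tensor products has to be proved; the resulting
  equations become simplification rules for each construction.\<close>

lemma same_space_basic:
  assumes "carrier U = carrier U'" "scal U = scal U'"
  shows "is_vspace U = is_vspace U'"
    and "linear_map U W = linear_map U' W" and "linear_map W U = linear_map W U'"
  unfolding linear_map_def is_vspace_def by (simp_all only: assms)

lemma same_space_bilinear:
  assumes "carrier U = carrier U'" "scal U = scal U'"
  shows "bilinear_map U V W = bilinear_map U' V W" and "bilinear_map V U W = bilinear_map V U' W"
    and "bilinear_map V W U = bilinear_map V W U'"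
  by (simp_all add: bilinear_map_def fun_eq_iff same_space_basic[OF assms] assms)

lemma same_space_tensor:
  assumes "carrier U = carrier U'" "scal U = scal U'"
  shows "tens U V = tens U' V" and "tens V U = tens V U'"
    and "tensor U V = tensor U' V" and "tensor V U = tensor V U'"
  by (simp_all add: tensor_def tens_def fun_eq_iff same_space_bilinear[OF assms] assms)

lemma same_space_sweedler:
  assumes "carrier U = carrier U'" "scal U = scal U'"
  shows "sweedler U V = sweedler U' V" and "sweedler V U = sweedler V U'"
  by (simp_all add: sweedler_def fun_eq_iff same_space_tensor[OF assms] assms)

lemmas same_space = same_space_basic same_space_bilinear same_space_tensor same_space_sweedler

section \<open>Algebras, coalgebras and Hopf algebras\<close>

abbreviation cosum ::
  "('k::field, 'a::ab_group_add, 'm) bialg_scheme \<Rightarrow> 'a \<Rightarrow> ('a \<Rightarrow> 'a \<Rightarrow> 'c::ab_group_add) \<Rightarrow> 'c" where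
  "cosum C c f \<equiv> sweedler C C (comult C c) f"

locale alg =
  fixes A :: "('k::field, 'a::ab_group_add, 'm) bialg_scheme"
  assumes algebra: "algebra A"
begin

lemma vspace_alg [simp]: "is_vspace A" and bilinear_mult: "bilinear_map A A A (mult A)"
  and unit_mem [closed, simp]: "unit A \<in> carrier A"
  and mult_assoc: "a \<in> carrier A \<Longrightarrow> b \<in> carrier A \<Longrightarrow> c \<in> carrier A
    \<Longrightarrow> mult A (mult A a b) c = mult A a (mult A b c)"
  and mult_unit: "a \<in> carrier A \<Longrightarrow> mult A (unit A) a = a" "a \<in> carrier A \<Longrightarrow> mult A a (unit A) = a"
  using algebra by (auto simp: algebra_def)

lemmas linear_mult [linear] = bilinear_map_left[OF bilinear_mult] bilinear_map_right[OF bilinear_mult]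
lemmas mult_mem [closed] = bilinear_map_mem[OF bilinear_mult]

end

locale coalg =
  fixes C :: "('k::field, 'a::ab_group_add, 'm) bialg_scheme"
  assumes coalgebra: "coalgebra C"
begin

lemma vspace_coalg [simp]: "is_vspace C" and comult_linear: "linear_map C (tensor C C) (comult C)"
  and counit_linear: "linear_map C field_space (counit C)"
  using coalgebra by (auto simp: coalgebra_def linear_form_def)

lemmas linear_comult [linear] = linear_map_compose[OF comult_linear]
lemmas comult_mem [closed] = linear_map_mem[OF comult_linear]
lemmas linear_counit [linear] = linear_map_compose[OF counit_linear]

text \<open>The axiom is an equation between elements of C \<otimes> (C \<otimes> C); the linear map
  \<open>?L\<close> induced by \<open>f\<close> is applied to both sides. The other axioms are
  likewise restated under an arbitrary linear or multilinear map, so that they can be used deep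
  inside a sum.\<close>

lemma coassoc:
  assumes W: "is_vspace W" and f: "trilinear_map C C C W f" and c: "c \<in> carrier C"
  shows "cosum C c (\<lambda>a b. cosum C a (\<lambda>a\<^sub>1 a\<^sub>2. f a\<^sub>1 a\<^sub>2 b)) = cosum C c (\<lambda>a b. cosum C b (\<lambda>b\<^sub>1 b\<^sub>2. f a b\<^sub>1 b\<^sub>2))"
proof -
  note [linear, closed] = trilinear_rules[OF f]
  let ?L = "\<lambda>z. sweedler C (tensor C C) z (\<lambda>a y. sweedler C C y (f a))"
  have bil: "bilinear_map C (tensor C C) W (\<lambda>a y. sweedler C C y (f a))"
    using W by (auto intro!: linear closed)
  hence L: "linear_map (tensor C (tensor C C)) W ?L"
    using W by (auto intro!: linear)
  have tens: "?L (tens C (tensor C C) a y) = sweedler C C y (f a)"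
    if "a \<in> carrier C" "y \<in> carrier (tensor C C)" for a y
    using sweedler_tens[OF W bil that] .
  note simps = linear_map_of_sweedler[OF L] closed tens sweedler_tens[OF W] linear
  have "cosum C c (\<lambda>a b. cosum C a (\<lambda>a\<^sub>1 a\<^sub>2. f a\<^sub>1 a\<^sub>2 b))
      = ?L (cosum C c (\<lambda>a b. cosum C a (\<lambda>a\<^sub>1 a\<^sub>2. tens C (tensor C C) a\<^sub>1 (tens C C a\<^sub>2 b))))"
    using W c by (simp add: simps cong: sweedler_cong')
  also have "\<dots> = ?L (cosum C c (\<lambda>a b. tens C (tensor C C) a (comult C b)))"
    using coalgebra c by (simp add: coalgebra_def)
  also have "\<dots> = cosum C c (\<lambda>a b. cosum C b (\<lambda>b\<^sub>1 b\<^sub>2. f a b\<^sub>1 b\<^sub>2))"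
    using W c by (simp add: simps cong: sweedler_cong')
  finally show ?thesis .
qed

text \<open>Two uses of coassociativity bring the two middle factors of a fourfold coproduct
  together as the coproduct of one element, as the Yetter-Drinfel'd condition requires.\<close>

lemma coassoc4:
  assumes W: "is_vspace W" and c: "c \<in> carrier C"
    and F: "\<And>p. p \<in> carrier C \<Longrightarrow> trilinear_map C C C W (F p)"
      "\<And>q x y. q \<in> carrier C \<Longrightarrow> x \<in> carrier C \<Longrightarrow> y \<in> carrier C \<Longrightarrow> linear_map C W (\<lambda>p. F p q x y)"
  shows "cosum C c (\<lambda>a b. cosum C a (\<lambda>a\<^sub>1 a\<^sub>2. cosum C b (\<lambda>b\<^sub>1 b\<^sub>2. F a\<^sub>1 a\<^sub>2 b\<^sub>1 b\<^sub>2)))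
    = cosum C c (\<lambda>a\<^sub>1 y. cosum C y (\<lambda>z b\<^sub>2. cosum C z (\<lambda>a\<^sub>2 b\<^sub>1. F a\<^sub>1 a\<^sub>2 b\<^sub>1 b\<^sub>2)))"
proof -
  note [linear, closed] = trilinear_rules[OF F(1)] linear_map_compose[OF F(2)]
  have "cosum C c (\<lambda>a b. cosum C a (\<lambda>a\<^sub>1 a\<^sub>2. cosum C b (\<lambda>b\<^sub>1 b\<^sub>2. F a\<^sub>1 a\<^sub>2 b\<^sub>1 b\<^sub>2)))
    = cosum C c (\<lambda>a\<^sub>1 y. cosum C y (\<lambda>a\<^sub>2 b. cosum C b (\<lambda>b\<^sub>1 b\<^sub>2. F a\<^sub>1 a\<^sub>2 b\<^sub>1 b\<^sub>2)))"
    using W c by (intro coassoc) (auto intro!: linear closed F(2))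
  also have "\<dots> = cosum C c (\<lambda>a\<^sub>1 y. cosum C y (\<lambda>z b\<^sub>2. cosum C z (\<lambda>a\<^sub>2 b\<^sub>1. F a\<^sub>1 a\<^sub>2 b\<^sub>1 b\<^sub>2)))"
    using W c F(1) by (intro sweedler_cong coassoc[symmetric]) (auto intro!: linear closed)
  finally show ?thesis .
qed

lemma counit_left:
  assumes "is_vspace W" and f: "linear_map C W f" and c: "c \<in> carrier C"
  shows "cosum C c (\<lambda>a b. scal W (counit C a) (f b)) = f c"
proof -
  have "f c = f (cosum C c (\<lambda>a b. scal C (counit C a) b))"
    using coalgebra c by (simp add: coalgebra_def)
  also have "\<dots> = cosum C c (\<lambda>a b. scal W (counit C a) (f b))"
    using c by (simp add: linear_map_of_sweedler[OF f] closed linear_map_scaleD[OF f] cong: sweedler_cong')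
  finally show ?thesis by simp
qed

lemma counit_right:
  assumes "is_vspace W" and f: "linear_map C W f" and c: "c \<in> carrier C"
  shows "cosum C c (\<lambda>a b. scal W (counit C b) (f a)) = f c"
proof -
  have "f c = f (cosum C c (\<lambda>a b. scal C (counit C b) a))"
    using coalgebra c by (simp add: coalgebra_def)
  also have "\<dots> = cosum C c (\<lambda>a b. scal W (counit C b) (f a))"
    using c by (simp add: linear_map_of_sweedler[OF f] closed linear_map_scaleD[OF f] cong: sweedler_cong')
  finally show ?thesis by simp
qed

end

locale bialg =
  fixes A :: "('k::field, 'a::ab_group_add, 'm) bialg_scheme"
  assumes bialgebra: "bialgebra A"
begin

sublocale alg A + coalg A
  using bialgebra by unfold_locales (auto simp: bialgebra_def)

lemma comult_mult:
  assumes "is_vspace W" and f: "bilinear_map A A W f" and ab: "a \<in> carrier A" "b \<in> carrier A"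
  shows "cosum A (mult A a b) f =
    cosum A a (\<lambda>a\<^sub>1 a\<^sub>2. cosum A b (\<lambda>b\<^sub>1 b\<^sub>2. f (mult A a\<^sub>1 b\<^sub>1) (mult A a\<^sub>2 b\<^sub>2)))"
proof -
  note [linear, closed] = bilinear_rules[OF f]
  have "comult A (mult A a b) = cosum A a (\<lambda>a\<^sub>1 a\<^sub>2. cosum A b (\<lambda>b\<^sub>1 b\<^sub>2.
          tens A A (mult A a\<^sub>1 b\<^sub>1) (mult A a\<^sub>2 b\<^sub>2)))"
    using bialgebra ab by (simp add: bialgebra_def)
  thus ?thesis using assms
    by (simp add: linear_map_of_sweedler[OF linear_map_sweedler] closed sweedler_tens[of W] linear
        cong: sweedler_cong')
qed

lemma comult_unit:
  assumes "is_vspace W" and f: "bilinear_map A A W f"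
  shows "cosum A (unit A) f = f (unit A) (unit A)"
  using bialgebra by (simp add: bialgebra_def sweedler_tens[OF assms])

lemma counit_mult: "a \<in> carrier A \<Longrightarrow> b \<in> carrier A \<Longrightarrow> counit A (mult A a b) = counit A a * counit A b"
  and counit_unit: "counit A (unit A) = 1"
  using bialgebra by (auto simp: bialgebra_def)

end

locale hopf_alg =
  fixes H :: "('k::field, 'a::ab_group_add) hopf"
  assumes hopf_algebra: "hopf_algebra H" and bijective_antipode: "bijective_antipode H"
begin

sublocale bialg H
  using hopf_algebra by unfold_locales (auto simp: hopf_algebra_def)

abbreviation S where "S \<equiv> antipode H"
abbreviation T where "T \<equiv> antipode_inv H"

lemma antipode_linear: "linear_map H H S"
  using hopf_algebra by (auto simp: hopf_algebra_def)

lemmas linear_antipode [linear] = linear_map_compose[OF antipode_linear]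
lemmas antipode_mem [closed] = linear_map_mem[OF antipode_linear]

lemma antipode_left:
  assumes f: "linear_map H W f" and h: "h \<in> carrier H"
  shows "cosum H h (\<lambda>a b. f (mult H (S a) b)) = scal W (counit H h) (f (unit H))"
proof -
  have "f (cosum H h (\<lambda>a b. mult H (S a) b)) = scal W (counit H h) (f (unit H))"
    using hopf_algebra h by (simp add: hopf_algebra_def linear_map_scaleD[OF f])
  thus ?thesis using h
    by (simp add: linear_map_of_sweedler[OF f] closed)
qed

lemma antipode_right:
  assumes f: "linear_map H W f" and h: "h \<in> carrier H"
  shows "cosum H h (\<lambda>a b. f (mult H a (S b))) = scal W (counit H h) (f (unit H))"
proof -
  have "f (cosum H h (\<lambda>a b. mult H a (S b))) = scal W (counit H h) (f (unit H))"
    using hopf_algebra h by (simp add: hopf_algebra_def linear_map_scaleD[OF f])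
  thus ?thesis using h
    by (simp add: linear_map_of_sweedler[OF f] closed)
qed

lemma antipode_unit: "S (unit H) = unit H"
proof -
  have "cosum H (unit H) (\<lambda>a b. mult H (S a) b) = scal H (counit H (unit H)) (unit H)"
    by (rule antipode_left[OF linear_map_id]) simp
  moreover have "cosum H (unit H) (\<lambda>a b. mult H (S a) b) = mult H (S (unit H)) (unit H)"
    by (rule comult_unit[of H]) (auto intro!: linear closed)
  ultimately show ?thesis
    using module_of_vspace[of H] by (simp add: counit_unit mult_unit closed module.scale_one)
qed

text \<open>Both sides are the convolution product of \<open>S(a\<^sub>1 b\<^sub>1)\<close>, \<open>a\<^sub>2 b\<^sub>2\<close> and \<open>S(b\<^sub>3) S(a\<^sub>3)\<close>.\<close>

lemma antipode_mult:
  assumes ab: "a \<in> carrier H" "b \<in> carrier H"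
  shows "S (mult H a b) = mult H (S b) (S a)"
proof -
  define F where "F a\<^sub>1 a\<^sub>2 a\<^sub>3 b\<^sub>1 b\<^sub>2 b\<^sub>3 = mult H (S (mult H a\<^sub>1 b\<^sub>1)) (mult H (mult H a\<^sub>2 b\<^sub>2) (mult H (S b\<^sub>3) (S a\<^sub>3)))"
    for a\<^sub>1 a\<^sub>2 a\<^sub>3 b\<^sub>1 b\<^sub>2 b\<^sub>3
  have vs: "module (scal H)" by (simp add: module_of_vspace)
  let ?X = "cosum H a (\<lambda>a\<^sub>1 a'. cosum H a' (\<lambda>a\<^sub>2 a\<^sub>3. cosum H b (\<lambda>b\<^sub>1 b'. cosum H b' (\<lambda>b\<^sub>2 b\<^sub>3. F a\<^sub>1 a\<^sub>2 a\<^sub>3 b\<^sub>1 b\<^sub>2 b\<^sub>3))))"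
  have "?X = cosum H a (\<lambda>a\<^sub>1 a'. cosum H a' (\<lambda>a\<^sub>2 a\<^sub>3. cosum H b (\<lambda>b\<^sub>1 b'. cosum H b' (\<lambda>b\<^sub>2 b\<^sub>3.
      mult H (S (mult H a\<^sub>1 b\<^sub>1)) (mult H (mult H a\<^sub>2 (mult H b\<^sub>2 (S b\<^sub>3))) (S a\<^sub>3))))))"
    using ab by (simp add: F_def mult_assoc closed cong: sweedler_cong')
  also have "\<dots> = cosum H a (\<lambda>a\<^sub>1 a'. cosum H a' (\<lambda>a\<^sub>2 a\<^sub>3. cosum H b (\<lambda>b\<^sub>1 b'. scal H (counit H b')
      (mult H (S (mult H a\<^sub>1 b\<^sub>1)) (mult H (mult H a\<^sub>2 (unit H)) (S a\<^sub>3))))))"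
    using ab by (intro sweedler_cong antipode_right) (auto intro!: linear closed)
  also have "\<dots> = cosum H a (\<lambda>a\<^sub>1 a'. cosum H a' (\<lambda>a\<^sub>2 a\<^sub>3.
      mult H (S (mult H a\<^sub>1 b)) (mult H (mult H a\<^sub>2 (unit H)) (S a\<^sub>3))))"
    using ab by (intro sweedler_cong counit_right) (auto intro!: linear closed)
  also have "\<dots> = cosum H a (\<lambda>a\<^sub>1 a'. cosum H a' (\<lambda>a\<^sub>2 a\<^sub>3.
      mult H (S (mult H a\<^sub>1 b)) (mult H a\<^sub>2 (S a\<^sub>3))))"
    using ab by (simp add: mult_unit closed cong: sweedler_cong')
  also have "\<dots> = cosum H a (\<lambda>a\<^sub>1 a'. scal H (counit H a') (mult H (S (mult H a\<^sub>1 b)) (unit H)))"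
    using ab by (intro sweedler_cong antipode_right) (auto intro!: linear closed)
  also have "\<dots> = mult H (S (mult H a b)) (unit H)"
    using ab by (intro counit_right) (auto intro!: linear closed)
  also have "\<dots> = S (mult H a b)"
    using ab by (simp add: mult_unit closed)
  finally have 1: "?X = S (mult H a b)" .
  have "?X = cosum H a (\<lambda>a' a\<^sub>3. cosum H a' (\<lambda>a\<^sub>1 a\<^sub>2. cosum H b (\<lambda>b\<^sub>1 b'. cosum H b' (\<lambda>b\<^sub>2 b\<^sub>3. F a\<^sub>1 a\<^sub>2 a\<^sub>3 b\<^sub>1 b\<^sub>2 b\<^sub>3))))"
    using ab unfolding F_def by (intro coassoc[symmetric]) (auto intro!: linear closed)
  also have "\<dots> = cosum H a (\<lambda>a' a\<^sub>3. cosum H a' (\<lambda>a\<^sub>1 a\<^sub>2. cosum H b (\<lambda>b' b\<^sub>3. cosum H b' (\<lambda>b\<^sub>1 b\<^sub>2. F a\<^sub>1 a\<^sub>2 a\<^sub>3 b\<^sub>1 b\<^sub>2 b\<^sub>3))))"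
    using ab unfolding F_def by (intro sweedler_cong coassoc[symmetric]) (auto intro!: linear closed)
  also have "\<dots> = cosum H a (\<lambda>a' a\<^sub>3. cosum H b (\<lambda>b' b\<^sub>3. cosum H a' (\<lambda>a\<^sub>1 a\<^sub>2. cosum H b' (\<lambda>b\<^sub>1 b\<^sub>2. F a\<^sub>1 a\<^sub>2 a\<^sub>3 b\<^sub>1 b\<^sub>2 b\<^sub>3))))"
    by (subst sweedler_swap) (rule refl)
  also have "\<dots> = cosum H a (\<lambda>a' a\<^sub>3. cosum H b (\<lambda>b' b\<^sub>3. cosum H (mult H a' b')
      (\<lambda>x y. mult H (mult H (S x) y) (mult H (S b\<^sub>3) (S a\<^sub>3)))))"
    using ab by (intro sweedler_cong) (auto simp: comult_mult[of H] F_def closed linear mult_assoc cong: sweedler_cong')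
  also have "\<dots> = cosum H a (\<lambda>a' a\<^sub>3. cosum H b (\<lambda>b' b\<^sub>3. scal H (counit H (mult H a' b'))
      (mult H (unit H) (mult H (S b\<^sub>3) (S a\<^sub>3)))))"
    using ab by (intro sweedler_cong antipode_left) (auto intro!: linear closed)
  also have "\<dots> = cosum H a (\<lambda>a' a\<^sub>3. cosum H b (\<lambda>b' b\<^sub>3. scal H (counit H b')
      (scal H (counit H a') (mult H (S b\<^sub>3) (S a\<^sub>3)))))"
    using ab by (intro sweedler_cong)
      (auto simp: mult_unit closed counit_mult module.scale_scale[OF vs] mult.commute)
  also have "\<dots> = cosum H a (\<lambda>a' a\<^sub>3. scal H (counit H a') (mult H (S b) (S a\<^sub>3)))"
    using ab by (intro sweedler_cong counit_left) (auto intro!: linear closed)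
  also have "\<dots> = mult H (S b) (S a)"
    using ab by (intro counit_left) (auto intro!: linear closed)
  finally show ?thesis using 1 by simp
qed

lemma antipode_inv: "h \<in> carrier H \<Longrightarrow> T h \<in> carrier H" "h \<in> carrier H \<Longrightarrow> S (T h) = h"
    "h \<in> carrier H \<Longrightarrow> T (S h) = h"
  using bijective_antipode unfolding bijective_antipode_def antipode_inv_def bij_betw_def
  by (auto intro: inv_into_into f_inv_into_f)

lemma antipode_inv_eqI: "g \<in> carrier H \<Longrightarrow> S g = h \<Longrightarrow> T h = g"
  using antipode_inv(3) by blast

lemma antipode_inv_linear: "linear_map H H T"
  unfolding linear_map_def
  by (auto simp: antipode_inv closed vspace_add linear_map_add[OF antipode_linear]
      linear_map_scaleD[OF antipode_linear] intro!: antipode_inv_eqI)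

lemmas linear_antipode_inv [linear] = linear_map_compose[OF antipode_inv_linear]
declare antipode_inv(1) [closed]

lemma antipode_inv_unit: "T (unit H) = unit H"
  by (intro antipode_inv_eqI) (auto simp: antipode_unit)

lemma antipode_inv_mult: "a \<in> carrier H \<Longrightarrow> b \<in> carrier H \<Longrightarrow> T (mult H a b) = mult H (T b) (T a)"
  by (intro antipode_inv_eqI) (auto simp: antipode_mult antipode_inv closed)

text \<open>Apply the antimultiplicative map \<open>T\<close> to S(h_(1)) h_(2) = \<epsilon>(h) 1.
  The order of the factors is reversed: \<open>T\<close> behaves as an antipode of the opposite
  algebra.\<close>

lemma antipode_inv_left:
  assumes f: "linear_map H W f" and h: "h \<in> carrier H"
  shows "cosum H h (\<lambda>a b. f (mult H (T b) a)) = scal W (counit H h) (f (unit H))"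
proof -
  have *: "mult H (T b) a = T (mult H (S a) b)" if "a \<in> carrier H" "b \<in> carrier H" for a b
    using that by (simp add: antipode_inv_mult antipode_inv closed)
  have "cosum H h (\<lambda>a b. f (T (mult H (S a) b))) = scal W (counit H h) (f (T (unit H)))"
    using h f by (intro antipode_left) (auto intro!: linear linear_map_compose[OF f])
  thus ?thesis using h by (simp add: * antipode_inv_unit closed cong: sweedler_cong')
qed

lemma antipode_inv_right:
  assumes f: "linear_map H W f" and h: "h \<in> carrier H"
  shows "cosum H h (\<lambda>a b. f (mult H b (T a))) = scal W (counit H h) (f (unit H))"
proof -
  have *: "mult H b (T a) = T (mult H a (S b))" if "a \<in> carrier H" "b \<in> carrier H" for a b
    using that by (simp add: antipode_inv_mult antipode_inv closed)
  have "cosum H h (\<lambda>a b. f (T (mult H a (S b)))) = scal W (counit H h) (f (T (unit H)))"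
    using h f by (intro antipode_right) (auto intro!: linear linear_map_compose[OF f])
  thus ?thesis using h by (simp add: * antipode_inv_unit closed cong: sweedler_cong')
qed

end

section \<open>Bi-products\<close>

abbreviation coact_sum ::
  "('k::field, 'h::ab_group_add, 'n) bialg_scheme \<Rightarrow> ('k, 'r::ab_group_add, 'h) ydbialg
    \<Rightarrow> 'r \<Rightarrow> ('h \<Rightarrow> 'r \<Rightarrow> 'c::ab_group_add) \<Rightarrow> 'c" where
  "coact_sum H R r f \<equiv> sweedler H R (ycoact R r) f"

lemma biproduct_simps [simp]: "carrier (biproduct R H) = carrier (tensor R H)"
    "scal (biproduct R H) = fun_scal" "unit (biproduct R H) = tens R H (unit R) (unit H)"
  by (simp_all add: biproduct_def)

lemma op_bialg_simps [simp]: "carrier (op_bialg A) = carrier A" "scal (op_bialg A) = scal A"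
    "mult (op_bialg A) = (\<lambda>a b. mult A b a)" "unit (op_bialg A) = unit A"
    "comult (op_bialg A) = comult A" "counit (op_bialg A) = counit A"
  by (simp_all add: op_bialg_def)

lemma yd_op_simps [simp]: "carrier (yd_op H R) = carrier R" "scal (yd_op H R) = scal R"
    "mult (yd_op H R) = (\<lambda>a b. mult R b a)" "unit (yd_op H R) = unit R" "counit (yd_op H R) = counit R"
    "yact (yd_op H R) = (\<lambda>h r. yact R (antipode_inv H h) r)"
  by (simp_all add: yd_op_def)

lemma yd_of_simps [simp]: "carrier (yd_of R) = carrier R" "scal (yd_of R) = scal R"
  "act (yd_of R) = yact R" "coact (yd_of R) = ycoact R"
  by (simp_all add: yd_of_def)

lemma scal_biproduct_tensor: "scal (biproduct R H) = scal (tensor R H)"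
  by simp

lemmas biproduct_space [simp] = same_space[OF biproduct_simps(1) scal_biproduct_tensor]
lemmas op_bialg_space [simp] = same_space[OF op_bialg_simps(1,2)]
lemmas yd_op_space [simp] = same_space[OF yd_op_simps(1,2)]
lemmas yd_of_space [simp] = same_space[OF yd_of_simps(1,2)]

lemma yd_tensor_space:
  "carrier (yd_tensor H M N) = carrier (tensor M N)" "scal (yd_tensor H M N) = scal (tensor M N)"
  by (simp_all add: yd_tensor_def)

text \<open>Collects the data that determine the product of a bi-product, so that one set of lemmas
  serves both the pair (H, R) and the pair (H^op, R^op).\<close>

locale smash =
  fixes H :: "('k::field, 'h::ab_group_add, 'n) bialg_scheme"
    and R :: "('k, 'r::ab_group_add, 'h) ydbialg"
  assumes bialgebra_H: "bialgebra H" and algebra_R: "algebra R"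
    and bilinear_act: "bilinear_map H R R (yact R)"
    and act_unit: "r \<in> carrier R \<Longrightarrow> yact R (unit H) r = r"
    and act_mult: "g \<in> carrier H \<Longrightarrow> h \<in> carrier H \<Longrightarrow> r \<in> carrier R
      \<Longrightarrow> yact R (mult H g h) r = yact R g (yact R h r)"
begin

sublocale H: bialg H by unfold_locales (rule bialgebra_H)
sublocale R: alg R by unfold_locales (rule algebra_R)

abbreviation RH where "RH \<equiv> tensor R H"
abbreviation M where "M \<equiv> mult (biproduct R H)"

lemmas linear_act [linear] = bilinear_map_left[OF bilinear_act] bilinear_map_right[OF bilinear_act]
lemmas act_mem [closed] = bilinear_map_mem[OF bilinear_act]

lemma M_eq: "M x y = sweedler R H x (\<lambda>r h. sweedler R H y (\<lambda>r' h'.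
        cosum H h (\<lambda>h\<^sub>1 h\<^sub>2. tens R H (mult R r (yact R h\<^sub>1 r')) (mult H h\<^sub>2 h'))))"
  by (simp add: biproduct_def)

lemma bilinear_M: "bilinear_map RH RH RH M"
  unfolding M_eq[abs_def] by (auto intro!: linear closed)

lemmas linear_M [linear] = bilinear_map_left[OF bilinear_M] bilinear_map_right[OF bilinear_M]
lemmas M_mem [closed] = bilinear_map_mem[OF bilinear_M]

lemma M_tens:
  assumes "r \<in> carrier R" "h \<in> carrier H" "r' \<in> carrier R" "h' \<in> carrier H"
  shows "M (tens R H r h) (tens R H r' h')
    = cosum H h (\<lambda>h\<^sub>1 h\<^sub>2. tens R H (mult R r (yact R h\<^sub>1 r')) (mult H h\<^sub>2 h'))"
proof -
  have "M (tens R H r h) (tens R H r' h') = sweedler R H (tens R H r' h') (\<lambda>r' h'.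
        cosum H h (\<lambda>h\<^sub>1 h\<^sub>2. tens R H (mult R r (yact R h\<^sub>1 r')) (mult H h\<^sub>2 h')))"
    unfolding M_eq using assms by (intro sweedler_tens[of RH]) (auto intro!: linear closed)
  also have "\<dots> = cosum H h (\<lambda>h\<^sub>1 h\<^sub>2. tens R H (mult R r (yact R h\<^sub>1 r')) (mult H h\<^sub>2 h'))"
    using assms by (intro sweedler_tens[of RH]) (auto intro!: linear closed)
  finally show ?thesis .
qed

lemma M_sweedler_left:
  assumes "is_vspace X" "is_vspace Y" "z \<in> carrier (tensor X Y)" "y \<in> carrier RH"
    "\<And>a b. a \<in> carrier X \<Longrightarrow> b \<in> carrier Y \<Longrightarrow> f a b \<in> carrier RH"
  shows "M (sweedler X Y z f) y = sweedler X Y z (\<lambda>a b. M (f a b) y)"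
  using assms by (intro linear_map_of_sweedler[of RH RH "\<lambda>x. M x y"]) (auto intro!: linear)

lemma M_sweedler_right:
  assumes "is_vspace X" "is_vspace Y" "z \<in> carrier (tensor X Y)" "y \<in> carrier RH"
    "\<And>a b. a \<in> carrier X \<Longrightarrow> b \<in> carrier Y \<Longrightarrow> f a b \<in> carrier RH"
  shows "M y (sweedler X Y z f) = sweedler X Y z (\<lambda>a b. M y (f a b))"
  using assms by (intro linear_map_of_sweedler[of RH RH "M y"]) (auto intro!: linear)

end

locale yd_bialg =
  fixes H :: "('k::field, 'h::ab_group_add, 'n) bialg_scheme"
    and R :: "('k, 'r::ab_group_add, 'h) ydbialg"
  assumes bialgebra_base: "bialgebra H" and yd_bialgebra: "yd_bialgebra H R"
begin

lemma yd_module: "yd_module H (yd_of R)"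
  using yd_bialgebra by (simp add: yd_bialgebra_def)

sublocale smash H R
proof
  show "bialgebra H" by (rule bialgebra_base)
  show "algebra R" using yd_bialgebra by (simp add: yd_bialgebra_def)
qed (use yd_module in \<open>auto simp: yd_module_def\<close>)

sublocale R: coalg R
  using yd_bialgebra by unfold_locales (simp add: yd_bialgebra_def)

lemma coact_linear: "linear_map R (tensor H R) (ycoact R)"
  using yd_module by (simp add: yd_module_def)

lemmas linear_coact [linear] = linear_map_compose[OF coact_linear]
lemmas coact_mem [closed] = linear_map_mem[OF coact_linear]

lemma coact_coassoc:
  assumes W: "is_vspace W" and f: "trilinear_map H H R W f" and r: "r \<in> carrier R"
  shows "coact_sum H R r (\<lambda>g n. cosum H g (\<lambda>g\<^sub>1 g\<^sub>2. f g\<^sub>1 g\<^sub>2 n))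
    = coact_sum H R r (\<lambda>g n. coact_sum H R n (\<lambda>g' n'. f g g' n'))"
proof -
  note [linear, closed] = trilinear_rules[OF f]
  let ?L = "\<lambda>z. sweedler H (tensor H R) z (\<lambda>a y. sweedler H R y (f a))"
  have bil: "bilinear_map H (tensor H R) W (\<lambda>a y. sweedler H R y (f a))"
    using W by (auto intro!: linear closed)
  hence L: "linear_map (tensor H (tensor H R)) W ?L"
    using W by (auto intro!: linear)
  have tens: "?L (tens H (tensor H R) a y) = sweedler H R y (f a)"
    if "a \<in> carrier H" "y \<in> carrier (tensor H R)" for a y
    using sweedler_tens[OF W bil that] .
  note simps = linear_map_of_sweedler[OF L] closed tens sweedler_tens[OF W] linear
  have "coact_sum H R r (\<lambda>g n. cosum H g (\<lambda>g\<^sub>1 g\<^sub>2. f g\<^sub>1 g\<^sub>2 n))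
      = ?L (coact_sum H R r (\<lambda>g n. cosum H g (\<lambda>g\<^sub>1 g\<^sub>2. tens H (tensor H R) g\<^sub>1 (tens H R g\<^sub>2 n))))"
    using W r by (simp add: simps cong: sweedler_cong')
  also have "\<dots> = ?L (coact_sum H R r (\<lambda>g n. tens H (tensor H R) g (ycoact R n)))"
    using yd_module r by (simp add: yd_module_def)
  also have "\<dots> = coact_sum H R r (\<lambda>g n. coact_sum H R n (\<lambda>g' n'. f g g' n'))"
    using W r by (simp add: simps cong: sweedler_cong')
  finally show ?thesis .
qed

lemma yd_condition:
  assumes W: "is_vspace W" and f: "bilinear_map H R W f" and h: "h \<in> carrier H" and r: "r \<in> carrier R"
  shows "cosum H h (\<lambda>h\<^sub>1 h\<^sub>2. coact_sum H R r (\<lambda>g n. f (mult H h\<^sub>1 g) (yact R h\<^sub>2 n)))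
    = cosum H h (\<lambda>h\<^sub>1 h\<^sub>2. coact_sum H R (yact R h\<^sub>1 r) (\<lambda>g n. f (mult H g h\<^sub>2) n))"
proof -
  let ?L = "\<lambda>z. sweedler H R z f"
  note simps = linear_map_of_sweedler[OF linear_map_sweedler[OF _ _ W f]] closed sweedler_tens[OF W f]
  have "cosum H h (\<lambda>h\<^sub>1 h\<^sub>2. coact_sum H R r (\<lambda>g n. f (mult H h\<^sub>1 g) (yact R h\<^sub>2 n)))
    = ?L (cosum H h (\<lambda>h\<^sub>1 h\<^sub>2. coact_sum H R r (\<lambda>g n. tens H R (mult H h\<^sub>1 g) (yact R h\<^sub>2 n))))"
    using r h by (simp add: simps cong: sweedler_cong')
  also have "\<dots> = ?L (cosum H h (\<lambda>h\<^sub>1 h\<^sub>2. coact_sum H R (yact R h\<^sub>1 r) (\<lambda>g n. tens H R (mult H g h\<^sub>2) n)))"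
    using yd_module r h by (simp add: yd_module_def)
  also have "\<dots> = cosum H h (\<lambda>h\<^sub>1 h\<^sub>2. coact_sum H R (yact R h\<^sub>1 r) (\<lambda>g n. f (mult H g h\<^sub>2) n))"
    using r h by (simp add: simps cong: sweedler_cong')
  finally show ?thesis .
qed

text \<open>The product R \<otimes> R -> R is a morphism of the category, hence linear over H for
  the diagonal action: this is the module algebra axiom.\<close>

lemma act_alg_mult:
  assumes W: "linear_map R W f" and h: "h \<in> carrier H" and ab: "a \<in> carrier R" "b \<in> carrier R"
  shows "f (yact R h (mult R a b)) = cosum H h (\<lambda>h\<^sub>1 h\<^sub>2. f (mult R (yact R h\<^sub>1 a) (yact R h\<^sub>2 b)))"
proof -
  note simps = linear_map_of_sweedler[OF linear_map_sweedler[OF _ _ _ R.bilinear_mult]] closed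
    sweedler_tens[OF _ R.bilinear_mult]
  have "yd_hom H (yd_tensor H (yd_of R) (yd_of R)) (yd_of R) (\<lambda>x. sweedler R R x (mult R))"
    using yd_bialgebra by (simp add: yd_bialgebra_def)
  hence "sweedler R R (act (yd_tensor H (yd_of R) (yd_of R)) h (tens R R a b)) (mult R)
      = yact R h (mult R a b)"
    using h ab by (simp add: yd_hom_def yd_tensor_space closed sweedler_tens[OF _ R.bilinear_mult])
  also have "act (yd_tensor H (yd_of R) (yd_of R)) h (tens R R a b)
      = cosum H h (\<lambda>h\<^sub>1 h\<^sub>2. tens R R (yact R h\<^sub>1 a) (yact R h\<^sub>2 b))"
    using h ab by (simp add: yd_tensor_def sweedler_tens[of "tensor R R"] linear closed)
  also have "sweedler R R \<dots> (mult R) = cosum H h (\<lambda>h\<^sub>1 h\<^sub>2. mult R (yact R h\<^sub>1 a) (yact R h\<^sub>2 b))"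
    using h ab by (simp add: simps cong: sweedler_cong')
  finally show ?thesis
    using h ab by (simp add: linear_map_of_sweedler[OF W, symmetric] closed)
qed

lemma act_alg_unit: "h \<in> carrier H \<Longrightarrow> yact R h (unit R) = scal R (counit H h) (unit R)"
proof -
  assume h: "h \<in> carrier H"
  have "yd_hom H (yd_unit H) (yd_of R) (\<lambda>c. scal R c (unit R))"
    using yd_bialgebra by (simp add: yd_bialgebra_def)
  hence "scal R (counit H h * 1) (unit R) = yact R h (scal R 1 (unit R))"
    using h unfolding yd_hom_def yd_unit_def by (auto simp del: mult_1_right)
  thus ?thesis using module_of_vspace[of R] by (simp add: module.scale_one)
qed

lemma comult_act:
  assumes W: "is_vspace W" and f: "bilinear_map R R W f" and h: "h \<in> carrier H" and r: "r \<in> carrier R"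
  shows "cosum R (yact R h r) f
    = cosum H h (\<lambda>h\<^sub>1 h\<^sub>2. cosum R r (\<lambda>r\<^sub>1 r\<^sub>2. f (yact R h\<^sub>1 r\<^sub>1) (yact R h\<^sub>2 r\<^sub>2)))"
proof -
  note simps = linear_map_of_sweedler[OF linear_map_sweedler[OF _ _ W f]] closed
    sweedler_tens[OF W f]
  have "yd_hom H (yd_of R) (yd_tensor H (yd_of R) (yd_of R)) (comult R)"
    using yd_bialgebra by (simp add: yd_bialgebra_def)
  hence "comult R (yact R h r) = cosum R r (\<lambda>r\<^sub>1 r\<^sub>2. cosum H h (\<lambda>h\<^sub>1 h\<^sub>2. tens R R (yact R h\<^sub>1 r\<^sub>1) (yact R h\<^sub>2 r\<^sub>2)))"
    using h r by (simp add: yd_hom_def yd_tensor_def)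
  hence "cosum R (yact R h r) f = cosum R r (\<lambda>r\<^sub>1 r\<^sub>2. cosum H h (\<lambda>h\<^sub>1 h\<^sub>2. f (yact R h\<^sub>1 r\<^sub>1) (yact R h\<^sub>2 r\<^sub>2)))"
    using h r by (simp add: simps cong: sweedler_cong')
  thus ?thesis by (subst sweedler_swap) simp
qed

lemma counit_act: "h \<in> carrier H \<Longrightarrow> r \<in> carrier R \<Longrightarrow> counit R (yact R h r) = counit H h * counit R r"
  using yd_bialgebra by (simp add: yd_bialgebra_def yd_hom_def yd_unit_def)

lemma counit_R_unit: "counit R (unit R) = 1"
  using yd_bialgebra by (simp add: yd_bialgebra_def)

text \<open>Multiplicativity of the coproduct splits \<open>h\<^sub>2 h'\<close>; coassociativity
  then makes the factors acting on \<open>r'\<close> and on \<open>h' \<cdot> r''\<close> the two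
  legs of one coproduct, and the module algebra axiom merges them into a single action on a
  product.\<close>

lemma M_assoc:
  assumes "x \<in> carrier RH" "y \<in> carrier RH" "z \<in> carrier RH"
  shows "M (M x y) z = M x (M y z)"
proof (rule trilinear_tensor_eqI[of R H R H R H RH "\<lambda>x y z. M (M x y) z" "\<lambda>x y z. M x (M y z)"])
  fix r h r' h' r'' h''
  assume *: "r \<in> carrier R" "h \<in> carrier H" "r' \<in> carrier R" "h' \<in> carrier H"
    "r'' \<in> carrier R" "h'' \<in> carrier H"
  let ?F = "\<lambda>h\<^sub>1 p q p' q'. tens R H (mult R (mult R r (yact R h\<^sub>1 r')) (yact R (mult H p p') r''))
              (mult H (mult H q q') h'')"
  have "M (M (tens R H r h) (tens R H r' h')) (tens R H r'' h'')
      = cosum H h (\<lambda>h\<^sub>1 h\<^sub>2. cosum H (mult H h\<^sub>2 h') (\<lambda>x y.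
        tens R H (mult R (mult R r (yact R h\<^sub>1 r')) (yact R x r'')) (mult H y h'')))"
    using * by (simp add: M_tens M_sweedler_left closed cong: sweedler_cong')
  also have "\<dots> = cosum H h (\<lambda>h\<^sub>1 h\<^sub>2. cosum H h\<^sub>2 (\<lambda>p q. cosum H h' (\<lambda>p' q'. ?F h\<^sub>1 p q p' q')))"
    using * by (intro sweedler_cong H.comult_mult) (auto intro!: linear closed)
  also have "\<dots> = cosum H h (\<lambda>x q. cosum H x (\<lambda>h\<^sub>1 p. cosum H h' (\<lambda>p' q'. ?F h\<^sub>1 p q p' q')))"
    using * by (intro H.coassoc[symmetric]) (auto intro!: linear closed)
  also have "\<dots> = cosum H h (\<lambda>x q. cosum H h' (\<lambda>p' q'. cosum H x (\<lambda>h\<^sub>1 p. ?F h\<^sub>1 p q p' q')))"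
    by (subst sweedler_swap) (rule refl)
  also have "\<dots> = cosum H h (\<lambda>x q. cosum H h' (\<lambda>p' q'. cosum H x (\<lambda>h\<^sub>1 p.
     tens R H (mult R r (mult R (yact R h\<^sub>1 r') (yact R p (yact R p' r'')))) (mult H q (mult H q' h'')))))"
    using * by (simp add: closed act_mult H.mult_assoc R.mult_assoc cong: sweedler_cong')
  also have "\<dots> = cosum H h (\<lambda>x q. cosum H h' (\<lambda>p' q'.
     tens R H (mult R r (yact R x (mult R r' (yact R p' r'')))) (mult H q (mult H q' h''))))"
    using * by (intro sweedler_cong act_alg_mult[symmetric]) (auto intro!: linear closed)
  also have "\<dots> = cosum H h' (\<lambda>p' q'. cosum H h (\<lambda>x q.
     tens R H (mult R r (yact R x (mult R r' (yact R p' r'')))) (mult H q (mult H q' h''))))"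
    by (rule sweedler_swap)
  also have "\<dots> = M (tens R H r h) (M (tens R H r' h') (tens R H r'' h''))"
    using * by (simp add: M_tens M_sweedler_right closed cong: sweedler_cong')
  finally show "M (M (tens R H r h) (tens R H r' h')) (tens R H r'' h'')
    = M (tens R H r h) (M (tens R H r' h') (tens R H r'' h''))" .
qed (use assms in \<open>auto intro!: linear closed\<close>)

end

section \<open>The isomorphism with the opposite of the bi-product\<close>

lemma (in bialg) bialgebra_op: "bialgebra (op_bialg A)"
proof -
  have "algebra (op_bialg A)"
    by (auto simp: algebra_def mult_assoc mult_unit bilinear_map_def intro!: linear closed)
  moreover have "coalgebra (op_bialg A)" using coalgebra by (simp add: coalgebra_def linear_form_def)
  moreover have "comult A (mult A b a) = cosum A a (\<lambda>a\<^sub>1 a\<^sub>2. cosum A b (\<lambda>b\<^sub>1 b\<^sub>2.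
          tens A A (mult A b\<^sub>1 a\<^sub>1) (mult A b\<^sub>2 a\<^sub>2)))" if "a \<in> carrier A" "b \<in> carrier A" for a b
    using bialgebra that by (subst sweedler_swap) (simp add: bialgebra_def)
  ultimately show ?thesis
    using bialgebra by (simp add: bialgebra_def mult.commute)
qed

locale yd_hopf =
  fixes H :: "('k::field, 'h::ab_group_add) hopf" and R :: "('k, 'r::ab_group_add, 'h) ydbialg"
  assumes hopf: "hopf_algebra H" and bijective: "bijective_antipode H" and yd: "yd_bialgebra H R"
begin

sublocale H: hopf_alg H by unfold_locales (fact hopf bijective)+
sublocale yd_bialg H R by unfold_locales (use hopf yd in \<open>auto simp: hopf_algebra_def\<close>)

abbreviation T where "T \<equiv> antipode_inv H"

text \<open>The inverse antipode reverses products, so acting through it is an action of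
  H^op.\<close>

sublocale op: smash "op_bialg H" "yd_op H R"
proof
  show "bialgebra (op_bialg H)" by (rule H.bialgebra_op)
  show "algebra (yd_op H R)"
    by (auto simp: algebra_def R.mult_assoc R.mult_unit bilinear_map_def intro!: linear closed)
  show "bilinear_map (op_bialg H) (yd_op H R) (yd_op H R) (yact (yd_op H R))"
    by (auto intro!: linear closed)
qed (auto simp: act_unit H.antipode_inv_unit H.antipode_inv_mult act_mult closed)

lemmas linear_op_M [linear] = op.linear_M[simplified]
lemmas op_M_mem [closed] = op.M_mem[simplified]

lemma act_antipode_inv_cancel:
  assumes f: "linear_map R W f" and hr: "h \<in> carrier H" "r \<in> carrier R"
  shows "cosum H h (\<lambda>a b. f (yact R b (yact R (T a) r))) = scal W (counit H h) (f r)"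
    "cosum H h (\<lambda>a b. f (yact R (T b) (yact R a r))) = scal W (counit H h) (f r)"
proof -
  have L: "linear_map H W (\<lambda>g. f (yact R g r))"
    using hr by (auto intro!: linear linear_map_compose[OF f])
  show "cosum H h (\<lambda>a b. f (yact R b (yact R (T a) r))) = scal W (counit H h) (f r)"
    using H.antipode_inv_right[OF L hr(1)] hr by (simp add: act_mult act_unit closed cong: sweedler_cong')
  show "cosum H h (\<lambda>a b. f (yact R (T b) (yact R a r))) = scal W (counit H h) (f r)"
    using H.antipode_inv_left[OF L hr(1)] hr by (simp add: act_mult act_unit closed cong: sweedler_cong')
qed

abbreviation \<phi> where "\<phi> \<equiv> phi H R"

definition \<psi> where
  "\<psi> x = sweedler R H x (\<lambda>r h. cosum H h (\<lambda>a b. tens R H (yact R (T a) r) b))"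

lemma linear_map_\<psi>: "linear_map RH RH \<psi>"
  unfolding \<psi>_def[abs_def] by (auto intro!: linear closed)

lemmas linear_\<psi> [linear] = linear_map_compose[OF linear_map_\<psi>]
lemmas \<psi>_mem [closed] = linear_map_mem[OF linear_map_\<psi>]

lemma \<psi>_tens:
  "r \<in> carrier R \<Longrightarrow> h \<in> carrier H \<Longrightarrow> \<psi> (tens R H r h) = cosum H h (\<lambda>a b. tens R H (yact R (T a) r) b)"
  unfolding \<psi>_def by (intro sweedler_tens[of RH]) (auto intro!: linear closed)

lemma \<psi>_unit: "\<psi> (tens R H (unit R) (unit H)) = tens R H (unit R) (unit H)"
proof -
  have "\<psi> (tens R H (unit R) (unit H)) = tens R H (yact R (antipode_inv H (unit H)) (unit R)) (unit H)"
    by (subst \<psi>_tens, simp_all, intro H.comult_unit[of "tensor R H"]) (auto intro!: linear closed)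
  thus ?thesis by (simp add: H.antipode_inv_unit act_unit)
qed

lemma M_unit_tens:
  shows "r \<in> carrier R \<Longrightarrow> h \<in> carrier H \<Longrightarrow> h' \<in> carrier H \<Longrightarrow> M (tens R H (unit R) h) (tens R H r h') = cosum H h (\<lambda>a b. tens R H (yact R a r) (mult H b h'))"
    and "r \<in> carrier R \<Longrightarrow> h \<in> carrier H \<Longrightarrow> r' \<in> carrier R \<Longrightarrow> M (tens R H r' (unit H)) (tens R H r h) = tens R H (mult R r' r) h"
proof -
  show "M (tens R H (unit R) h) (tens R H r h') = cosum H h (\<lambda>a b. tens R H (yact R a r) (mult H b h'))"
    if "r \<in> carrier R" "h \<in> carrier H" "h' \<in> carrier H"
    using that by (simp add: M_tens R.mult_unit closed cong: sweedler_cong')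
  assume *: "r \<in> carrier R" "h \<in> carrier H" "r' \<in> carrier R"
  have "M (tens R H r' (unit H)) (tens R H r h)
    = tens R H (mult R r' (yact R (unit H) r)) (mult H (unit H) h)"
    using * by (subst M_tens, simp_all, intro H.comult_unit[of RH]) (auto intro!: linear closed)
  thus "M (tens R H r' (unit H)) (tens R H r h) = tens R H (mult R r' r) h"
    using * by (simp add: act_unit H.mult_unit)
qed

text \<open>H acts on the unit of R through \<epsilon>, so the first leg of h is absorbed by the
  counit axiom and H embeds in R # H as a subalgebra.\<close>

lemma M_unit_unit:
  assumes "h \<in> carrier H" "h' \<in> carrier H"
  shows "M (tens R H (unit R) h) (tens R H (unit R) h') = tens R H (unit R) (mult H h h')"
proof -
  have "M (tens R H (unit R) h) (tens R H (unit R) h')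
      = cosum H h (\<lambda>a b. tens R H (scal R (counit H a) (unit R)) (mult H b h'))"
    using assms by (simp add: M_unit_tens act_alg_unit closed cong: sweedler_cong')
  also have "\<dots> = cosum H h (\<lambda>a b. scal RH (counit H a) (tens R H (unit R) (mult H b h')))"
  proof (intro sweedler_cong)
    fix a b assume "a \<in> carrier H" "b \<in> carrier H"
    thus "tens R H (scal R (counit H a) (unit R)) (mult H b h')
        = scal RH (counit H a) (tens R H (unit R) (mult H b h'))"
      using assms by (intro linear_map_scaleD[of R RH "\<lambda>r. tens R H r (mult H b h')"])
        (auto intro!: linear closed)
  qed (use assms in \<open>auto intro!: closed\<close>)
  also have "\<dots> = tens R H (unit R) (mult H h h')"
    using assms by (intro H.counit_left) (auto intro!: linear closed)
  finally show ?thesis .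
qed

lemma phi_eq: "\<phi> x = sweedler R H x (\<lambda>r h. M (tens R H (unit R) h) (tens R H r (unit H)))"
  by (simp add: phi_def)

lemma linear_map_phi: "linear_map RH RH \<phi>"
  unfolding phi_eq[abs_def] by (auto intro!: linear closed)

lemmas linear_phi [linear] = linear_map_compose[OF linear_map_phi]
lemmas phi_mem [closed] = linear_map_mem[OF linear_map_phi]

lemma phi_tens_M:
  "r \<in> carrier R \<Longrightarrow> h \<in> carrier H \<Longrightarrow> \<phi> (tens R H r h) = M (tens R H (unit R) h) (tens R H r (unit H))"
  unfolding phi_eq by (intro sweedler_tens[of RH]) (auto intro!: linear closed)

lemma phi_tens:
  "r \<in> carrier R \<Longrightarrow> h \<in> carrier H \<Longrightarrow> \<phi> (tens R H r h) = cosum H h (\<lambda>a b. tens R H (yact R a r) b)"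
  by (simp add: phi_tens_M M_unit_tens H.mult_unit closed cong: sweedler_cong')

text \<open>Coassociativity makes \<open>T a\<^sub>1\<close> and \<open>a\<^sub>2\<close> adjacent,
  and \<open>a\<^sub>2 T(a\<^sub>1)\<close> collapses to the counit. In the other composite the
  collapsing product is \<open>T(a\<^sub>2) a\<^sub>1\<close>.\<close>

lemma phi_\<psi>:
  assumes "x \<in> carrier RH"
  shows "\<phi> (\<psi> x) = x"
proof (rule linear_map_tensor_eqI[of R H RH "\<lambda>x. \<phi> (\<psi> x)" "\<lambda>x. x"])
  fix r h assume rh: "r \<in> carrier R" "h \<in> carrier H"
  have "\<phi> (\<psi> (tens R H r h)) = cosum H h (\<lambda>a b. \<phi> (tens R H (yact R (T a) r) b))"
    using rh by (simp add: \<psi>_tens linear_map_of_sweedler[OF linear_map_phi] closed)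
  also have "\<dots> = cosum H h (\<lambda>a b. cosum H b (\<lambda>b\<^sub>1 b\<^sub>2. tens R H (yact R b\<^sub>1 (yact R (T a) r)) b\<^sub>2))"
    using rh by (simp add: phi_tens closed cong: sweedler_cong')
  also have "\<dots> = cosum H h (\<lambda>a b. cosum H a (\<lambda>a\<^sub>1 a\<^sub>2. tens R H (yact R a\<^sub>2 (yact R (T a\<^sub>1) r)) b))"
    using rh by (intro H.coassoc[symmetric]) (auto intro!: linear closed)
  also have "\<dots> = cosum H h (\<lambda>a b. scal RH (counit H a) (tens R H r b))"
    using rh by (intro sweedler_cong act_antipode_inv_cancel) (auto intro!: linear closed)
  also have "\<dots> = tens R H r h"
    using rh by (intro H.counit_left) (auto intro!: linear closed)
  finally show "\<phi> (\<psi> (tens R H r h)) = tens R H r h" .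
qed (use assms in \<open>auto intro!: linear\<close>)

lemma \<psi>_phi:
  assumes "x \<in> carrier RH"
  shows "\<psi> (\<phi> x) = x"
proof (rule linear_map_tensor_eqI[of R H RH "\<lambda>x. \<psi> (\<phi> x)" "\<lambda>x. x"])
  fix r h assume rh: "r \<in> carrier R" "h \<in> carrier H"
  have "\<psi> (\<phi> (tens R H r h)) = cosum H h (\<lambda>a b. \<psi> (tens R H (yact R a r) b))"
    using rh by (simp add: phi_tens linear_map_of_sweedler[OF linear_map_\<psi>] closed)
  also have "\<dots> = cosum H h (\<lambda>a b. cosum H b (\<lambda>b\<^sub>1 b\<^sub>2. tens R H (yact R (T b\<^sub>1) (yact R a r)) b\<^sub>2))"
    using rh by (simp add: \<psi>_tens closed cong: sweedler_cong')
  also have "\<dots> = cosum H h (\<lambda>a b. cosum H a (\<lambda>a\<^sub>1 a\<^sub>2. tens R H (yact R (T a\<^sub>2) (yact R a\<^sub>1 r)) b))"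
    using rh by (intro H.coassoc[symmetric]) (auto intro!: linear closed)
  also have "\<dots> = cosum H h (\<lambda>a b. scal RH (counit H a) (tens R H r b))"
    using rh by (intro sweedler_cong act_antipode_inv_cancel) (auto intro!: linear closed)
  also have "\<dots> = tens R H r h"
    using rh by (intro H.counit_left) (auto intro!: linear closed)
  finally show "\<psi> (\<phi> (tens R H r h)) = tens R H r h" .
qed (use assms in \<open>auto intro!: linear\<close>)

lemma bij_betw_phi: "bij_betw \<phi> (carrier RH) (carrier RH)"
  by (rule bij_betw_byWitness[of _ \<psi>]) (auto simp: phi_\<psi> \<psi>_phi closed)

lemma phi_inv_eq: "x \<in> carrier RH \<Longrightarrow> phi_inv H R x = \<psi> x"
  using bij_betw_phi unfolding phi_inv_def
  by (intro inv_into_f_eq) (auto simp: bij_betw_def phi_\<psi> closed)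

text \<open>The product of \<open>1 # h\<^sub>(\<^sub>2\<^sub>)\<close> and \<open>S\<^sup>-\<^sup>1(h\<^sub>(\<^sub>1\<^sub>)) \<cdot> r' # 1\<close> is \<open>\<phi>(\<psi>(r' # h)) = (r' # 1)(1 # h)\<close>.\<close>

lemma phi_op_mult:
  assumes "x \<in> carrier RH" "y \<in> carrier RH"
  shows "\<phi> (op.M x y) = M (\<phi> y) (\<phi> x)"
proof (rule bilinear_tensor_eqI[of R H R H RH "\<lambda>x y. \<phi> (op.M x y)" "\<lambda>x y. M (\<phi> y) (\<phi> x)"])
  fix r h r' h'
  assume *: "r \<in> carrier R" "h \<in> carrier H" "r' \<in> carrier R" "h' \<in> carrier H"
  have "\<phi> (op.M (tens R H r h) (tens R H r' h'))
      = cosum H h (\<lambda>a b. \<phi> (tens R H (mult R (yact R (T a) r') r) (mult H h' b)))"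
    using * op.M_tens[of r h r' h'] by (simp add: linear_map_of_sweedler[OF linear_map_phi] closed)
  also have "\<dots> = cosum H h (\<lambda>a b. M (M (tens R H (unit R) h') (tens R H (unit R) b))
       (M (tens R H (yact R (T a) r') (unit H)) (tens R H r (unit H))))"
    using * by (simp add: phi_tens_M M_unit_unit M_unit_tens(2) closed cong: sweedler_cong')
  also have "\<dots> = cosum H h (\<lambda>a b. M (M (tens R H (unit R) h')
       (\<phi> (tens R H (yact R (T a) r') b))) (tens R H r (unit H)))"
    using * by (simp add: phi_tens_M M_assoc closed cong: sweedler_cong')
  also have "\<dots> = M (M (tens R H (unit R) h') (\<phi> (\<psi> (tens R H r' h)))) (tens R H r (unit H))"
    using * by (simp add: \<psi>_tens linear_map_of_sweedler[OF linear_map_phi] M_sweedler_left M_sweedler_right closed)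
  also have "\<dots> = M (M (tens R H (unit R) h') (M (tens R H r' (unit H)) (tens R H (unit R) h)))
      (tens R H r (unit H))"
    using * by (simp add: phi_\<psi> M_unit_tens R.mult_unit closed)
  also have "\<dots> = M (\<phi> (tens R H r' h')) (\<phi> (tens R H r h))"
    using * by (simp add: phi_tens_M M_assoc closed)
  finally show "\<phi> (op.M (tens R H r h) (tens R H r' h')) = M (\<phi> (tens R H r' h')) (\<phi> (tens R H r h))" .
qed (use assms in \<open>auto intro!: linear closed\<close>)

text \<open>Both bracketings have the same image under \<open>\<phi>\<close> by associativity in R #
  H, and \<open>\<psi>\<close> is a left inverse of \<open>\<phi>\<close>.\<close>

lemma op_M_assoc:
  assumes "x \<in> carrier RH" "y \<in> carrier RH" "z \<in> carrier RH"
  shows "op.M (op.M x y) z = op.M x (op.M y z)"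
proof -
  have "\<phi> (op.M (op.M x y) z) = \<phi> (op.M x (op.M y z))"
    using assms by (simp add: phi_op_mult M_assoc closed)
  hence "\<psi> (\<phi> (op.M (op.M x y) z)) = \<psi> (\<phi> (op.M x (op.M y z)))" by simp
  thus ?thesis using assms by (simp add: \<psi>_phi closed)
qed

lemma \<psi>_M:
  assumes "x \<in> carrier RH" "y \<in> carrier RH"
  shows "\<psi> (M x y) = op.M (\<psi> y) (\<psi> x)"
proof -
  have "\<phi> (op.M (\<psi> y) (\<psi> x)) = M x y"
    using assms by (simp add: phi_op_mult phi_\<psi> closed)
  thus ?thesis using assms \<psi>_phi[of "op.M (\<psi> y) (\<psi> x)"] by (simp add: closed)
qed

end

section \<open>The coproduct of the bi-product and its pull-back along \<open>\<phi>\<close>\<close>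

context yd_bialg
begin

abbreviation \<Delta> where "\<Delta> \<equiv> comult (biproduct R H)"

lemma \<Delta>_eq: "\<Delta> x = sweedler R H x (\<lambda>r h. cosum R r (\<lambda>r\<^sub>1 r\<^sub>2.
        coact_sum H R r\<^sub>2 (\<lambda>g r\<^sub>2'. cosum H h (\<lambda>h\<^sub>1 h\<^sub>2.
          tens RH RH (tens R H r\<^sub>1 (mult H g h\<^sub>1)) (tens R H r\<^sub>2' h\<^sub>2)))))"
  by (simp add: biproduct_def)

lemma linear_map_\<Delta>: "linear_map RH (tensor RH RH) \<Delta>"
  unfolding \<Delta>_eq[abs_def] by (auto intro!: linear closed)

lemmas linear_\<Delta> [linear] = linear_map_compose[OF linear_map_\<Delta>]
lemmas \<Delta>_mem [closed] = linear_map_mem[OF linear_map_\<Delta>]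

lemma \<Delta>_tens_sum:
  assumes W: "is_vspace W" and G: "bilinear_map RH RH W G" and rh: "r \<in> carrier R" "h \<in> carrier H"
  shows "sweedler RH RH (\<Delta> (tens R H r h)) G = cosum R r (\<lambda>r\<^sub>1 r\<^sub>2.
        coact_sum H R r\<^sub>2 (\<lambda>g n. cosum H h (\<lambda>h\<^sub>1 h\<^sub>2. G (tens R H r\<^sub>1 (mult H g h\<^sub>1)) (tens R H n h\<^sub>2))))"
proof -
  have "\<Delta> (tens R H r h) = cosum R r (\<lambda>r\<^sub>1 r\<^sub>2. coact_sum H R r\<^sub>2 (\<lambda>g n. cosum H h (\<lambda>h\<^sub>1 h\<^sub>2.
          tens RH RH (tens R H r\<^sub>1 (mult H g h\<^sub>1)) (tens R H n h\<^sub>2))))"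
    unfolding \<Delta>_eq using rh by (intro sweedler_tens[of "tensor RH RH"]) (auto intro!: linear closed)
  thus ?thesis using rh W
    by (simp add: linear_map_of_sweedler[OF linear_map_sweedler[OF _ _ W G]] closed
        sweedler_tens[OF W G] cong: sweedler_cong')
qed

end

context yd_hopf
begin

text \<open>Both sides are brought to one normal form: the sum of \<open>?E\<close> over the
  coproducts of both legs of h, that is, h_(1) acts on r^(1), h_(2) multiplies g, h_(3) acts on n
  and h_(4) is the last factor. On the left the Yetter-Drinfel'd condition moves h past the
  coaction; on the right the inserted S^{-1}(g_(1)) cancels.\<close>

lemma phi_comult:
  assumes W: "is_vspace W" and G: "bilinear_map RH RH W G" and rh: "r \<in> carrier R" "h \<in> carrier H"
  shows "sweedler RH RH (\<Delta> (\<phi> (tens R H r h))) G = cosum R r (\<lambda>r\<^sub>1 r\<^sub>2. coact_sum H R r\<^sub>2 (\<lambda>g n.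
    cosum H g (\<lambda>g\<^sub>1 g\<^sub>2. cosum H h (\<lambda>h\<^sub>1 h\<^sub>2.
      G (\<phi> (tens R H (yact R (T g\<^sub>1) r\<^sub>1) (mult H h\<^sub>1 g\<^sub>2))) (\<phi> (tens R H n h\<^sub>2))))))"
    (is "?L = ?R")
proof -
  note [linear, closed] = bilinear_rules[OF G]
  note W [simp]
  let ?D = "\<lambda>x. sweedler RH RH (\<Delta> x) G"
  have D: "linear_map RH W ?D" by (auto intro!: linear closed)
  let ?E = "\<lambda>p p' c d r\<^sub>1 g n. G (tens R H (yact R p r\<^sub>1) (mult H p' g)) (tens R H (yact R c n) d)"
  have "?L = cosum H h (\<lambda>a b. ?D (tens R H (yact R a r) b))"
    using rh by (simp add: phi_tens linear_map_of_sweedler[OF D] closed)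
  also have "\<dots> = cosum H h (\<lambda>a b. cosum R (yact R a r) (\<lambda>r\<^sub>1 r\<^sub>2.
        coact_sum H R r\<^sub>2 (\<lambda>g n. cosum H b (\<lambda>b\<^sub>1 b\<^sub>2. G (tens R H r\<^sub>1 (mult H g b\<^sub>1)) (tens R H n b\<^sub>2)))))"
    using rh by (intro sweedler_cong \<Delta>_tens_sum) (auto intro!: G closed)
  also have "\<dots> = cosum H h (\<lambda>a b. cosum H a (\<lambda>a\<^sub>1 a\<^sub>2. cosum R r (\<lambda>r\<^sub>1 r\<^sub>2.
        coact_sum H R (yact R a\<^sub>2 r\<^sub>2) (\<lambda>g n. cosum H b (\<lambda>b\<^sub>1 b\<^sub>2.
          G (tens R H (yact R a\<^sub>1 r\<^sub>1) (mult H g b\<^sub>1)) (tens R H n b\<^sub>2))))))"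
    using rh by (intro sweedler_cong comult_act) (auto intro!: linear closed)
  also have "\<dots> = cosum H h (\<lambda>a\<^sub>1 y. cosum H y (\<lambda>a\<^sub>2 b. cosum R r (\<lambda>r\<^sub>1 r\<^sub>2.
        coact_sum H R (yact R a\<^sub>2 r\<^sub>2) (\<lambda>g n. cosum H b (\<lambda>b\<^sub>1 b\<^sub>2.
          G (tens R H (yact R a\<^sub>1 r\<^sub>1) (mult H g b\<^sub>1)) (tens R H n b\<^sub>2))))))"
    using rh by (intro H.coassoc) (auto intro!: linear closed)
  also have "\<dots> = cosum H h (\<lambda>a\<^sub>1 y. cosum R r (\<lambda>r\<^sub>1 r\<^sub>2. cosum H y (\<lambda>a\<^sub>2 b. cosum H b (\<lambda>b\<^sub>1 b\<^sub>2.
        coact_sum H R (yact R a\<^sub>2 r\<^sub>2) (\<lambda>g n.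
          G (tens R H (yact R a\<^sub>1 r\<^sub>1) (mult H g b\<^sub>1)) (tens R H n b\<^sub>2))))))"
    by (subst sweedler_swap[of R R], subst sweedler_swap[of H R]) (rule refl)
  \<comment> \<open>\<open>a\<^sub>2\<close> and \<open>b\<^sub>1\<close> must be the two legs of
    the same element \<open>x\<close>: the coaction of \<open>a\<^sub>2 \<cdot> r\<^sub>2\<close> is
    multiplied by \<open>b\<^sub>1\<close>, which is the right-hand side of the Yetter-Drinfel'd
    condition for \<open>x\<close>.\<close>
  also have "\<dots> = cosum H h (\<lambda>a\<^sub>1 y. cosum R r (\<lambda>r\<^sub>1 r\<^sub>2. cosum H y (\<lambda>x b\<^sub>2. cosum H x (\<lambda>a\<^sub>2 b\<^sub>1.
        coact_sum H R (yact R a\<^sub>2 r\<^sub>2) (\<lambda>g n.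
          G (tens R H (yact R a\<^sub>1 r\<^sub>1) (mult H g b\<^sub>1)) (tens R H n b\<^sub>2))))))"
    using rh by (intro sweedler_cong H.coassoc[symmetric]) (auto intro!: linear closed)
  also have "\<dots> = cosum H h (\<lambda>a\<^sub>1 y. cosum R r (\<lambda>r\<^sub>1 r\<^sub>2. cosum H y (\<lambda>x b\<^sub>2. cosum H x (\<lambda>a\<^sub>2 b\<^sub>1.
        coact_sum H R r\<^sub>2 (\<lambda>g n. ?E a\<^sub>1 a\<^sub>2 b\<^sub>1 b\<^sub>2 r\<^sub>1 g n)))))"
    using rh by (intro sweedler_cong yd_condition[symmetric, where f="\<lambda>g n. G (tens R H (yact R _ _) g) (tens R H n _)"])
      (auto intro!: linear closed)
  also have "\<dots> = cosum R r (\<lambda>r\<^sub>1 r\<^sub>2. coact_sum H R r\<^sub>2 (\<lambda>g n. cosum H h (\<lambda>a\<^sub>1 y. cosum H y (\<lambda>x b\<^sub>2.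
      cosum H x (\<lambda>a\<^sub>2 b\<^sub>1. ?E a\<^sub>1 a\<^sub>2 b\<^sub>1 b\<^sub>2 r\<^sub>1 g n)))))"
    by (simp only: sweedler_swap[of H H _ H R] sweedler_swap[of H H _ R R])
  also have "\<dots> = cosum R r (\<lambda>r\<^sub>1 r\<^sub>2. coact_sum H R r\<^sub>2 (\<lambda>g n. cosum H h (\<lambda>x y. cosum H x (\<lambda>a\<^sub>1 a\<^sub>2.
      cosum H y (\<lambda>b\<^sub>1 b\<^sub>2. ?E a\<^sub>1 a\<^sub>2 b\<^sub>1 b\<^sub>2 r\<^sub>1 g n)))))"
    using rh by (intro sweedler_cong H.coassoc4[symmetric]) (auto intro!: linear closed)
  finally have L: "?L = \<dots>" .
  \<comment> \<open>\<open>q\<close> and \<open>g\<^sub>1\<close> become adjacent legs of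
    \<open>g\<close>, so that \<open>q T(g\<^sub>1)\<close> acts on \<open>r\<^sub>1\<close> as the
    counit. This is the cancellation for which S^{-1}(g_(1)) occurs in the formula.\<close>
  have inner: "cosum H g (\<lambda>g\<^sub>1 g\<^sub>2. cosum H g\<^sub>2 (\<lambda>q q'.
      G (tens R H (yact R (mult H p q) (yact R (T g\<^sub>1) r\<^sub>1)) (mult H p' q')) z))
    = G (tens R H (yact R p r\<^sub>1) (mult H p' g)) z"
    if *: "g \<in> carrier H" "r\<^sub>1 \<in> carrier R" "p \<in> carrier H" "p' \<in> carrier H" "z \<in> carrier RH" for g r\<^sub>1 p p' z
  proof -
    have "cosum H g (\<lambda>g\<^sub>1 g\<^sub>2. cosum H g\<^sub>2 (\<lambda>q q'.
      G (tens R H (yact R (mult H p q) (yact R (T g\<^sub>1) r\<^sub>1)) (mult H p' q')) z))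
      = cosum H g (\<lambda>x q'. cosum H x (\<lambda>g\<^sub>1 q.
      G (tens R H (yact R (mult H p q) (yact R (T g\<^sub>1) r\<^sub>1)) (mult H p' q')) z))"
      using * by (intro H.coassoc[symmetric]) (auto intro!: linear closed)
    also have "\<dots> = cosum H g (\<lambda>x q'. cosum H x (\<lambda>g\<^sub>1 q.
      G (tens R H (yact R p (yact R q (yact R (T g\<^sub>1) r\<^sub>1))) (mult H p' q')) z))"
      using * by (simp add: act_mult closed cong: sweedler_cong')
    also have "\<dots> = cosum H g (\<lambda>x q'. scal W (counit H x) (G (tens R H (yact R p r\<^sub>1) (mult H p' q')) z))"
      using * by (intro sweedler_cong act_antipode_inv_cancel) (auto intro!: linear closed)
    also have "\<dots> = G (tens R H (yact R p r\<^sub>1) (mult H p' g)) z"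
      using * by (intro H.counit_left) (auto intro!: linear closed)
    finally show ?thesis .
  qed
  have G1: "G (sweedler X Y x f) z = sweedler X Y x (\<lambda>a b. G (f a b) z)"
    if "is_vspace X" "is_vspace Y" "x \<in> carrier (tensor X Y)" "z \<in> carrier RH"
      "\<And>a b. a \<in> carrier X \<Longrightarrow> b \<in> carrier Y \<Longrightarrow> f a b \<in> carrier RH"
    for X :: "('k, 'h) hopf" and Y :: "('k, 'h) hopf" and x f z
    using that by (intro linear_map_of_sweedler[of RH W "\<lambda>x. G x z"]) (auto intro!: linear)
  have G2: "G z (sweedler X Y x f) = sweedler X Y x (\<lambda>a b. G z (f a b))"
    if "is_vspace X" "is_vspace Y" "x \<in> carrier (tensor X Y)" "z \<in> carrier RH"
      "\<And>a b. a \<in> carrier X \<Longrightarrow> b \<in> carrier Y \<Longrightarrow> f a b \<in> carrier RH"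
    for X :: "('k, 'h) hopf" and Y :: "('k, 'h) hopf" and x f z
    using that by (intro linear_map_of_sweedler[of RH W "G z"]) (auto intro!: linear)
  \<comment> \<open>The right-hand side is expanded by the formula for \<open>\<phi>\<close>; the
    swaps that follow isolate the sum over the legs of \<open>g\<close>, to which
    \<open>inner\<close> applies.\<close>
  have "?R = cosum R r (\<lambda>r\<^sub>1 r\<^sub>2. coact_sum H R r\<^sub>2 (\<lambda>g n.
      cosum H g (\<lambda>g\<^sub>1 g\<^sub>2. cosum H h (\<lambda>h\<^sub>1 h\<^sub>2. cosum H h\<^sub>2 (\<lambda>c d. cosum H (mult H h\<^sub>1 g\<^sub>2) (\<lambda>x y.
      G (tens R H (yact R x (yact R (T g\<^sub>1) r\<^sub>1)) y) (tens R H (yact R c n) d)))))))"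
    using rh by (simp add: phi_tens G1 G2 closed cong: sweedler_cong')
  also have "\<dots> = cosum R r (\<lambda>r\<^sub>1 r\<^sub>2. coact_sum H R r\<^sub>2 (\<lambda>g n.
      cosum H g (\<lambda>g\<^sub>1 g\<^sub>2. cosum H h (\<lambda>h\<^sub>1 h\<^sub>2. cosum H h\<^sub>2 (\<lambda>c d. cosum H h\<^sub>1 (\<lambda>p p'. cosum H g\<^sub>2 (\<lambda>q q'.
      G (tens R H (yact R (mult H p q) (yact R (T g\<^sub>1) r\<^sub>1)) (mult H p' q')) (tens R H (yact R c n) d))))))))"
    using rh by (intro sweedler_cong H.comult_mult) (auto intro!: linear closed)
  also have "\<dots> = cosum R r (\<lambda>r\<^sub>1 r\<^sub>2. coact_sum H R r\<^sub>2 (\<lambda>g n.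
      cosum H h (\<lambda>h\<^sub>1 h\<^sub>2. cosum H g (\<lambda>g\<^sub>1 g\<^sub>2. cosum H h\<^sub>2 (\<lambda>c d. cosum H h\<^sub>1 (\<lambda>p p'. cosum H g\<^sub>2 (\<lambda>q q'.
      G (tens R H (yact R (mult H p q) (yact R (T g\<^sub>1) r\<^sub>1)) (mult H p' q')) (tens R H (yact R c n) d))))))))"
    using rh by (intro sweedler_cong sweedler_swap) (auto intro!: closed)
  also have "\<dots> = cosum R r (\<lambda>r\<^sub>1 r\<^sub>2. coact_sum H R r\<^sub>2 (\<lambda>g n.
      cosum H h (\<lambda>h\<^sub>1 h\<^sub>2. cosum H h\<^sub>2 (\<lambda>c d. cosum H g (\<lambda>g\<^sub>1 g\<^sub>2. cosum H h\<^sub>1 (\<lambda>p p'. cosum H g\<^sub>2 (\<lambda>q q'.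
      G (tens R H (yact R (mult H p q) (yact R (T g\<^sub>1) r\<^sub>1)) (mult H p' q')) (tens R H (yact R c n) d))))))))"
    using rh by (intro sweedler_cong sweedler_swap) (auto intro!: closed)
  also have "\<dots> = cosum R r (\<lambda>r\<^sub>1 r\<^sub>2. coact_sum H R r\<^sub>2 (\<lambda>g n.
      cosum H h (\<lambda>h\<^sub>1 h\<^sub>2. cosum H h\<^sub>2 (\<lambda>c d. cosum H h\<^sub>1 (\<lambda>p p'. cosum H g (\<lambda>g\<^sub>1 g\<^sub>2. cosum H g\<^sub>2 (\<lambda>q q'.
      G (tens R H (yact R (mult H p q) (yact R (T g\<^sub>1) r\<^sub>1)) (mult H p' q')) (tens R H (yact R c n) d))))))))"
    using rh by (intro sweedler_cong sweedler_swap) (auto intro!: closed)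
  also have "\<dots> = cosum R r (\<lambda>r\<^sub>1 r\<^sub>2. coact_sum H R r\<^sub>2 (\<lambda>g n.
      cosum H h (\<lambda>h\<^sub>1 h\<^sub>2. cosum H h\<^sub>2 (\<lambda>c d. cosum H h\<^sub>1 (\<lambda>p p'.
      ?E p p' c d r\<^sub>1 g n)))))"
    using rh by (intro sweedler_cong inner) (auto intro!: closed)
  also have "\<dots> = cosum R r (\<lambda>r\<^sub>1 r\<^sub>2. coact_sum H R r\<^sub>2 (\<lambda>g n.
      cosum H h (\<lambda>h\<^sub>1 h\<^sub>2. cosum H h\<^sub>1 (\<lambda>p p'. cosum H h\<^sub>2 (\<lambda>c d.
      ?E p p' c d r\<^sub>1 g n)))))"
    using rh by (intro sweedler_cong sweedler_swap) (auto intro!: closed)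
  finally show ?thesis using L by simp
qed

end

section \<open>The form \<open>\<beta> # \<tau>\<close>\<close>

locale yd_pairing =
  fixes K :: "('k::field, 'a::ab_group_add) hopf"
    and H :: "('k, 'b::ab_group_add) hopf"
    and T :: "('k, 'c::ab_group_add, 'a) ydbialg"
    and R :: "('k, 'd::ab_group_add, 'b) ydbialg"
    and \<tau> :: "('a, 'b, 'k) tensor \<Rightarrow> 'k"
    and \<beta> :: "('c, 'd, 'k) tensor \<Rightarrow> 'k"
  assumes K: "hopf_algebra K" "bijective_antipode K"
    and H: "hopf_algebra H" "bijective_antipode H"
    and T: "yd_bialgebra K T" and R: "yd_bialgebra H R"
    and \<tau>: "linear_form (tensor K H) \<tau>" and \<beta>: "linear_form (tensor T R) \<beta>"
    and conditions_A: "conditions_A K H \<tau>"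
    and conditions_B: "conditions_B H T R \<beta>"
    and conditions_C: "conditions_C K H T R \<tau> \<beta>"
begin

sublocale KT: yd_hopf K T by unfold_locales (fact K T)+
sublocale HR: yd_hopf H R by unfold_locales (fact H R)+

abbreviation b where "b t r \<equiv> \<beta> (tens T R t r)"
abbreviation c where "c k h \<equiv> \<tau> (tens K H k h)"

lemmas linear_\<beta> [linear] = linear_map_compose[OF \<beta>[unfolded linear_form_def]]
lemmas linear_\<tau> [linear] = linear_map_compose[OF \<tau>[unfolded linear_form_def]]

lemma c_mult_right: "k \<in> carrier K \<Longrightarrow> h \<in> carrier H \<Longrightarrow> h' \<in> carrier H
    \<Longrightarrow> c k (mult H h h') = cosum K k (\<lambda>k\<^sub>1 k\<^sub>2. c k\<^sub>2 h * c k\<^sub>1 h')"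
  and c_unit_left: "h \<in> carrier H \<Longrightarrow> c (unit K) h = counit H h"
  and c_mult_left: "k \<in> carrier K \<Longrightarrow> k' \<in> carrier K \<Longrightarrow> h \<in> carrier H
    \<Longrightarrow> c (mult K k k') h = cosum H h (\<lambda>h\<^sub>1 h\<^sub>2. c k h\<^sub>1 * c k' h\<^sub>2)"
  and c_unit_right: "k \<in> carrier K \<Longrightarrow> c k (unit H) = counit K k"
  using conditions_A by (auto simp: conditions_A_def)

lemma b_mult_left: "t \<in> carrier T \<Longrightarrow> t' \<in> carrier T \<Longrightarrow> r \<in> carrier R
    \<Longrightarrow> b (mult T t t') r = cosum R r (\<lambda>r\<^sub>1 r\<^sub>2. coact_sum H R r\<^sub>2 (\<lambda>g n.
      b t (yact R (antipode_inv H g) r\<^sub>1) * b t' n))"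
  and b_unit_left: "r \<in> carrier R \<Longrightarrow> b (unit T) r = counit R r"
  and b_mult_right: "t \<in> carrier T \<Longrightarrow> r \<in> carrier R \<Longrightarrow> r' \<in> carrier R
    \<Longrightarrow> b t (mult R r r') = cosum T t (\<lambda>t\<^sub>1 t\<^sub>2. b t\<^sub>2 r * b t\<^sub>1 r')"
  and b_unit_right: "t \<in> carrier T \<Longrightarrow> b t (unit R) = counit T t"
  using conditions_B by (auto simp: conditions_B_def)

text \<open>(C.1) with the harpoon unfolded: an action of K on the left argument becomes a coaction
  on the right one. The companion for (C.2) goes in the opposite direction.\<close>

lemma b_act_left:
  assumes "k \<in> carrier K" "t \<in> carrier T" "r \<in> carrier R"
  shows "b (yact T k t) r = coact_sum H R r (\<lambda>g n. c k g * b t n)"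
proof -
  have L: "linear_map R field_space (b t)" using assms by (auto intro!: linear)
  have "b (yact T k t) r = b t (coact_sum H R r (\<lambda>g n. scal R (form_left K H \<tau> k g) n))"
    using conditions_C assms by (simp add: conditions_C_def harpoon_def)
  also have "\<dots> = coact_sum H R r (\<lambda>g n. c k g * b t n)"
    using assms by (simp add: linear_map_of_sweedler[OF L] closed linear_map_scaleD[OF L] form_left_def
        zero_outside_def cong: sweedler_cong')
  finally show ?thesis .
qed

lemma b_act_right:
  assumes "h \<in> carrier H" "t \<in> carrier T" "r \<in> carrier R"
  shows "b t (yact R (antipode_inv H h) r) = coact_sum K T t (\<lambda>g n. c g h * b n r)"
proof -
  have L: "linear_map T field_space (\<lambda>t. b t r)" using assms by (auto intro!: linear)
  have "b t (yact R (antipode_inv H h) r) = b (coact_sum K T t (\<lambda>g n. scal T (form_right K H \<tau> h g) n)) r"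
    using conditions_C assms by (simp add: conditions_C_def harpoon_def)
  also have "\<dots> = coact_sum K T t (\<lambda>g n. c g h * b n r)"
    using assms by (simp add: linear_map_of_sweedler[OF L] closed linear_map_scaleD[OF L] form_right_def
        zero_outside_def cong: sweedler_cong')
  finally show ?thesis .
qed

definition B where
  "B x y = sweedler T K x (\<lambda>t k. sweedler R H y (\<lambda>r h. b t r * c k h))"

lemma bilinear_B: "bilinear_map (tensor T K) (tensor R H) field_space B"
  unfolding B_def[abs_def] by (auto intro!: linear closed)

lemmas linear_B [linear] = bilinear_map_left[OF bilinear_B] bilinear_map_right[OF bilinear_B]

lemma B_tens_left: "t \<in> carrier T \<Longrightarrow> k \<in> carrier K \<Longrightarrow> y \<in> carrier (tensor R H)
   \<Longrightarrow> B (tens T K t k) y = sweedler R H y (\<lambda>r h. b t r * c k h)"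
  unfolding B_def by (intro sweedler_tens[of field_space]) (auto intro!: linear closed)

lemma B_tens_right: "r \<in> carrier R \<Longrightarrow> h \<in> carrier H \<Longrightarrow> x \<in> carrier (tensor T K)
   \<Longrightarrow> B x (tens R H r h) = sweedler T K x (\<lambda>t k. b t r * c k h)"
  unfolding B_def by (simp add: sweedler_tens[of field_space] linear closed cong: sweedler_cong')

lemma B_tens: "t \<in> carrier T \<Longrightarrow> k \<in> carrier K \<Longrightarrow> r \<in> carrier R \<Longrightarrow> h \<in> carrier H
   \<Longrightarrow> B (tens T K t k) (tens R H r h) = b t r * c k h"
  by (simp add: B_tens_left sweedler_tens[of field_space] linear closed)

abbreviation hash where "hash \<equiv> hash_form K H T R \<beta> \<tau>"

lemma hash_tens:
  assumes "x \<in> carrier (tensor T K)" "y \<in> carrier (tensor R H)"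
  shows "hash (tens (tensor T K) (tensor R H) x y) = B x (HR.\<psi> y)"
proof -
  have "hash (tens (tensor T K) (tensor R H) x y) =
      sweedler T K x (\<lambda>t k. sweedler R H y (\<lambda>r h. cosum H h (\<lambda>h\<^sub>1 h\<^sub>2.
         b t (yact R (antipode_inv H h\<^sub>1) r) * c k h\<^sub>2)))"
    using assms by (simp add: hash_form_def sweedler_tens[of field_space] linear closed)
  also have "\<dots> = B x (HR.\<psi> y)"
    using assms by (simp add: B_def HR.\<psi>_def sweedler_sweedler[of _ _ field_space]
        sweedler_tens[of field_space] linear closed cong: sweedler_cong')
  finally show ?thesis .
qed

lemma counit_biproduct:
  "counit (biproduct R H) x = sweedler R H x (\<lambda>r h. counit R r * counit H h)"
  "counit (biproduct T K) y = sweedler T K y (\<lambda>r h. counit T r * counit K h)"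
  by (simp_all add: biproduct_def)

text \<open>By (B.2) and (A.2) the left side is \<epsilon> \<otimes> \<epsilon>, and
  \<open>\<phi>\<close> preserves it because \<epsilon>(h_(1) \<cdot> r) \<epsilon>(h_(2)) =
  \<epsilon>(h) \<epsilon>(r).\<close>

lemma B_unit_left:
  assumes "x \<in> carrier (tensor R H)"
  shows "B (unit (biproduct T K)) x = counit (biproduct R H) (HR.\<phi> x)"
proof -
  have "B (tens T K (unit T) (unit K)) x = sweedler R H (HR.\<phi> x) (\<lambda>r h. counit R r * counit H h)"
  proof (rule linear_map_tensor_eqI[of R H field_space "B (tens T K (unit T) (unit K))"
        "\<lambda>x. sweedler R H (HR.\<phi> x) (\<lambda>r h. counit R r * counit H h)"])
    fix r h assume rh: "r \<in> carrier R" "h \<in> carrier H"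
    have "sweedler R H (HR.\<phi> (tens R H r h)) (\<lambda>r h. counit R r * counit H h)
      = cosum H h (\<lambda>a b. scal field_space (counit H a) (counit R r * counit H b))"
      using rh by (simp add: HR.phi_tens sweedler_sweedler[of _ _ field_space] HR.counit_act
          sweedler_tens[of field_space] linear closed mult.assoc cong: sweedler_cong')
    also have "\<dots> = counit R r * counit H h"
      using rh by (intro HR.H.counit_left) (auto intro!: linear closed)
    finally show "B (tens T K (unit T) (unit K)) (tens R H r h)
      = sweedler R H (HR.\<phi> (tens R H r h)) (\<lambda>r h. counit R r * counit H h)"
      using rh by (simp add: B_tens b_unit_left c_unit_left)
  qed (use assms in \<open>auto intro!: linear closed\<close>)
  thus ?thesis by (simp add: counit_biproduct)
qed

text \<open>After (B.3), (A.1) and (C.2), the factors c(g, h_(1)) and c(k_(1), h_(2)) remain, where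
  g comes from the coaction of t^(2). By (A.3) read backwards they combine to c(g k_(1), h'), and g
  k_(1) is the K-component of the first leg of the coproduct of t # k. Since \<open>\<psi>\<close>
  reverses products, this is (A.1) for the form.\<close>

lemma B_op_mult:
  assumes "x \<in> carrier (tensor T K)" "y \<in> carrier (tensor R H)" "z \<in> carrier (tensor R H)"
  shows "B x (HR.op.M y z) =
    sweedler (tensor T K) (tensor T K) (KT.\<Delta> x) (\<lambda>x\<^sub>1 x\<^sub>2. B x\<^sub>2 z * B x\<^sub>1 y)"
proof (rule trilinear_tensor_eqI[of T K R H R H field_space "\<lambda>x y z. B x (HR.op.M y z)"
      "\<lambda>x y z. sweedler (tensor T K) (tensor T K) (KT.\<Delta> x) (\<lambda>x\<^sub>1 x\<^sub>2. B x\<^sub>2 z * B x\<^sub>1 y)"])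
  fix t k r' h' r h
  assume *: "t \<in> carrier T" "k \<in> carrier K" "r \<in> carrier R" "h \<in> carrier H" "r' \<in> carrier R" "h' \<in> carrier H"
  have "B (tens T K t k) (HR.op.M (tens R H r' h') (tens R H r h))
      = cosum H h' (\<lambda>h\<^sub>1 h\<^sub>2. b t (mult R (yact R (antipode_inv H h\<^sub>1) r) r') * c k (mult H h h\<^sub>2))"
    using * HR.op.M_tens[of r' h' r h]
    by (simp add: B_tens_left sweedler_sweedler[of _ _ field_space] sweedler_tens[of field_space]
        linear closed cong: sweedler_cong')
  also have "\<dots> = cosum H h' (\<lambda>h\<^sub>1 h\<^sub>2. cosum K k (\<lambda>k\<^sub>1 k\<^sub>2. cosum T t (\<lambda>t\<^sub>1 t\<^sub>2. coact_sum K T t\<^sub>2 (\<lambda>g n.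
      c g h\<^sub>1 * b n r * b t\<^sub>1 r' * (c k\<^sub>2 h * c k\<^sub>1 h\<^sub>2)))))"
    using * by (simp add: b_mult_right b_act_right c_mult_right closed
        sweedler_mult_left[symmetric] sweedler_mult_right[symmetric] cong: sweedler_cong')
  also have "\<dots> = cosum T t (\<lambda>t\<^sub>1 t\<^sub>2. coact_sum K T t\<^sub>2 (\<lambda>g n. cosum K k (\<lambda>k\<^sub>1 k\<^sub>2.
      cosum H h' (\<lambda>h\<^sub>1 h\<^sub>2. c g h\<^sub>1 * b n r * b t\<^sub>1 r' * (c k\<^sub>2 h * c k\<^sub>1 h\<^sub>2)))))"
    by (simp only: sweedler_swap[of H H _ K K] sweedler_swap[of H H _ K T] sweedler_swap[of H H _ T T]
        sweedler_swap[of K K _ K T] sweedler_swap[of K K _ T T])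
  also have "\<dots> = cosum T t (\<lambda>t\<^sub>1 t\<^sub>2. coact_sum K T t\<^sub>2 (\<lambda>g n. cosum K k (\<lambda>k\<^sub>1 k\<^sub>2.
      b n r * c k\<^sub>2 h * (b t\<^sub>1 r' * c (mult K g k\<^sub>1) h'))))"
    using * by (simp add: closed c_mult_left sweedler_mult_left[symmetric] mult_ac cong: sweedler_cong')
  also have "\<dots> = sweedler (tensor T K) (tensor T K) (KT.\<Delta> (tens T K t k))
      (\<lambda>x\<^sub>1 x\<^sub>2. B x\<^sub>2 (tens R H r h) * B x\<^sub>1 (tens R H r' h'))"
    using * by (subst KT.\<Delta>_tens_sum[of field_space])
      (simp_all add: linear closed B_tens cong: sweedler_cong')
  finally show "B (tens T K t k) (HR.op.M (tens R H r' h') (tens R H r h)) = \<dots>" .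
qed (use assms in \<open>auto intro!: linear closed\<close>)

text \<open>(B.1) yields one coaction of R and (C.1) a second. After (A.3), (A.1) read backwards
  joins the second with h_(1) to c(k, h_(1) g'); coassociativity of the coaction replaces the two
  coactions by the coproduct of a single g, which is the shape of \<open>phi_comult\<close>.\<close>

lemma B_mult:
  assumes "x \<in> carrier (tensor T K)" "y \<in> carrier (tensor T K)" "z \<in> carrier (tensor R H)"
  shows "B (KT.M x y) z =
    sweedler (tensor R H) (tensor R H) (HR.\<Delta> (HR.\<phi> z)) (\<lambda>z\<^sub>1 z\<^sub>2. B x (HR.\<psi> z\<^sub>1) * B y (HR.\<psi> z\<^sub>2))"
proof (rule trilinear_tensor_eqI[of T K T K R H field_space "\<lambda>x y z. B (KT.M x y) z"
      "\<lambda>x y z. sweedler (tensor R H) (tensor R H) (HR.\<Delta> (HR.\<phi> z)) (\<lambda>z\<^sub>1 z\<^sub>2. B x (HR.\<psi> z\<^sub>1) * B y (HR.\<psi> z\<^sub>2))"])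
  fix t k t' k' r h
  assume *: "t \<in> carrier T" "k \<in> carrier K" "t' \<in> carrier T" "k' \<in> carrier K" "r \<in> carrier R" "h \<in> carrier H"
  have "B (KT.M (tens T K t k) (tens T K t' k')) (tens R H r h)
      = cosum K k (\<lambda>k\<^sub>1 k\<^sub>2. b (mult T t (yact T k\<^sub>1 t')) r * c (mult K k\<^sub>2 k') h)"
    using * by (simp add: KT.M_tens B_tens_right sweedler_sweedler[of _ _ field_space] sweedler_tens[of field_space]
        linear closed cong: sweedler_cong')
  also have "\<dots> = cosum K k (\<lambda>k\<^sub>1 k\<^sub>2. cosum H h (\<lambda>h\<^sub>1 h\<^sub>2. cosum R r (\<lambda>r\<^sub>1 r\<^sub>2. coact_sum H R r\<^sub>2 (\<lambda>g n. coact_sum H R n (\<lambda>g' n'.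
      b t (yact R (antipode_inv H g) r\<^sub>1) * (c k\<^sub>1 g' * b t' n') * (c k\<^sub>2 h\<^sub>1 * c k' h\<^sub>2))))))"
    using * by (simp add: b_mult_left b_act_left c_mult_left closed
        sweedler_mult_left[symmetric] sweedler_mult_right[symmetric] cong: sweedler_cong')
  also have "\<dots> = cosum R r (\<lambda>r\<^sub>1 r\<^sub>2. coact_sum H R r\<^sub>2 (\<lambda>g n. coact_sum H R n (\<lambda>g' n'.
      cosum H h (\<lambda>h\<^sub>1 h\<^sub>2. cosum K k (\<lambda>k\<^sub>1 k\<^sub>2. b t (yact R (antipode_inv H g) r\<^sub>1) * (c k\<^sub>1 g' * b t' n') * (c k\<^sub>2 h\<^sub>1 * c k' h\<^sub>2))))))"
    by (simp only: sweedler_swap[of K K _ H H] sweedler_swap[of K K _ H R] sweedler_swap[of K K _ R R]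
        sweedler_swap[of H H _ H R] sweedler_swap[of H H _ R R])
  also have "\<dots> = cosum R r (\<lambda>r\<^sub>1 r\<^sub>2. coact_sum H R r\<^sub>2 (\<lambda>g n. coact_sum H R n (\<lambda>g' n'.
      cosum H h (\<lambda>h\<^sub>1 h\<^sub>2. b t (yact R (antipode_inv H g) r\<^sub>1) * c k (mult H h\<^sub>1 g') * (b t' n' * c k' h\<^sub>2)))))"
    using * by (simp add: closed c_mult_right sweedler_mult_left[symmetric] sweedler_mult_right[symmetric] mult_ac
        cong: sweedler_cong')
  also have "\<dots> = cosum R r (\<lambda>r\<^sub>1 r\<^sub>2. coact_sum H R r\<^sub>2 (\<lambda>g n. cosum H g (\<lambda>g\<^sub>1 g\<^sub>2.
      cosum H h (\<lambda>h\<^sub>1 h\<^sub>2. b t (yact R (antipode_inv H g\<^sub>1) r\<^sub>1) * c k (mult H h\<^sub>1 g\<^sub>2) * (b t' n * c k' h\<^sub>2)))))"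
    using * by (intro sweedler_cong HR.coact_coassoc[symmetric]) (auto intro!: linear closed)
  also have "\<dots> = sweedler (tensor R H) (tensor R H) (HR.\<Delta> (HR.\<phi> (tens R H r h)))
      (\<lambda>z\<^sub>1 z\<^sub>2. B (tens T K t k) (HR.\<psi> z\<^sub>1) * B (tens T K t' k') (HR.\<psi> z\<^sub>2))"
    using * by (subst HR.phi_comult[of field_space])
      (simp_all add: linear closed B_tens HR.\<psi>_phi cong: sweedler_cong')
  finally show "B (KT.M (tens T K t k) (tens T K t' k')) (tens R H r h) = \<dots>" .
qed (use assms in \<open>auto intro!: linear closed\<close>)

lemma conditions_A_hash: "conditions_A (biproduct T K) (biproduct R H) hash"
proof -
  have 1: "hash (tens (tensor T K) (tensor R H) u (HR.M a a')) =
    sweedler (tensor T K) (tensor T K) (KT.\<Delta> u)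
     (\<lambda>u\<^sub>1 u\<^sub>2. hash (tens (tensor T K) (tensor R H) u\<^sub>2 a) * hash (tens (tensor T K) (tensor R H) u\<^sub>1 a'))"
    if "u \<in> carrier (tensor T K)" "a \<in> carrier (tensor R H)" "a' \<in> carrier (tensor R H)" for u a a'
    using that by (simp add: hash_tens HR.\<psi>_M B_op_mult closed cong: sweedler_cong')
  have 2: "hash (tens (tensor T K) (tensor R H) (unit (biproduct T K)) a) = counit (biproduct R H) a"
    if "a \<in> carrier (tensor R H)" for a
    using that B_unit_left[of "HR.\<psi> a"] by (simp add: hash_tens HR.phi_\<psi> closed)
  have 3: "hash (tens (tensor T K) (tensor R H) (KT.M u u') a) =
    sweedler (tensor R H) (tensor R H) (HR.\<Delta> a)
     (\<lambda>a\<^sub>1 a\<^sub>2. hash (tens (tensor T K) (tensor R H) u a\<^sub>1) * hash (tens (tensor T K) (tensor R H) u' a\<^sub>2))"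
    if "u \<in> carrier (tensor T K)" "u' \<in> carrier (tensor T K)" "a \<in> carrier (tensor R H)" for u u' a
    using that B_mult[of u u' "HR.\<psi> a"] by (simp add: hash_tens HR.phi_\<psi> closed cong: sweedler_cong')
  have 4: "hash (tens (tensor T K) (tensor R H) u (unit (biproduct R H))) = counit (biproduct T K) u"
    if "u \<in> carrier (tensor T K)" for u
    using that by (simp add: hash_tens HR.\<psi>_unit counit_biproduct B_tens_right b_unit_right c_unit_right closed
       cong: sweedler_cong')
  show ?thesis using 1 2 3 4 by (simp add: conditions_A_def)
qed

end

section \<open>Cofinite subspaces and finite duals\<close>

text \<open>Coordinates \<open>(f, e)\<close> modulo a subspace: each \<open>x\<close> is congruent to the sum of all \<open>f(x) e\<close>.\<close>

definition coordinates ::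
  "('k::field, 'a::ab_group_add, 'm) vspace_scheme \<Rightarrow> (('a \<Rightarrow> 'k) \<times> 'a) list \<Rightarrow> bool" where
  "coordinates V cs \<longleftrightarrow> (\<forall>(f, e)\<in>set cs. linear_map V field_space f \<and> e \<in> carrier V)"

lemma linear_map_coordinate_sum:
  assumes V: "is_vspace V" and cs: "coordinates V cs" and L: "linear_map V W L"
  shows "L (\<Sum>(f, e)\<leftarrow>cs. scal V (f x) e) = (\<Sum>(f, e)\<leftarrow>cs. scal W (f x) (L e))"
proof -
  have "L (\<Sum>(f, e)\<leftarrow>cs. scal V (f x) e) = (\<Sum>p\<leftarrow>cs. L (case p of (f, e) \<Rightarrow> scal V (f x) e))"
    using V cs by (intro linear_map_sum_list[OF L]) (auto simp: coordinates_def vspace_scal)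
  also have "\<dots> = (\<Sum>(f, e)\<leftarrow>cs. scal W (f x) (L e))"
    using cs by (intro arg_cong[of _ _ sum_list] map_cong)
      (auto simp: coordinates_def linear_map_scaleD[OF L])
  finally show ?thesis .
qed

lemma coordinate_sum_mem:
  "is_vspace V \<Longrightarrow> coordinates V cs \<Longrightarrow> (\<Sum>(f, e)\<leftarrow>cs. scal V (f x) e) \<in> carrier V"
  by (intro vspace_sum_list) (auto simp: coordinates_def vspace_scal)

text \<open>The coefficient functionals must be linear on all of \<open>V\<close> and not just on
  the span of \<open>S\<close>. Hence a basis chosen inside \<open>S\<close> is extended to a basis
  of the ambient space, whose coefficient functions are total.\<close>

lemma coordinates_finite:
  assumes V: "is_vspace V" and S: "finite S" "S \<subseteq> carrier V"
  shows "\<exists>cs. coordinates V cs \<and> (\<forall>x\<in>S. x = (\<Sum>(f, e)\<leftarrow>cs. scal V (f x) e))"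
proof -
  interpret vector_space "scal V" using V by (simp add: is_vspace_def)
  obtain B where B: "B \<subseteq> S" "independent B" "S \<subseteq> span B"
    using maximal_independent_subset[of S] by metis
  define E where "E = extend_basis B"
  have E: "B \<subseteq> E" "independent E" "span E = UNIV"
    using B(2) extend_basis_superset independent_extend_basis span_extend_basis by (auto simp: E_def)
  have fin: "finite B" using B(1) S(1) finite_subset by blast
  obtain bs where bs: "set bs = B" "distinct bs" using finite_distinct_list[OF fin] by blast
  define cs where "cs = map (\<lambda>b. (\<lambda>x. representation E x b, b)) bs"
  have "coordinates V cs"
    using E B S by (auto simp: coordinates_def cs_def bs linear_map_def representation_add representation_scale)
  moreover have "x = (\<Sum>(f, e)\<leftarrow>cs. scal V (f x) e)" if "x \<in> S" for x
  proof -
    have x: "x \<in> span B" using B(3) that by blast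
    have "(\<Sum>(f, e)\<leftarrow>cs. scal V (f x) e) = (\<Sum>b\<in>B. scal V (representation E x b) b)"
      using bs by (simp add: cs_def o_def case_prod_unfold sum_list_distinct_conv_sum_set)
    also have "\<dots> = (\<Sum>b\<in>B. scal V (representation B x b) b)"
      using representation_extend[OF E(2) x E(1)] by simp
    also have "\<dots> = x" by (rule sum_representation_eq[OF B(2) x fin]) simp
    finally show ?thesis by simp
  qed
  ultimately show ?thesis by blast
qed

text \<open>A basis \<open>A\<close> of \<open>I\<close> is extended by vectors of \<open>F\<close>
  to a set \<open>B\<close> spanning \<open>V\<close>, so \<open>B - A\<close> is finite.
  Subtracting the components along \<open>B - A\<close> leaves a combination of vectors of
  \<open>A\<close>, which lies in \<open>I\<close>.\<close>

lemma coordinates_cofinite: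
  assumes V: "is_vspace V" and I: "cofinite V I"
  shows "\<exists>cs. coordinates V cs \<and> (\<forall>x\<in>carrier V. x - (\<Sum>(f, e)\<leftarrow>cs. scal V (f x) e) \<in> I)"
proof -
  interpret vector_space "scal V" using V by (simp add: is_vspace_def)
  obtain F where F: "finite F" "F \<subseteq> carrier V" "span (F \<union> I) = carrier V"
    and sub: "subspace I" "I \<subseteq> carrier V" using I by (auto simp: cofinite_def)
  obtain A where A: "A \<subseteq> I" "independent A" "I \<subseteq> span A"
    using maximal_independent_subset[of I] by metis
  obtain B where B: "A \<subseteq> B" "B \<subseteq> A \<union> F" "independent B" "A \<union> F \<subseteq> span B"
    using maximal_independent_subset_extend[of A "A \<union> F"] A(2) by (metis Un_upper1)
  have "I \<subseteq> span B" using A(3) span_mono[OF B(1)] by blast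
  hence "span (F \<union> I) \<subseteq> span B" using B(4) by (intro span_minimal) auto
  hence spanB: "carrier V \<subseteq> span B" using F(3) by simp
  have BV: "B \<subseteq> carrier V" using B(2) A(1) sub(2) F(2) by blast
  have fin: "finite (B - A)" using B(2) F(1) by (metis Diff_subset_conv finite_subset)
  obtain bs where bs: "set bs = B - A" "distinct bs" using finite_distinct_list[OF fin] by blast
  define cs where "cs = map (\<lambda>b. (\<lambda>x. representation B x b, b)) bs"
  have "coordinates V cs"
    using BV spanB B(3) by (auto simp: coordinates_def cs_def bs linear_map_def representation_add
        representation_scale subset_iff)
  moreover have "x - (\<Sum>(f, e)\<leftarrow>cs. scal V (f x) e) \<in> I" if "x \<in> carrier V" for x
  proof -
    let ?r = "\<lambda>b. scal V (representation B x b) b"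
    let ?N = "{b. representation B x b \<noteq> 0}"
    have N: "finite ?N" "?N \<subseteq> B" by (auto simp: finite_representation representation_ne_zero)
    have x: "x \<in> span B" using spanB that by blast
    have "(\<Sum>(f, e)\<leftarrow>cs. scal V (f x) e) = sum ?r (B - A)"
      using bs by (simp add: cs_def o_def case_prod_unfold sum_list_distinct_conv_sum_set)
    also have "\<dots> = sum ?r (?N - A)" using fin N by (intro sum.mono_neutral_right) auto
    finally have "x - (\<Sum>(f, e)\<leftarrow>cs. scal V (f x) e) = sum ?r ?N - sum ?r (?N - A)"
      using sum_nonzero_representation_eq[OF B(3) x] by simp
    also have "\<dots> = sum ?r (?N \<inter> A)"
      using N by (metis (no_types, lifting) add_diff_cancel_right' sum.Int_Diff)
    also have "\<dots> \<in> I" using A(1) sub(1) by (intro subspace_sum) (auto intro: subspace_scale)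
    finally show ?thesis .
  qed
  ultimately show ?thesis by blast
qed

text \<open>Separates variables: for a form killing \<open>I\<close>, the dependence on
  \<open>x\<close> passes into finitely many coefficients, which are independent of the
  form.\<close>

lemma coordinate_expansion:
  assumes V: "is_vspace V" and cs: "coordinates V cs"
    and I: "\<forall>x\<in>carrier V. x - (\<Sum>(f, e)\<leftarrow>cs. scal V (f x) e) \<in> I"
    and L: "linear_map V field_space L" and 0: "\<forall>x\<in>I. L x = 0" and x: "x \<in> carrier V"
  shows "L x = (\<Sum>(f, e)\<leftarrow>cs. f x * L e)"
proof -
  have "0 = L (x - (\<Sum>(f, e)\<leftarrow>cs. scal V (f x) e))" using I 0 x by simp
  also have "\<dots> = L x - (\<Sum>(f, e)\<leftarrow>cs. f x * L e)"
    using linear_map_diff[OF L V x coordinate_sum_mem[OF V cs]]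
      linear_map_coordinate_sum[OF V cs L] by simp
  finally show ?thesis by simp
qed

text \<open>The forms are the coordinates modulo \<open>I\<close>. With the converse below, cofinite
  means containing the common kernel of finitely many forms, a description that is easy to intersect
  and to pull back.\<close>

lemma cofinite_forms:
  assumes V: "is_vspace V" and I: "cofinite V I"
  shows "\<exists>fs. (\<forall>f\<in>set fs. linear_map V field_space f) \<and>
    (\<forall>x\<in>carrier V. (\<forall>f\<in>set fs. f x = 0) \<longrightarrow> x \<in> I)"
proof -
  interpret module "scal V" using V by (rule module_of_vspace)
  obtain cs where cs: "coordinates V cs" "\<forall>x\<in>carrier V. x - (\<Sum>(f, e)\<leftarrow>cs. scal V (f x) e) \<in> I"
    using coordinates_cofinite[OF assms] by blast
  have "x \<in> I" if "x \<in> carrier V" "\<forall>f\<in>set (map fst cs). f x = 0" for x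
  proof -
    have "(\<Sum>(f, e)\<leftarrow>cs. scal V (f x) e) = (\<Sum>p\<leftarrow>cs. 0)"
      using that(2) by (intro arg_cong[of _ _ sum_list] map_cong) auto
    thus ?thesis using cs(2) that(1) by force
  qed
  thus ?thesis using cs(1) by (intro exI[of _ "map fst cs"]) (auto simp: coordinates_def)
qed

lemma cofiniteI_forms:
  assumes V: "is_vspace V" and I: "module.subspace (scal V) I" "I \<subseteq> carrier V"
    and fs: "\<forall>f\<in>set fs. linear_map V field_space f"
    and fsI: "\<And>x. x \<in> carrier V \<Longrightarrow> (\<forall>f\<in>set fs. f x = 0) \<Longrightarrow> x \<in> I"
  shows "cofinite V I"
proof -
  interpret module "scal V" using V by (rule module_of_vspace)
  have sub: "subspace (carrier V)" using V by (simp add: is_vspace_def)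
  \<comment> \<open>By induction on the list, \<open>F\<close> is chosen so that no value vector of
    the forms is lost on its span; a difference with equal values then lies in
    \<open>I\<close>.\<close>
  have "\<exists>F. finite F \<and> F \<subseteq> carrier V \<and> (\<forall>x\<in>carrier V. \<exists>y\<in>span F. \<forall>f\<in>set fs. f x = f y)"
    using fs
  proof (induction fs)
    case Nil
    show ?case by (intro exI[of _ "{}"]) auto
  next
    case (Cons f fs)
    then obtain F where F: "finite F" "F \<subseteq> carrier V" "\<forall>x\<in>carrier V. \<exists>y\<in>span F. \<forall>f\<in>set fs. f x = f y"
      by auto
    have FV: "span F \<subseteq> carrier V" using F(2) sub by (rule span_minimal)
    have lin: "linear_map V field_space g" if "g \<in> set (f # fs)" for g using Cons.prems that by auto
    show ?case
    \<comment> \<open>A vector \<open>e\<close> on which only the new form is non-zero corrects the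
      value of \<open>f\<close> without disturbing the others. If there is none, \<open>f\<close>
      vanishes on the common kernel of the others and \<open>F\<close> is already large
      enough.\<close>
    proof (cases "\<exists>e\<in>carrier V. (\<forall>g\<in>set fs. g e = 0) \<and> f e \<noteq> 0")
      case True
      then obtain e where e: "e \<in> carrier V" "\<forall>g\<in>set fs. g e = 0" "f e \<noteq> 0" by blast
      have "\<exists>y\<in>span (insert e F). \<forall>g\<in>set (f # fs). g x = g y" if x: "x \<in> carrier V" for x
      proof -
        obtain y where y: "y \<in> span F" "\<forall>g\<in>set fs. g x = g y" using F(3) x by blast
        let ?y = "y + scal V ((f x - f y) / f e) e"
        have "?y \<in> span (insert e F)"
        proof (intro span_add span_scale)
          show "y \<in> span (insert e F)" using y(1) span_mono[of F "insert e F"] by blast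
        qed (simp add: span_base)
        moreover have *: "g ?y = g y + (f x - f y) / f e * g e" if "g \<in> set (f # fs)" for g
          using linear_map_add[OF lin[OF that], of y "scal V ((f x - f y) / f e) e"]
            linear_map_scaleD[OF lin[OF that] e(1)] y(1) FV e(1) V by (simp add: vspace_scal subset_iff)
        hence "g x = g ?y" if "g \<in> set (f # fs)" for g
        proof (cases "g = f")
          case False
          hence "g \<in> set fs" using that by simp
          hence "g x = g y" "g e = 0" using y(2) e(2) by blast+
          thus ?thesis using *[OF that] by simp
        qed (use *[of f] e(3) in simp)
        ultimately show ?thesis by blast
      qed
      thus ?thesis using F(1,2) e(1) by (intro exI[of _ "insert e F"]) auto
    next
      case False
      have "\<exists>y\<in>span F. \<forall>g\<in>set (f # fs). g x = g y" if x: "x \<in> carrier V" for x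
      proof -
        obtain y where y: "y \<in> span F" "\<forall>g\<in>set fs. g x = g y" using F(3) x by blast
        have *: "g (x - y) = g x - g y" if "g \<in> set (f # fs)" for g
          using linear_map_diff[OF lin[OF that] V x] y(1) FV by auto
        have "g (x - y) = 0" if "g \<in> set fs" for g
        proof -
          have "g x = g y" using y(2) that by blast
          thus ?thesis using *[of g] that by simp
        qed
        moreover have "x - y \<in> carrier V" using x y(1) FV V by (auto intro: vspace_diff)
        ultimately have "f (x - y) = 0" using False by blast
        hence "f x = f y" using *[of f] by simp
        thus ?thesis using y by auto
      qed
      thus ?thesis using F(1,2) by blast
    qed
  qed
  then obtain F where F: "finite F" "F \<subseteq> carrier V" "\<forall>x\<in>carrier V. \<exists>y\<in>span F. \<forall>f\<in>set fs. f x = f y"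
    by blast
  have "x \<in> span (F \<union> I)" if x: "x \<in> carrier V" for x
  proof -
    obtain y where y: "y \<in> span F" "\<forall>f\<in>set fs. f x = f y" using F(3) x by blast
    have yV: "y \<in> carrier V" using y(1) span_minimal[OF F(2) sub] by blast
    have "f (x - y) = 0" if "f \<in> set fs" for f
      using linear_map_diff[of V field_space f x y] fs that x yV V y(2) by simp
    hence "x - y \<in> I" using fsI x yV V by (simp add: vspace_diff)
    hence "y + (x - y) \<in> span (F \<union> I)"
      using y(1) span_mono[of F "F \<union> I"] span_base[of "x - y" "F \<union> I"] by (intro span_add) auto
    thus ?thesis by simp
  qed
  moreover have "span (F \<union> I) \<subseteq> carrier V" using F(2) I(2) sub by (intro span_minimal) auto
  ultimately show ?thesis using I F(1,2) unfolding cofinite_def by blast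
qed

lemma cofinite_Int:
  assumes V: "is_vspace V" and "cofinite V I" "cofinite V J"
  shows "cofinite V (I \<inter> J)"
proof -
  obtain fs where fs: "\<forall>f\<in>set fs. linear_map V field_space f"
    "\<forall>x\<in>carrier V. (\<forall>f\<in>set fs. f x = 0) \<longrightarrow> x \<in> I"
    using cofinite_forms[OF V assms(2)] by blast
  obtain gs where gs: "\<forall>f\<in>set gs. linear_map V field_space f"
    "\<forall>x\<in>carrier V. (\<forall>f\<in>set gs. f x = 0) \<longrightarrow> x \<in> J"
    using cofinite_forms[OF V assms(3)] by blast
  show ?thesis
  proof (rule cofiniteI_forms[of V _ "fs @ gs"])
    show "module.subspace (scal V) (I \<inter> J)"
      using assms module_of_vspace[OF V] by (auto simp: cofinite_def module.subspace_inter)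
    show "I \<inter> J \<subseteq> carrier V" using assms by (auto simp: cofinite_def)
    show "\<forall>f\<in>set (fs @ gs). linear_map V field_space f" using fs(1) gs(1) by auto
    show "x \<in> I \<inter> J" if "x \<in> carrier V" "\<forall>f\<in>set (fs @ gs). f x = 0" for x
      using fs(2) gs(2) that by auto
  qed (rule V)
qed

lemma cofinite_carrier: "is_vspace V \<Longrightarrow> cofinite V (carrier V)"
  by (intro cofiniteI_forms[of V _ "[]"]) (auto simp: is_vspace_def)

section \<open>Duals and finite duals as vector spaces, and a membership criterion\<close>

lemma is_vspace_funI:
  fixes X :: "('x \<Rightarrow> 'k::field) set"
  assumes "0 \<in> X" "\<And>f g. f \<in> X \<Longrightarrow> g \<in> X \<Longrightarrow> f + g \<in> X" "\<And>c f. f \<in> X \<Longrightarrow> (\<lambda>x. c * f x) \<in> X"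
  shows "is_vspace \<lparr>carrier = X, scal = fun_scal\<rparr>"
  using assms by (simp add: is_vspace_def vector_space_fun module.subspace_def[OF module_fun])

lemma mem_dual_space: "f \<in> carrier (dual_space V) \<longleftrightarrow>
    linear_map V field_space f \<and> (\<forall>x. x \<notin> carrier V \<longrightarrow> f x = 0)"
  by (simp add: dual_space_def linear_form_def)

lemma dual_space_simps [simp]: "scal (dual_space V) = fun_scal"
  by (simp add: dual_space_def)

lemma linear_map_cong:
  assumes "\<And>x. x \<in> carrier V \<Longrightarrow> f x = g x" "is_vspace V"
  shows "linear_map V W f = linear_map V W g"
  using assms by (auto simp: linear_map_def vspace_add vspace_scal Pi_iff)

lemma zero_outside_mem_dual:
  "is_vspace V \<Longrightarrow> linear_map V field_space f \<Longrightarrow> zero_outside V f \<in> carrier (dual_space V)"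
  unfolding mem_dual_space
  by (subst linear_map_cong[of V _ f]) (auto simp: zero_outside_def)

lemma is_vspace_dual_space [simp]: "is_vspace (dual_space V)"
  unfolding dual_space_def
  by (intro is_vspace_funI) (auto simp: linear_form_def linear_map_def algebra_simps)

lemma mem_finite_dual_space: "f \<in> carrier (finite_dual_space A) \<longleftrightarrow> f \<in> carrier (dual_space A) \<and>
    (\<exists>I. ideal A I \<and> cofinite A I \<and> (\<forall>x\<in>I. f x = 0))"
  by (simp add: finite_dual_space_def)

lemma mem_yd_dual_space: "f \<in> carrier (yd_dual_space H R) \<longleftrightarrow> f \<in> carrier (dual_space R) \<and>
    (\<exists>I. ideal R I \<and> (\<forall>h\<in>carrier H. \<forall>x\<in>I. yact R h x \<in> I) \<and> cofinite R I \<and> (\<forall>x\<in>I. f x = 0))"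
  by (simp add: yd_dual_space_def)

lemma dual_simps [simp]:
  "scal (finite_dual_space A) = fun_scal" "scal (yd_dual_space H R) = fun_scal"
  "carrier (finite_dual A) = carrier (finite_dual_space A)" "scal (finite_dual A) = fun_scal"
  "carrier (yd_dual H R) = carrier (yd_dual_space H R)" "scal (yd_dual H R) = fun_scal"
  by (simp_all add: finite_dual_space_def yd_dual_space_def finite_dual_def yd_dual_def Let_def)

lemma dual_scal_eq:
  "scal (finite_dual A) = scal (finite_dual_space A)" "scal (yd_dual H R) = scal (yd_dual_space H R)"
  by simp_all

lemmas finite_dual_space_eq [simp] = same_space[OF dual_simps(3) dual_scal_eq(1)]
lemmas yd_dual_space_eq [simp] = same_space[OF dual_simps(5) dual_scal_eq(2)]

lemma ideal_Int:
  "is_vspace A \<Longrightarrow> ideal A I \<Longrightarrow> ideal A J \<Longrightarrow> ideal A (I \<inter> J)"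
  unfolding ideal_def using module.subspace_inter[OF module_of_vspace] by blast

context alg
begin

lemma ideal_carrier: "ideal A (carrier A)"
  using vspace_alg unfolding ideal_def is_vspace_def by (auto intro: closed)

lemma is_vspace_finite_dual_space [simp]: "is_vspace (finite_dual_space A)"
proof -
  let ?X = "{f \<in> carrier (dual_space A). \<exists>I. ideal A I \<and> cofinite A I \<and> (\<forall>x\<in>I. f x = 0)}"
  have D: "is_vspace (dual_space A)" by simp
  have "0 \<in> ?X" using vspace_0[OF D] ideal_carrier cofinite_carrier[of A] by auto
  moreover have "f + g \<in> ?X" if fg: "f \<in> ?X" "g \<in> ?X" for f g
  proof -
    obtain I J where "ideal A I" "cofinite A I" "\<forall>x\<in>I. f x = 0" "ideal A J" "cofinite A J" "\<forall>x\<in>J. g x = 0"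
      using fg by blast
    thus ?thesis using fg vspace_add[OF D]
      by (auto intro!: exI[of _ "I \<inter> J"] ideal_Int cofinite_Int)
  qed
  moreover have "(\<lambda>x. c * f x) \<in> ?X" if "f \<in> ?X" for c f
    using that vspace_scal[OF D, of f c] by auto
  ultimately show ?thesis unfolding finite_dual_space_def by (rule is_vspace_funI)
qed

text \<open>The largest ideal inside the kernel of \<open>f\<close> consists of the \<open>x\<close> with \<open>f(a x b) = 0\<close> for all \<open>a\<close> and \<open>b\<close>.\<close>

lemma finite_dual_spaceI:
  assumes f: "f \<in> carrier (dual_space A)" and fs: "\<forall>g\<in>set fs. linear_map A field_space g"
    and 0: "\<And>x a b. x \<in> carrier A \<Longrightarrow> (\<forall>g\<in>set fs. g x = 0) \<Longrightarrow> a \<in> carrier A \<Longrightarrow> b \<in> carrier A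
      \<Longrightarrow> f (mult A (mult A a x) b) = 0"
  shows "f \<in> carrier (finite_dual_space A)"
proof -
  interpret module "scal A" by (rule module_of_vspace) simp
  have lin: "linear_map A field_space f" using f by (simp add: mem_dual_space)
  define I where "I = {x \<in> carrier A. \<forall>a\<in>carrier A. \<forall>b\<in>carrier A. f (mult A (mult A a x) b) = 0}"
  have L: "linear_map A field_space (\<lambda>x. f (mult A (mult A a x) b))"
    if "a \<in> carrier A" "b \<in> carrier A" for a b
    using that by (auto intro!: linear linear_map_compose[OF lin])
  have sub: "subspace I" unfolding subspace_def I_def
    using linear_map_0[OF L] linear_map_add[OF L] linear_map_scaleD[OF L]
    by (auto simp: vspace_add vspace_scal)
  have "mult A c x \<in> I \<and> mult A x c \<in> I" if "c \<in> carrier A" "x \<in> I" for c x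
  proof -
    have "mult A (mult A a (mult A c x)) b = mult A (mult A (mult A a c) x) b"
      "mult A (mult A a (mult A x c)) b = mult A (mult A a x) (mult A c b)"
      if "a \<in> carrier A" "b \<in> carrier A" for a b
      using that \<open>c \<in> _\<close> \<open>x \<in> I\<close> by (auto simp: I_def mult_assoc closed)
    thus ?thesis using that by (auto simp: I_def closed)
  qed
  hence "ideal A I" using sub by (auto simp: ideal_def I_def)
  moreover have "cofinite A I"
    using sub fs 0 by (intro cofiniteI_forms[of A I fs]) (auto simp: I_def)
  moreover have "f x = 0" if "x \<in> I" for x
  proof -
    have "f (mult A (mult A (unit A) x) (unit A)) = 0" using that by (simp add: I_def)
    thus ?thesis using that by (simp add: I_def mult_unit)
  qed
  ultimately show ?thesis using f by (auto simp: mem_finite_dual_space)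
qed

end

lemma (in smash) is_vspace_yd_dual_space [simp]: "is_vspace (yd_dual_space H R)"
proof -
  let ?X = "{f \<in> carrier (dual_space R). \<exists>I. ideal R I \<and> (\<forall>h\<in>carrier H. \<forall>x\<in>I. yact R h x \<in> I) \<and>
     cofinite R I \<and> (\<forall>x\<in>I. f x = 0)}"
  have D: "is_vspace (dual_space R)" by simp
  have "0 \<in> ?X" using vspace_0[OF D] R.ideal_carrier cofinite_carrier[of R] by (auto intro!: closed)
  moreover have "f + g \<in> ?X" if fg: "f \<in> ?X" "g \<in> ?X" for f g
  proof -
    obtain I J where "ideal R I" "cofinite R I" "\<forall>x\<in>I. f x = 0" "ideal R J" "cofinite R J" "\<forall>x\<in>J. g x = 0"
      "\<forall>h\<in>carrier H. \<forall>x\<in>I. yact R h x \<in> I" "\<forall>h\<in>carrier H. \<forall>x\<in>J. yact R h x \<in> J"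
      using fg by blast
    thus ?thesis using fg vspace_add[OF D]
      by (auto intro!: exI[of _ "I \<inter> J"] ideal_Int cofinite_Int)
  qed
  moreover have "(\<lambda>x. c * f x) \<in> ?X" if "f \<in> ?X" for c f
    using that vspace_scal[OF D, of f c] by auto
  ultimately show ?thesis unfolding yd_dual_space_def by (rule is_vspace_funI)
qed

section \<open>The maps \<open>theta\<close> and the transpose of \<open>\<phi>^{-1}\<close> take
  values in finite duals\<close>

context yd_hopf
begin

lemma M_unit:
  assumes "x \<in> carrier RH"
  shows "M (tens R H (unit R) (unit H)) x = x" "M x (tens R H (unit R) (unit H)) = x"
proof -
  show "M (tens R H (unit R) (unit H)) x = x"
    by (rule linear_map_tensor_eqI[of R H RH "M (tens R H (unit R) (unit H))" "\<lambda>x. x"])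
      (use assms in \<open>auto simp: M_unit_tens(2) R.mult_unit intro!: linear closed\<close>)
  \<comment> \<open>On the right the unit is met by the H-component: r # h is factored as (r # 1)(1
    # h), and associativity moves the unit next to 1 # h.\<close>
  show "M x (tens R H (unit R) (unit H)) = x"
  proof (rule linear_map_tensor_eqI[of R H RH "\<lambda>x. M x (tens R H (unit R) (unit H))" "\<lambda>x. x"])
    fix r h assume rh: "r \<in> carrier R" "h \<in> carrier H"
    have "M (tens R H r h) (tens R H (unit R) (unit H))
      = M (M (tens R H r (unit H)) (tens R H (unit R) h)) (tens R H (unit R) (unit H))"
      using rh by (simp add: M_unit_tens(2) R.mult_unit)
    also have "\<dots> = M (tens R H r (unit H)) (M (tens R H (unit R) h) (tens R H (unit R) (unit H)))"
      using rh by (intro M_assoc) (auto intro!: closed)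
    also have "\<dots> = tens R H r h"
      using rh by (simp add: M_unit_unit H.mult_unit M_unit_tens(2) R.mult_unit)
    finally show "M (tens R H r h) (tens R H (unit R) (unit H)) = tens R H r h" .
  qed (use assms in \<open>auto intro!: linear closed\<close>)
qed

lemma op_M_unit:
  assumes "x \<in> carrier RH"
  shows "op.M (tens R H (unit R) (unit H)) x = x" "op.M x (tens R H (unit R) (unit H)) = x"
proof -
  let ?u = "tens R H (unit R) (unit H)"
  have u: "?u \<in> carrier RH" by (simp add: closed)
  hence "\<phi> ?u = ?u" using phi_\<psi>[OF u] \<psi>_unit by simp
  hence "\<psi> (\<phi> (op.M ?u x)) = \<psi> (\<phi> x)" "\<psi> (\<phi> (op.M x ?u)) = \<psi> (\<phi> x)"
    using assms u by (simp_all add: phi_op_mult M_unit closed)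
  thus "op.M ?u x = x" "op.M x ?u = x" using assms u by (simp_all add: \<psi>_phi closed)
qed

sublocale RH_op: alg "biproduct (yd_op H R) (op_bialg H)"
  by unfold_locales (simp add: algebra_def op_M_assoc op_M_unit closed op.bilinear_M[simplified])

text \<open>With coordinates modulo ideals annihilated by \<open>p\<close> and \<open>q\<close>, the value of \<open>p \<otimes> q\<close> at \<open>a z b\<close> becomes a
  combination, with coefficients depending on \<open>a\<close> and \<open>b\<close>, of finitely many forms in \<open>z\<close>.\<close>

lemma functional_tens_mem_finite_dual:
  assumes p: "p \<in> carrier (yd_dual_space (op_bialg H) (yd_op H R))"
    and q: "q \<in> carrier (finite_dual_space (op_bialg H))"
  shows "zero_outside RH (\<lambda>z. sweedler R H z (\<lambda>r h. p r * q h))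
    \<in> carrier (finite_dual_space (biproduct (yd_op H R) (op_bialg H)))"
proof -
  let ?F = "\<lambda>z. sweedler R H z (\<lambda>r h. p r * q h)"
  obtain I where I: "ideal (yd_op H R) I" "\<forall>h\<in>carrier H. \<forall>x\<in>I. yact R (T h) x \<in> I"
      "cofinite R I" "\<forall>x\<in>I. p x = 0"
    using p by (auto simp: mem_yd_dual_space cofinite_def)
  obtain J where J: "ideal (op_bialg H) J" "cofinite H J" "\<forall>x\<in>J. q x = 0"
    using q by (auto simp: mem_finite_dual_space cofinite_def)
  have lin: "linear_map R field_space p" "linear_map H field_space q"
    using p q by (auto simp: mem_finite_dual_space mem_yd_dual_space mem_dual_space)
  note [linear] = lin[THEN linear_map_compose]
  obtain cs where cs: "coordinates R cs" "\<forall>x\<in>carrier R. x - (\<Sum>(f, e)\<leftarrow>cs. scal R (f x) e) \<in> I"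
    using coordinates_cofinite[of R I] I by auto
  obtain ds where ds: "coordinates H ds" "\<forall>x\<in>carrier H. x - (\<Sum>(f, e)\<leftarrow>ds. scal H (f x) e) \<in> J"
    using coordinates_cofinite[of H J] J by auto
  have cs_lin: "f \<in> set cs \<Longrightarrow> linear_map R field_space (fst f)"
    and [closed]: "f \<in> set cs \<Longrightarrow> snd f \<in> carrier R" for f
    using cs by (auto simp: coordinates_def)
  have ds_lin: "f \<in> set ds \<Longrightarrow> linear_map H field_space (fst f)"
    and [closed]: "f \<in> set ds \<Longrightarrow> snd f \<in> carrier H" for f
    using ds by (auto simp: coordinates_def)
  note [linear] = cs_lin ds_lin linear_map_compose[OF cs_lin] linear_map_compose[OF ds_lin]
  \<comment> \<open>In a z b with z = x # y, the factor y_(1) of z acts on the R-component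
    \<open>r'\<close> of b. Modulo the H-stable ideal \<open>I\<close>, \<open>r'\<close> is first
    replaced by the vectors \<open>e\<close>, and then S^{-1}(y_(1)) \<cdot> e is expanded again
    with coordinates \<open>f'\<close>; \<open>f\<close> and \<open>l\<close> are the coordinates of
    x and y_(2). Thus the forms involve z alone.\<close>
  let ?\<Phi> = "\<lambda>f f' e l z. sweedler R H z (\<lambda>x y. fst f x * cosum H y (\<lambda>y\<^sub>1 y\<^sub>2.
      fst f' (yact R (T y\<^sub>1) (snd e)) * fst l y\<^sub>2))"
  define fs where "fs = [?\<Phi> f f' e l. f \<leftarrow> cs, f' \<leftarrow> cs, e \<leftarrow> cs, l \<leftarrow> ds]"
  have lin_fs: "\<forall>f\<in>set fs. linear_map RH field_space f"
    unfolding fs_def by (auto intro!: linear closed)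
  have F: "linear_map RH field_space ?F"
    by (auto intro!: linear lin)
  show ?thesis
  proof (rule RH_op.finite_dual_spaceI[OF _ , of _ fs])
    show "zero_outside RH ?F \<in> carrier (dual_space (biproduct (yd_op H R) (op_bialg H)))"
      using zero_outside_mem_dual[OF _ F] by (simp add: mem_dual_space)
    fix z a b
    assume z: "z \<in> carrier (biproduct (yd_op H R) (op_bialg H))" and 0: "\<forall>g\<in>set fs. g z = 0"
      and ab: "a \<in> carrier (biproduct (yd_op H R) (op_bialg H))" "b \<in> carrier (biproduct (yd_op H R) (op_bialg H))"
    have z' [simp, closed]: "z \<in> carrier RH" using z by simp
    have "?F (op.M (op.M a z) b) = 0"
    proof (rule bilinear_tensor_eqI[of R H R H field_space "\<lambda>a b. ?F (op.M (op.M a z) b)" "\<lambda>a b. 0"])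
      fix r h r' h'
      assume *: "r \<in> carrier R" "h \<in> carrier H" "r' \<in> carrier R" "h' \<in> carrier H"
      let ?P = "\<lambda>x y\<^sub>1 y\<^sub>2 h\<^sub>1 g g'. p (mult R (yact R (T g) (yact R (T y\<^sub>1) r')) (mult R (yact R (T h\<^sub>1) x) r))
          * q (mult H h' (mult H y\<^sub>2 g'))"
      have "?F (op.M (op.M (tens R H r h) z) (tens R H r' h'))
        = sweedler R H z (\<lambda>x y. cosum H h (\<lambda>h\<^sub>1 h\<^sub>2. cosum H y (\<lambda>y\<^sub>1 y\<^sub>2. cosum H h\<^sub>2 (\<lambda>g g'. ?P x y\<^sub>1 y\<^sub>2 h\<^sub>1 g g'))))"
      proof (rule linear_map_tensor_eqI[of R H field_space "\<lambda>z. ?F (op.M (op.M (tens R H r h) z) (tens R H r' h'))"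
            "\<lambda>z. sweedler R H z (\<lambda>x y. cosum H h (\<lambda>h\<^sub>1 h\<^sub>2. cosum H y (\<lambda>y\<^sub>1 y\<^sub>2. cosum H h\<^sub>2 (\<lambda>g g'. ?P x y\<^sub>1 y\<^sub>2 h\<^sub>1 g g'))))"])
        fix x y assume xy: "x \<in> carrier R" "y \<in> carrier H"
        have "?F (op.M (op.M (tens R H r h) (tens R H x y)) (tens R H r' h'))
          = cosum H h (\<lambda>h\<^sub>1 h\<^sub>2. cosum H (mult H y h\<^sub>2) (\<lambda>u v.
             p (mult R (yact R (T u) r') (mult R (yact R (T h\<^sub>1) x) r)) * q (mult H h' v)))"
          using * xy
          by (simp add: op.M_tens[simplified] op.M_sweedler_left[simplified] sweedler_sweedler[of _ _ field_space] sweedler_tens[of field_space] linear closed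
              cong: sweedler_cong')
        also have "\<dots> = cosum H h (\<lambda>h\<^sub>1 h\<^sub>2. cosum H y (\<lambda>y\<^sub>1 y\<^sub>2. cosum H h\<^sub>2 (\<lambda>g g'.
             p (mult R (yact R (T (mult H y\<^sub>1 g)) r') (mult R (yact R (T h\<^sub>1) x) r)) * q (mult H h' (mult H y\<^sub>2 g')))))"
          using * xy by (intro sweedler_cong H.comult_mult) (auto intro!: linear closed)
        also have "\<dots> = sweedler R H (tens R H x y) (\<lambda>x y. cosum H h (\<lambda>h\<^sub>1 h\<^sub>2. cosum H y (\<lambda>y\<^sub>1 y\<^sub>2. cosum H h\<^sub>2 (\<lambda>g g'.
             ?P x y\<^sub>1 y\<^sub>2 h\<^sub>1 g g'))))"
          using * xy by (simp add: sweedler_tens[of field_space] linear closed H.antipode_inv_mult act_mult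
             cong: sweedler_cong')
        finally show "?F (op.M (op.M (tens R H r h) (tens R H x y)) (tens R H r' h')) = \<dots>" .
      qed (use * in \<open>auto intro!: linear closed\<close>)
      also have "\<dots> = cosum H h (\<lambda>h\<^sub>1 h\<^sub>2. sweedler R H z (\<lambda>x y. cosum H y (\<lambda>y\<^sub>1 y\<^sub>2. cosum H h\<^sub>2 (\<lambda>g g'. ?P x y\<^sub>1 y\<^sub>2 h\<^sub>1 g g'))))"
        by (rule sweedler_swap)
      also have "\<dots> = cosum H h (\<lambda>h\<^sub>1 h\<^sub>2. sweedler R H z (\<lambda>x y. cosum H h\<^sub>2 (\<lambda>g g'. cosum H y (\<lambda>y\<^sub>1 y\<^sub>2. ?P x y\<^sub>1 y\<^sub>2 h\<^sub>1 g g'))))"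
        using * by (intro sweedler_cong sweedler_swap) (auto intro!: closed)
      also have "\<dots> = cosum H h (\<lambda>h\<^sub>1 h\<^sub>2. cosum H h\<^sub>2 (\<lambda>g g'. sweedler R H z (\<lambda>x y. cosum H y (\<lambda>y\<^sub>1 y\<^sub>2. ?P x y\<^sub>1 y\<^sub>2 h\<^sub>1 g g'))))"
        using * by (intro sweedler_cong sweedler_swap) (auto intro!: closed)
      also have "\<dots> = cosum H h (\<lambda>h\<^sub>1 h\<^sub>2. cosum H h\<^sub>2 (\<lambda>g g'. 0))"
      proof (intro sweedler_cong)
        fix h\<^sub>1 h\<^sub>2 g g' assume h: "h\<^sub>1 \<in> carrier H" "h\<^sub>2 \<in> carrier H" "g \<in> carrier H" "g' \<in> carrier H"
        let ?C = "\<lambda>f f' e l. fst e r' * p (mult R (yact R (T g) (snd f')) (mult R (yact R (T h\<^sub>1) (snd f)) r))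
              * q (mult H h' (mult H (snd l) g'))"
        have P: "?P x y\<^sub>1 y\<^sub>2 h\<^sub>1 g g' = (\<Sum>f\<leftarrow>cs. \<Sum>e\<leftarrow>cs. \<Sum>f'\<leftarrow>cs. \<Sum>l\<leftarrow>ds.
            fst f x * (fst f' (yact R (T y\<^sub>1) (snd e)) * fst l y\<^sub>2) * ?C f f' e l)"
          if xy: "x \<in> carrier R" "y\<^sub>1 \<in> carrier H" "y\<^sub>2 \<in> carrier H" for x y\<^sub>1 y\<^sub>2
        proof -
          note expand = coordinate_expansion[OF _ cs, unfolded case_prod_unfold]
          have 1: "p (mult R u (mult R (yact R (T h\<^sub>1) x) r)) =
              (\<Sum>f\<leftarrow>cs. fst f x * p (mult R u (mult R (yact R (T h\<^sub>1) (snd f)) r)))"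
            if "u \<in> carrier R" for u
            using that xy h * I by (intro expand) (auto intro!: linear closed simp: ideal_def)
          \<comment> \<open>Both actions may stand in front of the expanded vector because
            \<open>I\<close> is stable under them and under multiplication; the form being expanded
            therefore kills \<open>I\<close>.\<close>
          have 2: "p (mult R (yact R (T g) (yact R (T y\<^sub>1) r')) u) =
              (\<Sum>e\<leftarrow>cs. fst e r' * p (mult R (yact R (T g) (yact R (T y\<^sub>1) (snd e))) u))"
            if "u \<in> carrier R" for u
            using that xy h * I by (intro expand) (auto intro!: linear closed simp: ideal_def)
          have 3: "p (mult R (yact R (T g) v) u) =
              (\<Sum>f'\<leftarrow>cs. fst f' v * p (mult R (yact R (T g) (snd f')) u))"
            if "u \<in> carrier R" "v \<in> carrier R" for u v
            using that xy h * I by (intro expand) (auto intro!: linear closed simp: ideal_def)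
          have 4: "q (mult H h' (mult H y\<^sub>2 g')) = (\<Sum>l\<leftarrow>ds. fst l y\<^sub>2 * q (mult H h' (mult H (snd l) g')))"
            using xy h * J by (intro coordinate_expansion[OF _ ds, unfolded case_prod_unfold])
              (auto intro!: linear closed simp: ideal_def)
          have 5: "p (mult R (yact R (T g) (yact R (T y\<^sub>1) r')) u) =
              (\<Sum>e\<leftarrow>cs. fst e r' * (\<Sum>f'\<leftarrow>cs. fst f' (yact R (T y\<^sub>1) (snd e)) *
              p (mult R (yact R (T g) (snd f')) u)))" if u: "u \<in> carrier R" for u
          proof -
            have "(\<Sum>e\<leftarrow>cs. fst e r' * p (mult R (yact R (T g) (yact R (T y\<^sub>1) (snd e))) u)) =
              (\<Sum>e\<leftarrow>cs. fst e r' * (\<Sum>f'\<leftarrow>cs. fst f' (yact R (T y\<^sub>1) (snd e)) *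
              p (mult R (yact R (T g) (snd f')) u)))"
              using u xy by (intro arg_cong[of _ _ sum_list] map_cong refl) (subst 3; simp add: closed)
            thus ?thesis using 2[OF u] by simp
          qed
          have "?P x y\<^sub>1 y\<^sub>2 h\<^sub>1 g g' =
              (\<Sum>f\<leftarrow>cs. fst f x * p (mult R (yact R (T g) (yact R (T y\<^sub>1) r')) (mult R (yact R (T h\<^sub>1) (snd f)) r)))
              * (\<Sum>l\<leftarrow>ds. fst l y\<^sub>2 * q (mult H h' (mult H (snd l) g')))"
            using xy h * by (subst 1, simp add: closed) (subst 4, rule refl)
          also have "(\<Sum>f\<leftarrow>cs. fst f x * p (mult R (yact R (T g) (yact R (T y\<^sub>1) r')) (mult R (yact R (T h\<^sub>1) (snd f)) r)))
            = (\<Sum>f\<leftarrow>cs. fst f x * (\<Sum>e\<leftarrow>cs. fst e r' * (\<Sum>f'\<leftarrow>cs. fst f' (yact R (T y\<^sub>1) (snd e)) *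
              p (mult R (yact R (T g) (snd f')) (mult R (yact R (T h\<^sub>1) (snd f)) r)))))"
            using xy h * by (intro arg_cong[of _ _ sum_list] map_cong refl) (subst 5; simp add: closed)
          finally have "?P x y\<^sub>1 y\<^sub>2 h\<^sub>1 g g' = (\<Sum>f\<leftarrow>cs. fst f x * (\<Sum>e\<leftarrow>cs. fst e r' * (\<Sum>f'\<leftarrow>cs. fst f' (yact R (T y\<^sub>1) (snd e)) *
              p (mult R (yact R (T g) (snd f')) (mult R (yact R (T h\<^sub>1) (snd f)) r)))))
              * (\<Sum>l\<leftarrow>ds. fst l y\<^sub>2 * q (mult H h' (mult H (snd l) g')))" .
          thus ?thesis
            by (simp add: sum_list_const_mult[symmetric] sum_list_mult_const[symmetric] mult_ac)
        qed
        have "sweedler R H z (\<lambda>x y. cosum H y (\<lambda>y\<^sub>1 y\<^sub>2. ?P x y\<^sub>1 y\<^sub>2 h\<^sub>1 g g'))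
          = (\<Sum>f\<leftarrow>cs. \<Sum>e\<leftarrow>cs. \<Sum>f'\<leftarrow>cs. \<Sum>l\<leftarrow>ds. ?\<Phi> f f' e l z * ?C f f' e l)"
          by (simp add: P closed sweedler_sum_list sweedler_mult_right sweedler_mult_left cong: sweedler_cong')
        also have "\<dots> = (\<Sum>f\<leftarrow>cs. \<Sum>e\<leftarrow>cs. \<Sum>f'\<leftarrow>cs. \<Sum>l\<leftarrow>ds. 0)"
          using 0 by (intro arg_cong[of _ _ sum_list] map_cong refl) (auto simp: fs_def)
        finally show "sweedler R H z (\<lambda>x y. cosum H y (\<lambda>y\<^sub>1 y\<^sub>2. ?P x y\<^sub>1 y\<^sub>2 h\<^sub>1 g g')) = 0" by simp
      qed (use * in \<open>auto intro!: closed\<close>)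
      finally show "?F (op.M (op.M (tens R H r h) z) (tens R H r' h')) = 0"
        by (simp add: sweedler_eq_0)
    qed (use ab in \<open>auto intro!: linear closed\<close>)
    thus "zero_outside RH ?F (op.M (op.M a z) b) = 0" by (simp add: zero_outside_def)
  qed (use lin_fs in simp)
qed

text \<open>The pointwise definition is rewritten as a Sweedler sum of functionals coming from pairs
  (p, q); the finite dual is a subspace, so membership for one pair suffices.\<close>

lemma theta_mem:
  assumes X: "X \<in> carrier (tensor (yd_dual_space (op_bialg H) (yd_op H R)) (finite_dual_space (op_bialg H)))"
  shows "theta H R X \<in> carrier (finite_dual_space (biproduct (yd_op H R) (op_bialg H)))"
proof -
  let ?P = "yd_dual_space (op_bialg H) (yd_op H R)" and ?Q = "finite_dual_space (op_bialg H)"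
  have "theta H R X = sweedler ?P ?Q X (\<lambda>p q. zero_outside RH (\<lambda>z. sweedler R H z (\<lambda>r h. p r * q h)))"
    by (simp add: theta_def tensor_functional_def fun_eq_iff zero_outside_def sweedler_terms
        sum_list_fun_apply case_prod_unfold)
  thus ?thesis using X
    by (auto intro!: sweedler_mem functional_tens_mem_finite_dual)
qed

text \<open>If \<open>G\<close> kills a cofinite ideal \<open>I\<close>, the transported functional
  kills the preimage \<open>J\<close> of \<open>I\<close> under \<open>\<psi>\<close>. It is an
  ideal because \<open>\<psi>\<close> reverses products, and cofinite because forms cutting out a
  subspace of \<open>I\<close> pull back along \<open>\<psi>\<close>.\<close>

lemma transpose_phi_inv_mem:
  assumes G: "G \<in> carrier (finite_dual_space (biproduct (yd_op H R) (op_bialg H)))"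
  shows "finite_dual_map (op_bialg (biproduct R H)) (biproduct (yd_op H R) (op_bialg H)) (phi_inv H R) G
    \<in> carrier (finite_dual_space (op_bialg (biproduct R H)))"
proof -
  interpret module "fun_scal :: 'k \<Rightarrow> (('r \<Rightarrow> 'h \<Rightarrow> 'k) \<Rightarrow> 'k) \<Rightarrow> _" by (rule module_fun)
  let ?G = "zero_outside RH (\<lambda>x. G (\<psi> x))"
  have "finite_dual_map (op_bialg (biproduct R H)) (biproduct (yd_op H R) (op_bialg H)) (phi_inv H R) G = ?G"
    using G by (auto simp: finite_dual_map_def transpose_def zero_outside_def phi_inv_eq)
  moreover have "?G \<in> carrier (finite_dual_space (op_bialg (biproduct R H)))"
  proof -
    have lin: "linear_map RH field_space G"
      using G by (simp add: mem_finite_dual_space mem_dual_space)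
    have "linear_map RH field_space (\<lambda>x. G (\<psi> x))" by (auto intro!: linear linear_map_compose[OF lin])
    hence "?G \<in> carrier (dual_space RH)" by (intro zero_outside_mem_dual) auto
    hence 1: "?G \<in> carrier (dual_space (op_bialg (biproduct R H)))" by (simp add: mem_dual_space)
    obtain I where I: "ideal (biproduct (yd_op H R) (op_bialg H)) I"
      "cofinite (biproduct (yd_op H R) (op_bialg H)) I" "\<forall>x\<in>I. G x = 0"
      using G by (auto simp: mem_finite_dual_space)
    hence sub: "subspace I" "I \<subseteq> carrier RH" by (auto simp: ideal_def)
    obtain fs where fs: "\<forall>f\<in>set fs. linear_map RH field_space f"
      "\<forall>x\<in>carrier RH. (\<forall>f\<in>set fs. f x = 0) \<longrightarrow> x \<in> I"
      using cofinite_forms[OF _ I(2)] by auto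
    define J where "J = {x \<in> carrier RH. \<psi> x \<in> I}"
    have J: "subspace J"
      unfolding subspace_def J_def using sub(1) linear_map_0[OF linear_map_\<psi>] linear_map_add[OF linear_map_\<psi>]
        linear_map_scaleD[OF linear_map_\<psi>]
      by (auto simp: subspace_def vspace_add vspace_scal[of RH, simplified])
    have "M c x \<in> J \<and> M x c \<in> J" if "c \<in> carrier RH" "x \<in> J" for c x
      using that I(1) by (auto simp: J_def \<psi>_M ideal_def closed)
    hence "ideal (op_bialg (biproduct R H)) J" using J by (auto simp: ideal_def J_def)
    moreover have "cofinite (op_bialg (biproduct R H)) J"
    proof (rule cofiniteI_forms[where fs = "[(\<lambda>x. f (\<psi> x)). f \<leftarrow> fs]"])
      show "\<forall>f\<in>set (map (\<lambda>f x. f (\<psi> x)) fs). linear_map (op_bialg (biproduct R H)) field_space f"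
        using fs(1) by (auto intro: linear_map_compose[OF _ linear_map_\<psi>])
      show "x \<in> J" if "x \<in> carrier (op_bialg (biproduct R H))" "\<forall>f\<in>set (map (\<lambda>f x. f (\<psi> x)) fs). f x = 0" for x
        using that fs(2) by (auto simp: J_def closed)
    qed (use J in \<open>auto simp: J_def\<close>)
    moreover have "\<forall>x\<in>J. ?G x = 0" using I(3) by (auto simp: J_def zero_outside_def)
    ultimately show ?thesis using 1 by (auto simp: mem_finite_dual_space)
  qed
  ultimately show ?thesis by simp
qed

end

text \<open>Apply the linear maps id \<otimes> \<epsilon> and \<epsilon> \<otimes> id, which recover
  r and h since \<epsilon>(1) = 1.\<close>

lemma (in yd_bialg) tens_unit_eq_0:
  "r \<in> carrier R \<Longrightarrow> tens R H r (unit H) = 0 \<Longrightarrow> r = 0"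
  "h \<in> carrier H \<Longrightarrow> tens R H (unit R) h = 0 \<Longrightarrow> h = 0"
proof -
  let ?f = "\<lambda>r h. scal R (counit H h) r" and ?g = "\<lambda>r h. scal H (counit R r) h"
  have f: "bilinear_map R H R ?f" and g: "bilinear_map R H H ?g" by (auto intro!: linear)
  note f0 = linear_map_0[OF linear_map_sweedler[OF _ _ _ f]] and g0 = linear_map_0[OF linear_map_sweedler[OF _ _ _ g]]
  show "r = 0" if "r \<in> carrier R" "tens R H r (unit H) = 0"
    using that sweedler_tens[OF _ f, of r "unit H"] f0 module_of_vspace[of R]
    by (simp add: H.counit_unit module.scale_one)
  show "h = 0" if "h \<in> carrier H" "tens R H (unit R) h = 0"
    using that sweedler_tens[OF _ g, of "unit R" h] g0 module_of_vspace[of H]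
    by (simp add: counit_R_unit module.scale_one)
qed

section \<open>Forms as maps into dual spaces, and separation of points on tensor products\<close>

lemma linear_map_form:
  assumes "linear_form (tensor U V) b"
  shows "u \<in> carrier U \<Longrightarrow> linear_map V field_space (\<lambda>v. b (tens U V u v))"
    and "v \<in> carrier V \<Longrightarrow> linear_map U field_space (\<lambda>u. b (tens U V u v))"
  by (rule linear_map_compose[OF assms[unfolded linear_form_def]], auto intro!: linear)+

lemma form_left_mem_dual:
  assumes "is_vspace V" "linear_form (tensor U V) b" "u \<in> carrier U"
  shows "form_left U V b u \<in> carrier (dual_space V)"
  unfolding form_left_def using assms by (intro zero_outside_mem_dual linear_map_form(1))

lemma form_right_mem_dual:
  assumes "is_vspace U" "linear_form (tensor U V) b" "v \<in> carrier V"
  shows "form_right U V b v \<in> carrier (dual_space U)"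
  unfolding form_right_def using assms by (intro zero_outside_mem_dual linear_map_form(2))

lemma tensor_map_mem:
  "is_vspace U \<Longrightarrow> is_vspace V \<Longrightarrow> f \<in> carrier U \<rightarrow> carrier P \<Longrightarrow> g \<in> carrier V \<rightarrow> carrier Q
    \<Longrightarrow> x \<in> carrier (tensor U V) \<Longrightarrow> tensor_map U V P Q f g x \<in> carrier (tensor P Q)"
  unfolding tensor_map_def by (intro sweedler_mem) (auto intro!: closed)

lemma bilinear_map_functional:
  assumes "scal P = fun_scal" "scal Q = fun_scal"
  shows "bilinear_map P Q field_space (\<lambda>p q. sweedler U V y (\<lambda>u v. p u * q v))"
  unfolding bilinear_map_def linear_map_def
  by (auto simp: assms sweedler_add[symmetric] sweedler_mult_left[symmetric] algebra_simps)

lemma tensor_functional_tensor_map: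
  assumes "is_vspace P" "is_vspace Q" "is_vspace X" "is_vspace Y"
    and "scal P = fun_scal" "scal Q = fun_scal"
    and fg: "f \<in> carrier X \<rightarrow> carrier P" "g \<in> carrier Y \<rightarrow> carrier Q"
    and x: "x \<in> carrier (tensor X Y)" and y: "y \<in> carrier (tensor U V)"
  shows "tensor_functional P Q U V (tensor_map X Y P Q f g x) y
    = sweedler X Y x (\<lambda>s t. sweedler U V y (\<lambda>u v. f s u * g t v))"
proof -
  let ?b = "\<lambda>p q. sweedler U V y (\<lambda>u v. p u * q v)"
  have b: "bilinear_map P Q field_space ?b" by (rule bilinear_map_functional) fact+
  have fg': "f s \<in> carrier P" "g t \<in> carrier Q" if "s \<in> carrier X" "t \<in> carrier Y" for s t
    using fg that by auto
  show ?thesis using assms b fg' sweedler_tens[OF is_vspace_field_space b]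
    by (simp add: tensor_functional_def zero_outside_def tensor_map_def closed
        sweedler_sweedler[of P Q field_space X Y ?b] cong: sweedler_cong')
qed

text \<open>Expanding the second factors of \<open>z\<close> in coordinates \<open>\<phi>\<close> reduces the claim to
  the vanishing of the contractions \<open>(id \<otimes> \<phi>)(z)\<close>.\<close>

lemma tensor_pairing_eq_0:
  assumes U: "is_vspace U" and V: "is_vspace V"
    and f: "\<And>x. x \<in> X \<Longrightarrow> linear_map U field_space (\<lambda>u. f u x)"
      "\<And>u. u \<in> carrier U \<Longrightarrow> (\<And>x. x \<in> X \<Longrightarrow> f u x = 0) \<Longrightarrow> u = 0"
    and g: "\<And>y. y \<in> Y \<Longrightarrow> linear_map V field_space (\<lambda>v. g v y)"
      "\<And>v. v \<in> carrier V \<Longrightarrow> (\<And>y. y \<in> Y \<Longrightarrow> g v y = 0) \<Longrightarrow> v = 0"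
    and z: "z \<in> carrier (tensor U V)"
    and 0: "\<And>x y. x \<in> X \<Longrightarrow> y \<in> Y \<Longrightarrow> sweedler U V z (\<lambda>u v. f u x * g v y) = 0"
  shows "z = 0"
proof -
  \<comment> \<open>Contracting the first leg with \<open>f\<close> leaves a vector of
    \<open>V\<close> annihilated by all the separating forms \<open>g\<close>. The next step
    contracts the second leg, tests against \<open>f\<close>, and exchanges the two contractions to
    reach this one.\<close>
  have w: "sweedler U V z (\<lambda>u v. scal V (f u x) v) = 0" if x: "x \<in> X" for x
  proof (rule g(2))
    show "sweedler U V z (\<lambda>u v. scal V (f u x) v) \<in> carrier V"
      using U V z by (auto intro!: closed)
    show "g (sweedler U V z (\<lambda>u v. scal V (f u x) v)) y = 0" if y: "y \<in> Y" for y
      using U V z 0[OF x y]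
      by (simp add: linear_map_of_sweedler[OF g(1)[OF y]] linear_map_scaleD[OF g(1)[OF y]] closed
          cong: sweedler_cong')
  qed
  have t: "sweedler U V z (\<lambda>u v. scal U (\<phi> v) u) = 0" if \<phi>: "linear_map V field_space \<phi>" for \<phi>
  proof (rule f(2))
    show "sweedler U V z (\<lambda>u v. scal U (\<phi> v) u) \<in> carrier U"
      using U V z by (auto intro!: closed)
    fix x assume x: "x \<in> X"
    have "f (sweedler U V z (\<lambda>u v. scal U (\<phi> v) u)) x = sweedler U V z (\<lambda>u v. \<phi> v * f u x)"
      using U V z by (simp add: linear_map_of_sweedler[OF f(1)[OF x]] linear_map_scaleD[OF f(1)[OF x]] closed
          cong: sweedler_cong')
    also have "\<dots> = \<phi> (sweedler U V z (\<lambda>u v. scal V (f u x) v))"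
      using U V z by (simp add: linear_map_of_sweedler[OF \<phi>] linear_map_scaleD[OF \<phi>] closed mult.commute
          cong: sweedler_cong')
    also have "\<dots> = 0" using w[OF x] linear_map_0[OF \<phi> V] by simp
    finally show "f (sweedler U V z (\<lambda>u v. scal U (\<phi> v) u)) x = 0" .
  qed
  have S: "finite (snd ` set (tensor_terms U V z))" "snd ` set (tensor_terms U V z) \<subseteq> carrier V"
    using tensor_terms_mem[OF U V z] by auto
  from coordinates_finite[OF V S] obtain cs where cs: "coordinates V cs"
    "\<forall>v\<in>snd ` set (tensor_terms U V z). v = (\<Sum>(\<phi>, e)\<leftarrow>cs. scal V (\<phi> v) e)" by blast
  have "z b = 0" for b
  proof (cases "bilinear_map U V field_space b")
    case True
    have lin: "linear_map V field_space (b u)" if "u \<in> carrier U" for u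
      using True that by (simp add: bilinear_map_def)
    have lin': "linear_map U field_space (\<lambda>u. b u v)" if "v \<in> carrier V" for v
      using True that by (simp add: bilinear_map_def)
    have "z b = sweedler U V z b" by (rule tensor_apply[OF U V z True])
    also have "\<dots> = sweedler U V z (\<lambda>u v. \<Sum>p\<leftarrow>cs. fst p v * b u (snd p))"
      unfolding sweedler_terms
    proof (intro arg_cong[of _ _ sum_list] map_cong refl, clarify)
      fix u v assume uv: "(u, v) \<in> set (tensor_terms U V z)"
      hence u: "u \<in> carrier U" using tensor_terms_mem[OF U V z] by auto
      have "v = (\<Sum>(\<phi>, e)\<leftarrow>cs. scal V (\<phi> v) e)" using cs(2) uv by force
      hence "b u v = b u (\<Sum>(\<phi>, e)\<leftarrow>cs. scal V (\<phi> v) e)" by (rule arg_cong)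
      thus "b u v = (\<Sum>p\<leftarrow>cs. fst p v * b u (snd p))"
        using linear_map_coordinate_sum[OF V cs(1) lin[OF u], of v] by (simp add: case_prod_unfold)
    qed
    also have "\<dots> = (\<Sum>p\<leftarrow>cs. sweedler U V z (\<lambda>u v. fst p v * b u (snd p)))"
      by (rule sweedler_sum_list)
    also have "\<dots> = (\<Sum>p\<leftarrow>cs. b (sweedler U V z (\<lambda>u v. scal U (fst p v) u)) (snd p))"
    proof (intro arg_cong[of _ _ sum_list] map_cong refl)
      fix p assume "p \<in> set cs"
      hence "snd p \<in> carrier V" using cs(1) by (auto simp: coordinates_def)
      from lin'[OF this] show "sweedler U V z (\<lambda>u v. fst p v * b u (snd p))
          = b (sweedler U V z (\<lambda>u v. scal U (fst p v) u)) (snd p)"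
        using U V z by (subst linear_map_of_sweedler[of U field_space "\<lambda>u. b u (snd p)"])
          (auto simp: closed linear_map_scaleD[of U field_space "\<lambda>u. b u (snd p)"] intro!: sweedler_cong)
    qed
    also have "\<dots> = (\<Sum>p\<leftarrow>cs. 0)"
    proof (intro arg_cong[of _ _ sum_list] map_cong refl)
      fix p assume "p \<in> set cs"
      hence "snd p \<in> carrier V" "linear_map V field_space (fst p)" using cs(1) by (auto simp: coordinates_def)
      thus "b (sweedler U V z (\<lambda>u v. scal U (fst p v) u)) (snd p) = 0"
        using t linear_map_0[OF lin' U] by simp
    qed
    finally show ?thesis by simp
  qed (rule tensor_apply_not_bilinear[OF U V z])
  thus ?thesis by (simp add: fun_eq_iff)
qed

lemma inj_on_linear_iff:
  fixes f :: "'a::ab_group_add \<Rightarrow> 'b::ab_group_add"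
  assumes V: "is_vspace V" and add: "\<And>x y. x \<in> carrier V \<Longrightarrow> y \<in> carrier V \<Longrightarrow> f (x - y) = f x - f y"
  shows "inj_on f (carrier V) \<longleftrightarrow> (\<forall>x\<in>carrier V. f x = 0 \<longrightarrow> x = 0)"
proof
  assume inj: "inj_on f (carrier V)"
  have "f 0 = 0" using add[of 0 0] V by simp
  thus "\<forall>x\<in>carrier V. f x = 0 \<longrightarrow> x = 0" using inj V by (auto simp: inj_on_def)
next
  assume *: "\<forall>x\<in>carrier V. f x = 0 \<longrightarrow> x = 0"
  show "inj_on f (carrier V)"
  proof (rule inj_onI)
    fix x y assume "x \<in> carrier V" "y \<in> carrier V" "f x = f y"
    hence "x - y \<in> carrier V" "f (x - y) = 0" using add V by (auto intro: vspace_diff)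
    hence "x - y = 0" using * by blast
    thus "x = y" by simp
  qed
qed

lemma left_nonsingular_iff:
  assumes "is_vspace U" "linear_form (tensor U V) b"
  shows "left_nonsingular U V b \<longleftrightarrow>
    (\<forall>u\<in>carrier U. (\<forall>v\<in>carrier V. b (tens U V u v) = 0) \<longrightarrow> u = 0)"
  unfolding left_nonsingular_def
  by (subst inj_on_linear_iff[OF assms(1)])
    (auto simp: form_left_def zero_outside_def fun_eq_iff linear_map_diff[OF linear_map_form(2)[OF assms(2)] assms(1)])

lemma right_nonsingular_iff:
  assumes "is_vspace V" "linear_form (tensor U V) b"
  shows "right_nonsingular U V b \<longleftrightarrow>
    (\<forall>v\<in>carrier V. (\<forall>u\<in>carrier U. b (tens U V u v) = 0) \<longrightarrow> v = 0)"
  unfolding right_nonsingular_def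
  by (subst inj_on_linear_iff[OF assms(1)])
    (auto simp: form_right_def zero_outside_def fun_eq_iff linear_map_diff[OF linear_map_form(1)[OF assms(2)] assms(1)])

section \<open>Membership of \<open>\<beta>\<^sub>l(t)\<close> and \<open>\<tau>\<^sub>l(k)\<close>
  in the finite duals, and non-singularity\<close>

context yd_pairing
begin

lemma form_left_\<tau>_mem:
  assumes k: "k \<in> carrier K"
  shows "form_left K H \<tau> k \<in> carrier (finite_dual_space (op_bialg H))"
proof (rule HR.op.H.finite_dual_spaceI)
  let ?t = "\<lambda>k. tensor_terms K K (comult K k)"
  \<comment> \<open>Two uses of (A.1) pair \<open>x\<close> with the middle factor of the iterated
    coproduct of \<open>k\<close>: the second entry \<open>q\<close> of the coproduct of the first
    entry of \<open>p\<close>. The outer factors are paired with the multipliers.\<close>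
  let ?fs = "[(\<lambda>x. c (snd q) x). p \<leftarrow> ?t k, q \<leftarrow> ?t (fst p)]"
  have mem: "p \<in> carrier K \<times> carrier K" if "p \<in> set (?t l)" "l \<in> carrier K" for p l
    using tensor_terms_mem[of K K "comult K l"] that by (auto simp: closed)
  show "form_left K H \<tau> k \<in> carrier (dual_space (op_bialg H))"
    using form_left_mem_dual[OF _ \<tau> k] by (simp add: mem_dual_space)
  have "c (snd q) \<in> Collect (linear_map H field_space)" if "p \<in> set (?t k)" "q \<in> set (?t (fst p))" for p q
    using mem[OF that(1) k] mem[OF that(2)] by (auto intro!: linear)
  thus "\<forall>f\<in>set ?fs. linear_map (op_bialg H) field_space f" by auto
  fix x a b assume *: "x \<in> carrier (op_bialg H)" "\<forall>f\<in>set ?fs. f x = 0"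
    "a \<in> carrier (op_bialg H)" "b \<in> carrier (op_bialg H)"
  have "c k (mult H b (mult H x a)) = cosum K k (\<lambda>k\<^sub>1 k\<^sub>2. c k\<^sub>2 b * cosum K k\<^sub>1 (\<lambda>p q. c q x * c p a))"
    using * k by (simp add: c_mult_right closed cong: sweedler_cong')
  also have "\<dots> = 0"
  proof (rule sweedler_eq_0)
    fix k\<^sub>1 k\<^sub>2 assume k12: "(k\<^sub>1, k\<^sub>2) \<in> set (?t k)"
    have "cosum K k\<^sub>1 (\<lambda>p q. c q x * c p a) = 0"
      using *(2) k12 by (intro sweedler_eq_0) force
    thus "c k\<^sub>2 b * cosum K k\<^sub>1 (\<lambda>p q. c q x * c p a) = 0" by simp
  qed
  finally show "form_left K H \<tau> k (mult (op_bialg H) (mult (op_bialg H) a x) b) = 0"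
    using * by (simp add: form_left_def zero_outside_def)
qed

text \<open>The ideal must also be an H-submodule, so the condition defining \<open>I\<close> ranges
  over an acting \<open>h\<close> in addition to the multipliers. It remains an ideal because the
  module algebra axiom distributes \<open>h\<close> over a product and the extra factor joins a
  multiplier.\<close>

lemma form_left_\<beta>_mem:
  assumes t: "t \<in> carrier T"
  shows "form_left T R \<beta> t \<in> carrier (yd_dual_space (op_bialg H) (yd_op H R))"
proof -
  interpret module "scal R" by (rule module_of_vspace) simp
  let ?E = "\<lambda>x a a' h. b t (mult R (mult R a (yact R h x)) a')"
  define I where "I = {x \<in> carrier R. \<forall>a\<in>carrier R. \<forall>a'\<in>carrier R. \<forall>h\<in>carrier H. ?E x a a' h = 0}"
  have L: "linear_map R field_space (\<lambda>x. ?E x a a' h)"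
    if "a \<in> carrier R" "a' \<in> carrier R" "h \<in> carrier H" for a a' h
    using that t by (auto intro!: linear closed)
  have sub: "subspace I" unfolding subspace_def I_def
    using linear_map_0[OF L] linear_map_add[OF L] linear_map_scaleD[OF L]
    by (auto simp: vspace_add vspace_scal)
  have "mult R z x \<in> I \<and> mult R x z \<in> I" if z: "z \<in> carrier R" and x: "x \<in> I" for z x
  proof -
    have "?E (mult R z x) a a' h = 0 \<and> ?E (mult R x z) a a' h = 0"
      if *: "a \<in> carrier R" "a' \<in> carrier R" "h \<in> carrier H" for a a' h
    proof -
      have xR: "x \<in> carrier R" using x by (simp add: I_def)
      have L': "linear_map R field_space (\<lambda>y. b t (mult R (mult R a y) a'))"
        using t * by (auto intro!: linear closed)
      have "?E (mult R z x) a a' h = cosum H h (\<lambda>h\<^sub>1 h\<^sub>2. ?E x (mult R a (yact R h\<^sub>1 z)) a' h\<^sub>2)"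
        using HR.act_alg_mult[OF L' *(3) z xR] xR z * by (simp add: HR.R.mult_assoc closed cong: sweedler_cong')
      also have "\<dots> = cosum H h (\<lambda>h\<^sub>1 h\<^sub>2. 0)"
        using x * z by (intro sweedler_cong) (auto simp: I_def closed)
      finally have 1: "?E (mult R z x) a a' h = 0" by (simp add: sweedler_eq_0)
      have "?E (mult R x z) a a' h = cosum H h (\<lambda>h\<^sub>1 h\<^sub>2. ?E x a (mult R (yact R h\<^sub>2 z) a') h\<^sub>1)"
        using HR.act_alg_mult[OF L' *(3) xR z] xR z * by (simp add: HR.R.mult_assoc closed cong: sweedler_cong')
      also have "\<dots> = cosum H h (\<lambda>h\<^sub>1 h\<^sub>2. 0)"
        using x * z by (intro sweedler_cong) (auto simp: I_def closed)
      finally show ?thesis using 1 by (simp add: sweedler_eq_0)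
    qed
    thus ?thesis using z x by (auto simp: I_def closed)
  qed
  hence "ideal (yd_op H R) I" using sub by (auto simp: ideal_def I_def)
  moreover have "yact R (antipode_inv H h) x \<in> I" if "h \<in> carrier H" "x \<in> I" for h x
    using that by (auto simp: I_def closed HR.act_mult[symmetric])
  moreover have "cofinite R I"
  proof -
    let ?t = "\<lambda>s. tensor_terms T T (comult T s)" and ?d = "\<lambda>s. tensor_terms K T (ycoact T s)"
    \<comment> \<open>By (B.3) twice, \<open>h \<cdot> x\<close> is paired with the middle factor of
      the iterated coproduct of \<open>t\<close>. By (C.2) \<open>x\<close> alone is then paired
      with the components in \<open>T\<close> of the coaction of that factor.\<close>
    let ?fs = "[(\<lambda>x. b (snd n) x). p \<leftarrow> ?t t, q \<leftarrow> ?t (snd p), n \<leftarrow> ?d (fst q)]"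
    have mem: "p \<in> carrier T \<times> carrier T" if "p \<in> set (?t s)" "s \<in> carrier T" for p s
      using tensor_terms_mem[of T T "comult T s"] that by (auto simp: closed)
    have mem': "p \<in> carrier K \<times> carrier T" if "p \<in> set (?d s)" "s \<in> carrier T" for p s
      using tensor_terms_mem[of K T "ycoact T s"] that by (auto simp: closed)
    have "linear_map R field_space (b (snd n))"
      if "p \<in> set (?t t)" "q \<in> set (?t (snd p))" "n \<in> set (?d (fst q))" for p q n
      using mem[OF that(1) t] mem[OF that(2)] mem'[OF that(3)] by (auto intro!: linear)
    hence "\<forall>f\<in>set ?fs. linear_map R field_space f" by auto
    moreover have "x \<in> I" if x: "x \<in> carrier R" and 0: "\<forall>f\<in>set ?fs. f x = 0" for x
    proof -
      have "?E x a a' h = 0" if *: "a \<in> carrier R" "a' \<in> carrier R" "h \<in> carrier H" for a a' h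
      proof -
        \<comment> \<open>(C.2) describes the action through the inverse antipode, hence it is
          applied to \<open>antipode H h\<close>. Afterwards \<open>h\<close> occurs only in the
          scalar coefficients, which keeps the family of forms finite.\<close>
        have act: "b s (yact R h x) = coact_sum K T s (\<lambda>g n. c g (antipode H h) * b n x)" if "s \<in> carrier T" for s
          using b_act_right[of "antipode H h" s x] that * x by (simp add: HR.H.antipode_inv closed)
        have "?E x a a' h = cosum T t (\<lambda>t\<^sub>1 t\<^sub>2. cosum T t\<^sub>2 (\<lambda>s\<^sub>1 s\<^sub>2.
            b s\<^sub>2 a * coact_sum K T s\<^sub>1 (\<lambda>g n. c g (antipode H h) * b n x)) * b t\<^sub>1 a')"
          using * x t by (simp add: b_mult_right act closed cong: sweedler_cong')
        also have "\<dots> = 0"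
        proof (rule sweedler_eq_0)
          fix t\<^sub>1 t\<^sub>2 assume t12: "(t\<^sub>1, t\<^sub>2) \<in> set (?t t)"
          have "cosum T t\<^sub>2 (\<lambda>s\<^sub>1 s\<^sub>2. b s\<^sub>2 a * coact_sum K T s\<^sub>1 (\<lambda>g n. c g (antipode H h) * b n x)) = 0"
          proof (rule sweedler_eq_0)
            fix s\<^sub>1 s\<^sub>2 assume s12: "(s\<^sub>1, s\<^sub>2) \<in> set (?t t\<^sub>2)"
            have "coact_sum K T s\<^sub>1 (\<lambda>g n. c g (antipode H h) * b n x) = 0"
              using 0 t12 s12 by (intro sweedler_eq_0) force
            thus "b s\<^sub>2 a * coact_sum K T s\<^sub>1 (\<lambda>g n. c g (antipode H h) * b n x) = 0" by simp
          qed
          thus "cosum T t\<^sub>2 (\<lambda>s\<^sub>1 s\<^sub>2. b s\<^sub>2 a * coact_sum K T s\<^sub>1 (\<lambda>g n. c g (antipode H h) * b n x)) * b t\<^sub>1 a' = 0"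
            by simp
        qed
        finally show ?thesis .
      qed
      thus ?thesis using x by (simp add: I_def)
    qed
    ultimately show ?thesis using sub by (intro cofiniteI_forms[of R I ?fs]) (auto simp: I_def)
  qed
  moreover have "form_left T R \<beta> t x = 0" if "x \<in> I" for x
  proof -
    have "?E x (unit R) (unit R) (unit H) = 0" using that by (simp add: I_def)
    thus ?thesis using that
      by (simp add: I_def form_left_def zero_outside_def HR.act_unit HR.R.mult_unit)
  qed
  ultimately show ?thesis
    using form_left_mem_dual[OF _ \<beta> t] unfolding mem_yd_dual_space by (auto simp: mem_dual_space cofinite_def)
qed

lemma linear_form_hash: "linear_form (tensor (tensor T K) (tensor R H)) hash"
proof -
  have "bilinear_map (tensor T K) (tensor R H) field_space (\<lambda>x y.
       sweedler T K x (\<lambda>t k. sweedler R H y (\<lambda>r h. cosum H h (\<lambda>h\<^sub>1 h\<^sub>2.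
         b t (yact R (antipode_inv H h\<^sub>1) r) * c k h\<^sub>2))))"
    by (auto intro!: linear closed)
  thus ?thesis unfolding linear_form_def hash_form_def
    by (auto intro!: linear_map_sweedler)
qed

text \<open>\<open>\<psi>\<close> is surjective, so the left radical of the form is that of
  \<open>B\<close>. A vector in the left radical of \<open>\<beta>\<close> or \<open>\<tau>\<close>
  gives t # 1 or 1 # k in that of \<open>B\<close>; conversely, the rows of \<open>\<beta>\<close>
  and \<open>\<tau>\<close> separate points, and \<open>tensor_pairing_eq_0\<close> applies.\<close>

lemma left_nonsingular_hash:
  "left_nonsingular (biproduct T K) (biproduct R H) hash \<longleftrightarrow>
    left_nonsingular T R \<beta> \<and> left_nonsingular K H \<tau>"
proof -
  have hash_iff: "(\<forall>y\<in>carrier (tensor R H). hash (tens (tensor T K) (tensor R H) x y) = 0) \<longleftrightarrow>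
      (\<forall>y\<in>carrier (tensor R H). B x y = 0)" if "x \<in> carrier (tensor T K)" for x
    using that HR.\<psi>_phi by (metis HR.\<psi>_mem HR.phi_mem hash_tens)
  have "left_nonsingular (biproduct T K) (biproduct R H) hash \<longleftrightarrow> left_nonsingular (tensor T K) (tensor R H) hash"
    by (simp add: left_nonsingular_def form_left_def[abs_def] zero_outside_def cong: if_cong)
  also have "\<dots> \<longleftrightarrow> (\<forall>x\<in>carrier (tensor T K). (\<forall>y\<in>carrier (tensor R H). B x y = 0) \<longrightarrow> x = 0)"
    using hash_iff by (simp add: left_nonsingular_iff[OF _ linear_form_hash])
  also have "\<dots> \<longleftrightarrow> (\<forall>t\<in>carrier T. (\<forall>r\<in>carrier R. b t r = 0) \<longrightarrow> t = 0) \<and>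
      (\<forall>k\<in>carrier K. (\<forall>h\<in>carrier H. c k h = 0) \<longrightarrow> k = 0)" (is "?L \<longleftrightarrow> ?T \<and> ?K")
  proof (intro iffI conjI ballI impI)
    fix t assume L: ?L and t: "t \<in> carrier T" "\<forall>r\<in>carrier R. b t r = 0"
    have "B (tens T K t (unit K)) y = 0" if "y \<in> carrier (tensor R H)" for y
    proof -
      have "B (tens T K t (unit K)) y = sweedler R H y (\<lambda>r h. 0)"
        using t that by (simp add: B_tens_left cong: sweedler_cong')
      thus ?thesis by (simp add: sweedler_eq_0)
    qed
    hence "tens T K t (unit K) = 0" using L t by (auto intro: closed)
    thus "t = 0" using KT.tens_unit_eq_0(1) t by blast
  next
    fix k assume L: ?L and k: "k \<in> carrier K" "\<forall>h\<in>carrier H. c k h = 0"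
    have "B (tens T K (unit T) k) y = 0" if "y \<in> carrier (tensor R H)" for y
    proof -
      have "B (tens T K (unit T) k) y = sweedler R H y (\<lambda>r h. 0)"
        using k that by (simp add: B_tens_left cong: sweedler_cong')
      thus ?thesis by (simp add: sweedler_eq_0)
    qed
    hence "tens T K (unit T) k = 0" using L k by (auto intro: closed)
    thus "k = 0" using KT.tens_unit_eq_0(2) k by blast
  next
    fix x assume *: "?T \<and> ?K" and x: "x \<in> carrier (tensor T K)" "\<forall>y\<in>carrier (tensor R H). B x y = 0"
    show "x = 0"
    proof (rule tensor_pairing_eq_0[where X = "carrier R" and Y = "carrier H" and f = b and g = c])
      show "sweedler T K x (\<lambda>t k. b t r * c k h) = 0" if "r \<in> carrier R" "h \<in> carrier H" for r h
        using x that by (auto simp: B_tens_right[symmetric] intro: closed)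
    qed (use * x in \<open>auto intro!: linear\<close>)
  qed
  also have "\<dots> \<longleftrightarrow> left_nonsingular T R \<beta> \<and> left_nonsingular K H \<tau>"
    by (simp add: left_nonsingular_iff[OF _ \<beta>] left_nonsingular_iff[OF _ \<tau>])
  finally show ?thesis .
qed

text \<open>Here \<open>\<psi>\<close> acts on the very vector to be shown zero: its surjectivity
  reduces the condition to \<open>B\<close>, and its injectivity carries zero back. The rest mirrors
  the left-hand case.\<close>

lemma right_nonsingular_hash:
  "right_nonsingular (biproduct T K) (biproduct R H) hash \<longleftrightarrow>
    right_nonsingular T R \<beta> \<and> right_nonsingular K H \<tau>"
proof -
  have "right_nonsingular (biproduct T K) (biproduct R H) hash \<longleftrightarrow> right_nonsingular (tensor T K) (tensor R H) hash"
    by (simp add: right_nonsingular_def form_right_def[abs_def] zero_outside_def cong: if_cong)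
  also have "\<dots> \<longleftrightarrow> (\<forall>y\<in>carrier (tensor R H). (\<forall>x\<in>carrier (tensor T K). B x (HR.\<psi> y) = 0) \<longrightarrow> y = 0)"
    by (simp add: right_nonsingular_iff[OF _ linear_form_hash] hash_tens)
  also have "\<dots> \<longleftrightarrow> (\<forall>y\<in>carrier (tensor R H). (\<forall>x\<in>carrier (tensor T K). B x y = 0) \<longrightarrow> y = 0)"
  proof -
    have "HR.\<psi> y = 0 \<longleftrightarrow> y = 0" if "y \<in> carrier (tensor R H)" for y
      using HR.phi_\<psi>[OF that] linear_map_0[OF HR.linear_map_phi] linear_map_0[OF HR.linear_map_\<psi>] by auto
    thus ?thesis by (metis HR.\<psi>_phi HR.\<psi>_mem HR.phi_mem)
  qed
  also have "\<dots> \<longleftrightarrow> (\<forall>r\<in>carrier R. (\<forall>t\<in>carrier T. b t r = 0) \<longrightarrow> r = 0) \<and>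
      (\<forall>h\<in>carrier H. (\<forall>k\<in>carrier K. c k h = 0) \<longrightarrow> h = 0)" (is "?L \<longleftrightarrow> ?R \<and> ?H")
  proof (intro iffI conjI ballI impI)
    fix r assume L: ?L and r: "r \<in> carrier R" "\<forall>t\<in>carrier T. b t r = 0"
    have "B x (tens R H r (unit H)) = 0" if "x \<in> carrier (tensor T K)" for x
    proof -
      have "B x (tens R H r (unit H)) = sweedler T K x (\<lambda>t k. 0)"
        using r that by (simp add: B_tens_right cong: sweedler_cong')
      thus ?thesis by (simp add: sweedler_eq_0)
    qed
    hence "tens R H r (unit H) = 0" using L r by (auto intro: closed)
    thus "r = 0" using HR.tens_unit_eq_0(1) r by blast
  next
    fix h assume L: ?L and h: "h \<in> carrier H" "\<forall>k\<in>carrier K. c k h = 0"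
    have "B x (tens R H (unit R) h) = 0" if "x \<in> carrier (tensor T K)" for x
    proof -
      have "B x (tens R H (unit R) h) = sweedler T K x (\<lambda>t k. 0)"
        using h that by (simp add: B_tens_right cong: sweedler_cong')
      thus ?thesis by (simp add: sweedler_eq_0)
    qed
    hence "tens R H (unit R) h = 0" using L h by (auto intro: closed)
    thus "h = 0" using HR.tens_unit_eq_0(2) h by blast
  next
    fix y assume *: "?R \<and> ?H" and y: "y \<in> carrier (tensor R H)" "\<forall>x\<in>carrier (tensor T K). B x y = 0"
    show "y = 0"
    proof (rule tensor_pairing_eq_0[where X = "carrier T" and Y = "carrier K"
          and f = "\<lambda>r t. b t r" and g = "\<lambda>h k. c k h"])
      show "sweedler R H y (\<lambda>r h. b t r * c k h) = 0" if "t \<in> carrier T" "k \<in> carrier K" for t k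
        using y that by (auto simp: B_tens_left[symmetric] intro: closed)
    qed (use * y in \<open>auto intro!: linear\<close>)
  qed
  also have "\<dots> \<longleftrightarrow> right_nonsingular T R \<beta> \<and> right_nonsingular K H \<tau>"
    by (simp add: right_nonsingular_iff[OF _ \<beta>] right_nonsingular_iff[OF _ \<tau>])
  finally show ?thesis .
qed

lemma form_left_hash:
  "x \<in> carrier (tensor T K) \<Longrightarrow> form_left (biproduct T K) (biproduct R H) hash x
    = zero_outside (tensor R H) (\<lambda>y. B x (HR.\<psi> y))"
  by (auto simp: form_left_def zero_outside_def hash_tens)

lemma form_right_hash:
  "y \<in> carrier (tensor R H) \<Longrightarrow> form_right (biproduct T K) (biproduct R H) hash y
    = zero_outside (tensor T K) (\<lambda>x. B x (HR.\<psi> y))"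
  by (auto simp: form_right_def zero_outside_def hash_tens)

text \<open>The spaces \<open>P\<close> and \<open>Q\<close> are left open because the tensor
  product of functionals is formed in the finite duals for (a) and in the full duals for
  (b).\<close>

lemma B_eq_tensor_functional:
  assumes x: "x \<in> carrier (tensor T K)" and y: "y \<in> carrier (tensor R H)"
    and "is_vspace P" "is_vspace Q" "scal P = fun_scal" "scal Q = fun_scal"
    and "form_left T R \<beta> \<in> carrier T \<rightarrow> carrier P" "form_left K H \<tau> \<in> carrier K \<rightarrow> carrier Q"
  shows "tensor_functional P Q R H (tensor_map T K P Q (form_left T R \<beta>) (form_left K H \<tau>) x) y = B x y"
  using assms by (subst tensor_functional_tensor_map)
    (auto simp: B_def form_left_def zero_outside_def closed cong: sweedler_cong')

end

theorem theorem8p1: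
  fixes K :: "('k::field, 'a::ab_group_add) hopf"
    and H :: "('k, 'b::ab_group_add) hopf"
    and T :: "('k, 'c::ab_group_add, 'a) ydbialg"
    and R :: "('k, 'd::ab_group_add, 'b) ydbialg"
    and \<tau> :: "('a, 'b, 'k) tensor \<Rightarrow> 'k"
    and \<beta> :: "('c, 'd, 'k) tensor \<Rightarrow> 'k"
  assumes "hopf_algebra K" "bijective_antipode K"
    and "hopf_algebra H" "bijective_antipode H"
    and "yd_bialgebra K T" "yd_bialgebra H R"
    and "linear_form (tensor K H) \<tau>" "linear_form (tensor T R) \<beta>"
    and "conditions_A K H \<tau>"
    and "conditions_B H T R \<beta>"
    and "conditions_C K H T R \<tau> \<beta>"
  (* Conjunct 1: phi is bijective, so that phi_inv is its inverse.
     Conjuncts 2-6: (a), i.e. the three arrows, their composite, and (A.1)-(A.4).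
     Conjuncts 7-8: (b).  Conjuncts 9-10: (c). *)
  shows
    "(bij_betw (phi H R) (carrier (biproduct (yd_op H R) (op_bialg H)))
        (carrier (op_bialg (biproduct R H)))) \<and>
     (tensor_map T K (yd_dual (op_bialg H) (yd_op H R)) (finite_dual (op_bialg H))
          (form_left T R \<beta>) (form_left K H \<tau>)
        \<in> carrier (biproduct T K)
          \<rightarrow> carrier (biproduct (yd_dual (op_bialg H) (yd_op H R)) (finite_dual (op_bialg H)))) \<and>
     (theta H R
        \<in> carrier (biproduct (yd_dual (op_bialg H) (yd_op H R)) (finite_dual (op_bialg H)))
          \<rightarrow> carrier (finite_dual (biproduct (yd_op H R) (op_bialg H)))) \<and>
     (finite_dual_map (op_bialg (biproduct R H)) (biproduct (yd_op H R) (op_bialg H)) (phi_inv H R)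
        \<in> carrier (finite_dual (biproduct (yd_op H R) (op_bialg H)))
          \<rightarrow> carrier (finite_dual (op_bialg (biproduct R H)))) \<and>
     (\<forall>x\<in>carrier (biproduct T K).
        form_left (biproduct T K) (biproduct R H) (hash_form K H T R \<beta> \<tau>) x =
        finite_dual_map (op_bialg (biproduct R H)) (biproduct (yd_op H R) (op_bialg H)) (phi_inv H R)
          (theta H R
            (tensor_map T K (yd_dual (op_bialg H) (yd_op H R)) (finite_dual (op_bialg H))
              (form_left T R \<beta>) (form_left K H \<tau>) x))) \<and>
     (conditions_A (biproduct T K) (biproduct R H) (hash_form K H T R \<beta> \<tau>)) \<and>
     (\<forall>x\<in>carrier (biproduct T K).
        form_left (biproduct T K) (biproduct R H) (hash_form K H T R \<beta> \<tau>) x =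
        transpose (biproduct R H) (phi_inv H R)
          (tensor_functional (dual_space R) (dual_space H) R H
            (tensor_map T K (dual_space R) (dual_space H) (form_left T R \<beta>) (form_left K H \<tau>) x))) \<and>
     (\<forall>y\<in>carrier (biproduct R H).
        form_right (biproduct T K) (biproduct R H) (hash_form K H T R \<beta> \<tau>) y =
        tensor_functional (dual_space T) (dual_space K) T K
          (tensor_map R H (dual_space T) (dual_space K) (form_right T R \<beta>) (form_right K H \<tau>)
            (phi_inv H R y))) \<and>
     (left_nonsingular (biproduct T K) (biproduct R H) (hash_form K H T R \<beta> \<tau>) \<longleftrightarrow>
        left_nonsingular T R \<beta> \<and> left_nonsingular K H \<tau>) \<and>
     (right_nonsingular (biproduct T K) (biproduct R H) (hash_form K H T R \<beta> \<tau>) \<longleftrightarrow>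
        right_nonsingular T R \<beta> \<and> right_nonsingular K H \<tau>)"
proof -
  interpret yd_pairing K H T R \<tau> \<beta> by unfold_locales (fact assms)+
  let ?P = "yd_dual (op_bialg H) (yd_op H R)" and ?Q = "finite_dual (op_bialg H)"
  let ?A = "biproduct (yd_op H R) (op_bialg H)"
  have PQ: "is_vspace ?P" "is_vspace ?Q"
    using HR.op.is_vspace_yd_dual_space HR.op.H.is_vspace_finite_dual_space by auto
  have left: "form_left T R \<beta> \<in> carrier T \<rightarrow> carrier ?P" "form_left K H \<tau> \<in> carrier K \<rightarrow> carrier ?Q"
    by (auto simp: form_left_\<beta>_mem form_left_\<tau>_mem)
  have left': "form_left T R \<beta> \<in> carrier T \<rightarrow> carrier (dual_space R)"
      "form_left K H \<tau> \<in> carrier K \<rightarrow> carrier (dual_space H)"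
    by (auto intro: form_left_mem_dual \<beta> \<tau>)
  have right: "form_right T R \<beta> \<in> carrier R \<rightarrow> carrier (dual_space T)"
      "form_right K H \<tau> \<in> carrier H \<rightarrow> carrier (dual_space K)"
    by (auto intro: form_right_mem_dual \<beta> \<tau>)
  have 1: "bij_betw (phi H R) (carrier ?A) (carrier (op_bialg (biproduct R H)))"
    using HR.bij_betw_phi by simp
  \<comment> \<open>The duals are kept as records here: rewriting the target to a tensor product of
    the bare dual spaces would break the match with \<open>tensor_map_mem\<close>.\<close>
  have 2: "tensor_map T K ?P ?Q (form_left T R \<beta>) (form_left K H \<tau>) \<in> carrier (biproduct T K) \<rightarrow> carrier (biproduct ?P ?Q)"
    using left by (auto intro!: tensor_map_mem simp del: finite_dual_space_eq yd_dual_space_eq)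
  have 3: "theta H R \<in> carrier (biproduct ?P ?Q) \<rightarrow> carrier (finite_dual ?A)"
    using HR.theta_mem by auto
  have 4: "finite_dual_map (op_bialg (biproduct R H)) ?A (phi_inv H R)
      \<in> carrier (finite_dual ?A) \<rightarrow> carrier (finite_dual (op_bialg (biproduct R H)))"
    using HR.transpose_phi_inv_mem by auto
  have 5: "form_left (biproduct T K) (biproduct R H) hash x =
      finite_dual_map (op_bialg (biproduct R H)) ?A (phi_inv H R)
        (theta H R (tensor_map T K ?P ?Q (form_left T R \<beta>) (form_left K H \<tau>) x))"
    if x: "x \<in> carrier (biproduct T K)" for x
  proof -
    let ?X = "tensor_map T K ?P ?Q (form_left T R \<beta>) (form_left K H \<tau>) x"
    have X: "theta H R ?X \<in> carrier (finite_dual ?A)" using 2 3 x by blast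
    have "theta H R ?X y = B x y" if "y \<in> carrier (tensor R H)" for y
    proof -
      \<comment> \<open>\<open>theta\<close> is formed with the opposite structures, whose carriers
        and scalars are those of \<open>R\<close> and \<open>H\<close>; the simplifier identifies
        the two tensor products.\<close>
      have "theta H R ?X y = tensor_functional ?P ?Q R H ?X y"
        by (simp add: theta_def tensor_functional_def zero_outside_def)
      also have "\<dots> = B x y" using x that PQ left by (intro B_eq_tensor_functional) auto
      finally show ?thesis .
    qed
    thus ?thesis using x X
      by (auto simp: form_left_hash finite_dual_map_def transpose_def zero_outside_def HR.phi_inv_eq closed)
  qed
  have 7: "form_left (biproduct T K) (biproduct R H) hash x = transpose (biproduct R H) (phi_inv H R)
      (tensor_functional (dual_space R) (dual_space H) R H
        (tensor_map T K (dual_space R) (dual_space H) (form_left T R \<beta>) (form_left K H \<tau>) x))"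
    if x: "x \<in> carrier (biproduct T K)" for x
    using x left' by (auto simp: form_left_hash transpose_def zero_outside_def HR.phi_inv_eq closed
        B_eq_tensor_functional)
  have 8: "form_right (biproduct T K) (biproduct R H) hash y = tensor_functional (dual_space T) (dual_space K) T K
      (tensor_map R H (dual_space T) (dual_space K) (form_right T R \<beta>) (form_right K H \<tau>) (phi_inv H R y))"
    if y: "y \<in> carrier (biproduct R H)" for y
  proof
    fix x
    have "B x (HR.\<psi> y) = tensor_functional (dual_space T) (dual_space K) T K
      (tensor_map R H (dual_space T) (dual_space K) (form_right T R \<beta>) (form_right K H \<tau>) (HR.\<psi> y)) x"
      if x: "x \<in> carrier (tensor T K)"
      \<comment> \<open>\<open>B\<close> sums over the terms of \<open>x\<close> on the outside, the
        functional on the right over those of \<open>\<psi>(y)\<close>; the two finite sums are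
        interchanged.\<close>
      using x y right by (subst tensor_functional_tensor_map)
        (auto simp: B_def form_right_def zero_outside_def closed sweedler_swap[of T K x] cong: sweedler_cong')
    thus "form_right (biproduct T K) (biproduct R H) hash y x = tensor_functional (dual_space T) (dual_space K) T K
      (tensor_map R H (dual_space T) (dual_space K) (form_right T R \<beta>) (form_right K H \<tau>) (phi_inv H R y)) x"
      using y by (auto simp: form_right_hash zero_outside_def HR.phi_inv_eq tensor_functional_def)
  qed
  from 1 2 3 4 5 conditions_A_hash 7 8 left_nonsingular_hash right_nonsingular_hash
  show ?thesis by (intro conjI ballI)
qed

end
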